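(* Let $(\Omega,\mathcal F,\mathbb P,\theta)$ be a probability space with an invertible (measurable inverse), ergodic, $\mathbb P$-preserving map $\theta$, and let $\omega\mapsto\mathcal V_\omega=(\mathcal T_{a;\omega})_{a\in\mathcal A}$ be a random instrument as described in the context. Assume: (ESP) for $\mathbb P$-a.e. $\omega\in\Omega$ there is an integer $N_0(\omega)\in\mathbb N$ such that $\Phi^{(n)}_\omega$ is strictly positive for all $n\ge N_0(\omega)$. Then there exists a unique dynamically stationary state $\mathfrak s:\Omega\to\mathcal S_d$, i.e. a measurable map with $\Phi^{(n)}_\omega(\mathfrak s(\omega))=\mathfrak s(\theta^n\omega)$ for all $n\in\mathbb N$ ($\mathbb P$-a.s.). Moreover, for every random initial state $\vartheta:\Omega\to\mathcal S_d$, $\mathbb Q_{\vartheta(\omega);\omega}\ll\mathbb Q_{\mathfrak s(\omega);\omega}$ for $\mathbb P$-a.e. $\omega$. If in addition $\rho_{\mathbb P}(n)\to0$ as $n\to\infty$, then for every $\delta>0$ there exists a deterministic sequence $(r_n)_{n\ge1}\subseteq[0,\infty)$ with $\sum_{n\ge1}r_n^{\delta/(2+\delta)}<\infty$ such that for every random initial state $\vartheta:\Omega\to\mathcal S_d$ and every $n\in\mathbb N$, $$\beta_n(\vartheta):=\mathbb E_{\mathbb P}\Big[\big\|\Phi^{(n)}_\omega(\vartheta(\omega))-\mathfrak s(\theta^n\omega)\big\|_1\Big]\le r_n .$$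
   Context: Let $d\in\mathbb N$, $\mathcal H=\mathbb C^d$, $M_d$ the $d\times d$ complex matrices with trace norm $\|X\|_1=\operatorname{tr}|X|$, and $\mathcal S_d=\{\rho\in M_d:\rho\ge0,\ \operatorname{tr}\rho=1\}$ the set of states. A linear map $\phi:M_d\to M_d$ is strictly positive if it maps every nonzero positive semidefinite matrix to a positive definite matrix. Let $\mathcal A$ be a finite outcome set and $(\mathcal A^{\mathbb N},\Sigma)$ the sequence space with its product $\sigma$-algebra and coordinates $A_n(\bar a)=a_n$. A random instrument on $(\Omega,\mathcal F,\mathbb P)$ is a family $\mathcal T_{a;\omega}:M_d\to M_d$ ($a\in\mathcal A$, $\omega\in\Omega$) of completely positive, trace-non-increasing linear maps such that $\omega\mapsto\mathcal T_{a;\omega}$ is measurable for each $a$ and $\Phi_\omega:=\sum_{a}\mathcal T_{a;\omega}$ is trace preserving for $\mathbb P$-a.e. $\omega$. Put $\Phi_{k;\omega}:=\sum_a\mathcal T_{a;\theta^k\omega}$ and $\Phi^{(n)}_\omega:=\Phi_{n;\omega}\circ\cdots\circ\Phi_{1;\omega}$. For $\rho\in\mathcal S_d$ and $\omega\in\Omega$, the quenched law $\mathbb Q_{\rho;\omega}$ is the unique probability measure on $(\mathcal A^{\mathbb N},\Sigma)$ with $\mathbb Q_{\rho;\omega}(A_1=a_1,\dots,A_n=a_n)=\operatorname{tr}\big[(\mathcal T_{a_n;\theta^n\omega}\circ\cdots\circ\mathcal T_{a_1;\theta\omega})(\rho)\big]$. A random initial state is a measurable map $\vartheta:\Omega\to\mathcal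 S_d$. Mixing: let $\mathcal F_k:=\sigma(\omega\mapsto\mathcal V_{\theta^j\omega}: j\le k)$ and $\mathcal F^k:=\sigma(\omega\mapsto\mathcal V_{\theta^j\omega}: j\ge k)$; for sub-$\sigma$-algebras $\mathcal B,\mathcal C$, $\rho_{\mathbb P}(\mathcal B,\mathcal C)=\sup\{|\mathrm{Corr}_{\mathbb P}(U,V)|: U\in L^2(\mathcal B),V\in L^2(\mathcal C)\text{ nonconstant}\}$, and $\rho_{\mathbb P}(n):=\sup_{k\in\mathbb N}\rho_{\mathbb P}(\mathcal F_k,\mathcal F^{k+n})$. *)

theory Defs
  imports "HOL-Probability.Probability" "Jordan_Normal_Form.Matrix"
begin

definition adj :: "complex mat \<Rightarrow> complex mat" where
  "adj A = mat (dim_col A) (dim_row A) (\<lambda>(i,j). cnj (A $$ (j,i)))"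

definition mtrace :: "complex mat \<Rightarrow> complex" where
  "mtrace A = (\<Sum>i<dim_row A. A $$ (i,i))"

definition qform :: "complex mat \<Rightarrow> complex vec \<Rightarrow> complex" where
  "qform A v = (\<Sum>i<dim_vec v. cnj (v $ i) * (A *\<^sub>v v) $ i)"

definition psd :: "nat \<Rightarrow> complex mat \<Rightarrow> bool" where
  "psd n A \<longleftrightarrow> A \<in> carrier_mat n n \<and> adj A = A \<and>
     (\<forall>v \<in> carrier_vec n. 0 \<le> Re (qform A v))"

definition pd :: "nat \<Rightarrow> complex mat \<Rightarrow> bool" where
  "pd n A \<longleftrightarrow> A \<in> carrier_mat n n \<and> adj A = A \<and>
     (\<forall>v \<in> carrier_vec n. v \<noteq> 0\<^sub>v n \<longrightarrow> 0 < Re (qform A v))"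

definition states :: "nat \<Rightarrow> complex mat set" where
  "states d = {\<rho>. psd d \<rho> \<and> mtrace \<rho> = 1}"

definition psd_sqrt :: "nat \<Rightarrow> complex mat \<Rightarrow> complex mat" where
  "psd_sqrt n A = (THE B. psd n B \<and> B * B = A)"

definition mat_abs :: "complex mat \<Rightarrow> complex mat" where
  "mat_abs X = psd_sqrt (dim_col X) (adj X * X)"

definition trace_norm :: "complex mat \<Rightarrow> real" where
  "trace_norm X = Re (mtrace (mat_abs X))"

definition lin_map :: "nat \<Rightarrow> (complex mat \<Rightarrow> complex mat) \<Rightarrow> bool" where
  "lin_map d \<phi> \<longleftrightarrow>
     (\<forall>X \<in> carrier_mat d d. \<phi> X \<in> carrier_mat d d) \<and>
     (\<forall>X \<in> carrier_mat d d. \<forall>Y \<in> carrier_mat d d. \<phi> (X + Y) = \<phi> X + \<phi> Y) \<and>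
     (\<forall>X \<in> carrier_mat d d. \<forall>c. \<phi> (c \<cdot>\<^sub>m X) = c \<cdot>\<^sub>m \<phi> X)"

definition block_mat :: "nat \<Rightarrow> nat \<Rightarrow> (nat \<Rightarrow> nat \<Rightarrow> complex mat) \<Rightarrow> complex mat" where
  "block_mat k d B = mat (k * d) (k * d) (\<lambda>(i,j). B (i div d) (j div d) $$ (i mod d, j mod d))"

definition completely_positive :: "nat \<Rightarrow> (complex mat \<Rightarrow> complex mat) \<Rightarrow> bool" where
  "completely_positive d \<phi> \<longleftrightarrow> lin_map d \<phi> \<and>
     (\<forall>k B. (\<forall>i<k. \<forall>j<k. B i j \<in> carrier_mat d d) \<longrightarrow> psd (k * d) (block_mat k d B) \<longrightarrow>
        psd (k * d) (block_mat k d (\<lambda>i j. \<phi> (B i j))))"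

definition trace_non_increasing :: "nat \<Rightarrow> (complex mat \<Rightarrow> complex mat) \<Rightarrow> bool" where
  "trace_non_increasing d \<phi> \<longleftrightarrow> (\<forall>X. psd d X \<longrightarrow> Re (mtrace (\<phi> X)) \<le> Re (mtrace X))"

definition trace_preserving :: "nat \<Rightarrow> (complex mat \<Rightarrow> complex mat) \<Rightarrow> bool" where
  "trace_preserving d \<phi> \<longleftrightarrow> (\<forall>X \<in> carrier_mat d d. mtrace (\<phi> X) = mtrace X)"

definition strictly_positive :: "nat \<Rightarrow> (complex mat \<Rightarrow> complex mat) \<Rightarrow> bool" where
  "strictly_positive d \<phi> \<longleftrightarrow> (\<forall>X. psd d X \<and> X \<noteq> 0\<^sub>m d d \<longrightarrow> pd d (\<phi> X))"

definition unit_mat :: "nat \<Rightarrow> nat \<Rightarrow> nat \<Rightarrow> complex mat" where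
  "unit_mat d k l = mat d d (\<lambda>(i,j). if i = k \<and> j = l then 1 else 0)"

text \<open>Real coordinate functions of a linear map M_d -> M_d (entries of the images of matrix units);
  they generate the Borel structure on the space of such maps.\<close>
definition map_coords :: "nat \<Rightarrow> ((complex mat \<Rightarrow> complex mat) \<Rightarrow> real) set" where
  "map_coords d = {\<lambda>\<phi>. f (\<phi> (unit_mat d k l) $$ (i,j)) | f i j k l.
                      i < d \<and> j < d \<and> k < d \<and> l < d \<and> (f = Re \<or> f = Im)}"

definition mat_coords :: "nat \<Rightarrow> (complex mat \<Rightarrow> real) set" where
  "mat_coords d = {\<lambda>X. f (X $$ (i,j)) | f i j. i < d \<and> j < d \<and> (f = Re \<or> f = Im)}"

definition ergodic_mpt :: "'w measure \<Rightarrow> ('w \<Rightarrow> 'w) \<Rightarrow> bool" where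
  "ergodic_mpt M \<theta> \<longleftrightarrow>
     \<theta> \<in> M \<rightarrow>\<^sub>M M \<and>
     bij_betw \<theta> (space M) (space M) \<and> the_inv_into (space M) \<theta> \<in> M \<rightarrow>\<^sub>M M \<and>
     (\<forall>A \<in> sets M. measure M (\<theta> -` A \<inter> space M) = measure M A) \<and>
     (\<forall>A \<in> sets M. \<theta> -` A \<inter> space M = A \<longrightarrow> measure M A = 0 \<or> measure M A = 1)"

definition theta_pow :: "'w measure \<Rightarrow> ('w \<Rightarrow> 'w) \<Rightarrow> int \<Rightarrow> 'w \<Rightarrow> 'w" where
  "theta_pow M \<theta> j = (if 0 \<le> j then \<theta> ^^ nat j else the_inv_into (space M) \<theta> ^^ nat (- j))"

definition random_instrument ::
  "nat \<Rightarrow> 'w measure \<Rightarrow> ('b::finite \<Rightarrow> 'w \<Rightarrow> complex mat \<Rightarrow> complex mat) \<Rightarrow> bool" where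
  "random_instrument d M T \<longleftrightarrow>
     (\<forall>a \<omega>. completely_positive d (T a \<omega>) \<and> trace_non_increasing d (T a \<omega>)) \<and>
     (\<forall>a. \<forall>g \<in> map_coords d. (\<lambda>\<omega>. g (T a \<omega>)) \<in> borel_measurable M) \<and>
     (AE \<omega> in M. trace_preserving d (\<lambda>X. mat d d (\<lambda>(i,j). \<Sum>a\<in>UNIV. T a \<omega> X $$ (i,j))))"

definition Phi_k ::
  "nat \<Rightarrow> ('w \<Rightarrow> 'w) \<Rightarrow> ('b::finite \<Rightarrow> 'w \<Rightarrow> complex mat \<Rightarrow> complex mat) \<Rightarrow> nat \<Rightarrow> 'w \<Rightarrow> complex mat \<Rightarrow> complex mat" where
  "Phi_k d \<theta> T k \<omega> X = mat d d (\<lambda>(i,j). \<Sum>a\<in>UNIV. T a ((\<theta> ^^ k) \<omega>) X $$ (i,j))"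

primrec Phi_n ::
  "nat \<Rightarrow> ('w \<Rightarrow> 'w) \<Rightarrow> ('b::finite \<Rightarrow> 'w \<Rightarrow> complex mat \<Rightarrow> complex mat) \<Rightarrow> nat \<Rightarrow> 'w \<Rightarrow> complex mat \<Rightarrow> complex mat" where
  "Phi_n d \<theta> T 0 \<omega> X = X"
| "Phi_n d \<theta> T (Suc n) \<omega> X = Phi_k d \<theta> T (Suc n) \<omega> (Phi_n d \<theta> T n \<omega> X)"

text \<open>T_{a_n; theta^n omega} o ... o T_{a_1; theta omega}, where the outcome word
  a_1 ... a_n is encoded by as with as i = a_(i+1).\<close>
primrec instr_word ::
  "('w \<Rightarrow> 'w) \<Rightarrow> ('b \<Rightarrow> 'w \<Rightarrow> complex mat \<Rightarrow> complex mat) \<Rightarrow> (nat \<Rightarrow> 'b) \<Rightarrow> nat \<Rightarrow> 'w \<Rightarrow> complex mat \<Rightarrow> complex mat" where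
  "instr_word \<theta> T as 0 \<omega> X = X"
| "instr_word \<theta> T as (Suc n) \<omega> X = T (as n) ((\<theta> ^^ Suc n) \<omega>) (instr_word \<theta> T as n \<omega> X)"

text \<open>Sequence space A^N; coordinate A_(i+1) is the value at index i.\<close>
definition seq_space :: "(nat \<Rightarrow> 'b) measure" where
  "seq_space = PiM UNIV (\<lambda>_. count_space UNIV)"

definition quenched ::
  "('w \<Rightarrow> 'w) \<Rightarrow> ('b \<Rightarrow> 'w \<Rightarrow> complex mat \<Rightarrow> complex mat) \<Rightarrow> complex mat \<Rightarrow> 'w \<Rightarrow> (nat \<Rightarrow> 'b) measure" where
  "quenched \<theta> T \<rho> \<omega> = (THE Q. prob_space Q \<and> sets Q = sets seq_space \<and>
      (\<forall>n as. complex_of_real (measure Q {x \<in> space seq_space. \<forall>i<n. x i = as i})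
               = mtrace (instr_word \<theta> T as n \<omega> \<rho>)))"

definition random_state :: "nat \<Rightarrow> 'w measure \<Rightarrow> ('w \<Rightarrow> complex mat) \<Rightarrow> bool" where
  "random_state d M v \<longleftrightarrow> (\<forall>\<omega> \<in> space M. v \<omega> \<in> states d) \<and>
     (\<forall>g \<in> mat_coords d. (\<lambda>\<omega>. g (v \<omega>)) \<in> borel_measurable M)"

definition dyn_stationary ::
  "nat \<Rightarrow> 'w measure \<Rightarrow> ('w \<Rightarrow> 'w) \<Rightarrow> ('b::finite \<Rightarrow> 'w \<Rightarrow> complex mat \<Rightarrow> complex mat) \<Rightarrow> ('w \<Rightarrow> complex mat) \<Rightarrow> bool" where
  "dyn_stationary d M \<theta> T s \<longleftrightarrow> random_state d M s \<and>
     (AE \<omega> in M. \<forall>n. Phi_n d \<theta> T n \<omega> (s \<omega>) = s ((\<theta> ^^ n) \<omega>))"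

definition instr_gen ::
  "nat \<Rightarrow> 'w measure \<Rightarrow> ('w \<Rightarrow> 'w) \<Rightarrow> ('b \<Rightarrow> 'w \<Rightarrow> complex mat \<Rightarrow> complex mat) \<Rightarrow> int set \<Rightarrow> 'w set set" where
  "instr_gen d M \<theta> T J = {{\<omega> \<in> space M. g (T a (theta_pow M \<theta> j \<omega>)) \<in> B} | a j g B.
       j \<in> J \<and> g \<in> map_coords d \<and> B \<in> sets borel}"

definition past_alg where
  "past_alg d M \<theta> T k = sigma (space M) (instr_gen d M \<theta> T {j. j \<le> int k})"

definition future_alg where
  "future_alg d M \<theta> T k = sigma (space M) (instr_gen d M \<theta> T {j. int k \<le> j})"

definition L2_nonconst :: "'w measure \<Rightarrow> 'w measure \<Rightarrow> ('w \<Rightarrow> real) set" where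
  "L2_nonconst M B = {U. U \<in> borel_measurable B \<and> integrable M (\<lambda>\<omega>. (U \<omega>)\<^sup>2) \<and>
                         \<not> (\<exists>c. AE \<omega> in M. U \<omega> = c)}"

definition corr :: "'w measure \<Rightarrow> ('w \<Rightarrow> real) \<Rightarrow> ('w \<Rightarrow> real) \<Rightarrow> real" where
  "corr M U V =
     (integral\<^sup>L M (\<lambda>\<omega>. U \<omega> * V \<omega>) - integral\<^sup>L M U * integral\<^sup>L M V) /
     sqrt ((integral\<^sup>L M (\<lambda>\<omega>. (U \<omega>)\<^sup>2) - (integral\<^sup>L M U)\<^sup>2) *
           (integral\<^sup>L M (\<lambda>\<omega>. (V \<omega>)\<^sup>2) - (integral\<^sup>L M V)\<^sup>2))"

text \<open>Maximal correlation; the sup over the empty family is taken to be 0.\<close>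
definition max_corr :: "'w measure \<Rightarrow> 'w measure \<Rightarrow> 'w measure \<Rightarrow> real" where
  "max_corr M B C = Sup ({0} \<union> {\<bar>corr M U V\<bar> | U V. U \<in> L2_nonconst M B \<and> V \<in> L2_nonconst M C})"

definition rho_mix where
  "rho_mix d M \<theta> T n = (SUP k. max_corr M (past_alg d M \<theta> T k) (future_alg d M \<theta> T (k + n)))"

end

theory Submission
  imports Defs
begin

text \<open>
  A channel that is strictly positive dominates \<open>X \<mapsto> \<kappa> tr(X) 1\<close> for some \<open>\<kappa> > 0\<close>, by compactness.
  Subtracting this term does not change it on traceless matrices, but leaves a positive map that scales
  the trace by \<open>1 - \<kappa> d\<close>. Hence every block of steps on which the dynamics dominates contracts
  differences of states by that factor. The probability of such a block tends to one with its length,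
  and the probability that infinitely many of the (disjoint, stationary) blocks are good is at least
  that of a single one, so differences of states are forgotten almost surely. Started ever further in
  the past the dynamics therefore converges, and the limit is the unique stationary state \<open>s\<close>. Being an
  image under strictly positive maps, \<open>s\<close> is positive definite, so \<open>s = c \<rho> + (1 - c) \<sigma>\<close> for every
  state \<open>\<rho>\<close> with some \<open>c > 0\<close>, and quenched laws are affine in the initial state.

  For the rate let \<open>D n\<close> be the norm of the \<open>n\<close>-step dynamics on traceless matrices and \<open>b n\<close> its mean.
  Since \<open>D\<close> is submultiplicative, splitting at two times a distance \<open>m\<close> apart gives
  \<open>b (2 n + m) \<le> C (b n + \<rho> (m + 1)) b n\<close>. The bracket is as small as we please, so doubling \<open>n\<close>
  shrinks \<open>b n\<close> by an arbitrary factor: \<open>b\<close> decays faster than every power.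
\<close>

section \<open>Hermitian matrices and the trace norm\<close>

text \<open>Two obstacles shape the proof. A trace preserving positive map has norm at most
  \<open>K = 8 * d ^ 4\<close> on traceless matrices in the norm used here, not at most 1, so
  multiplying the norms of many blocks would lose a factor \<open>K\<close> for each. Contraction is
  therefore carried by a positive map that scales the trace by \<open>t\<close>: the factors
  \<open>t\<close> multiply exactly under composition, and \<open>K\<close> is paid once, when the
  composed map is finally measured in norm. For the same reason \<open>D\<close> and
  \<open>b\<close> are decreasing only up to the factor \<open>K\<close>. Moreover, forgetting along
  the forward orbit says nothing pointwise about the dynamics started \<open>n\<close> steps in the
  past and run up to the present: by invariance only the laws of the two norms agree. What survives
  is that the mean \<open>b n\<close> tends to 0. By Markov's inequality the norm from the past is
  then almost surely small for some \<open>n\<close>, and since an earlier start enlarges it by at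
  most \<open>K\<close>, it stays small from there on. This turns convergence in mean into almost
  sure convergence backwards in time.\<close>

definition cinner :: "nat \<Rightarrow> (nat \<Rightarrow> complex) \<Rightarrow> (nat \<Rightarrow> complex) \<Rightarrow> complex" where
  "cinner d f g = (\<Sum>i<d. cnj (f i) * g i)"

definition mat_apply :: "nat \<Rightarrow> complex mat \<Rightarrow> (nat \<Rightarrow> complex) \<Rightarrow> nat \<Rightarrow> complex" where
  "mat_apply d A f i = (\<Sum>j<d. A $$ (i,j) * f j)"

text \<open>\<open>qform\<close> over functions instead of \<open>vec\<close>. Only the values below
  \<open>d\<close> count, but functions on all naturals carry the product topology, which supplies
  Tychonoff compactness and a countable dense set.\<close>

definition herm_form :: "nat \<Rightarrow> complex mat \<Rightarrow> (nat \<Rightarrow> complex) \<Rightarrow> complex" where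
  "herm_form d A f = (\<Sum>i<d. \<Sum>j<d. cnj (f i) * A $$ (i,j) * f j)"

definition hermitian :: "nat \<Rightarrow> complex mat \<Rightarrow> bool" where
  "hermitian d A \<longleftrightarrow> (\<forall>i<d. \<forall>j<d. A $$ (i,j) = cnj (A $$ (j,i)))"

definition orthonormal :: "nat \<Rightarrow> nat \<Rightarrow> (nat \<Rightarrow> nat \<Rightarrow> complex) \<Rightarrow> bool" where
  "orthonormal d k u \<longleftrightarrow> (\<forall>m<k. \<forall>n<k. cinner d (u m) (u n) = of_bool (m = n))"

lemma qform_vec: "A \<in> carrier_mat d d \<Longrightarrow> qform A (vec d f) = herm_form d A f"
  unfolding qform_def herm_form_def
  by (auto simp: scalar_prod_def atLeast0LessThan sum_distrib_left mult.assoc intro!: sum.cong)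

lemma vec_eta: "v \<in> carrier_vec d \<Longrightarrow> v = vec d (\<lambda>i. v $ i)"
  by auto

lemma adj_eq_iff: "A \<in> carrier_mat d d \<Longrightarrow> adj A = A \<longleftrightarrow> hermitian d A"
proof -
  assume A: "A \<in> carrier_mat d d"
  have "adj A = A \<longleftrightarrow> (\<forall>i<d. \<forall>j<d. cnj (A $$ (j,i)) = A $$ (i,j))"
    using A unfolding adj_def by (auto simp: mat_eq_iff)
  also have "\<dots> \<longleftrightarrow> hermitian d A" unfolding hermitian_def by metis
  finally show ?thesis .
qed

lemma psd_iff: "psd d A \<longleftrightarrow> A \<in> carrier_mat d d \<and> hermitian d A \<and> (\<forall>f. 0 \<le> Re (herm_form d A f))"
proof -
  have "(\<forall>v \<in> carrier_vec d. 0 \<le> Re (qform A v)) \<longleftrightarrow> (\<forall>f. 0 \<le> Re (herm_form d A f))"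
    if "A \<in> carrier_mat d d" using that vec_eta by (metis qform_vec vec_carrier)
  then show ?thesis unfolding psd_def using adj_eq_iff by auto
qed

lemma psdI:
  "A \<in> carrier_mat d d \<Longrightarrow> (\<And>i j. i < d \<Longrightarrow> j < d \<Longrightarrow> A $$ (i,j) = cnj (A $$ (j,i))) \<Longrightarrow>
   (\<And>f. 0 \<le> Re (herm_form d A f)) \<Longrightarrow> psd d A"
  unfolding psd_iff hermitian_def by blast

lemma psd_carrier: "psd d A \<Longrightarrow> A \<in> carrier_mat d d"
  by (simp add: psd_def)

lemma cinner_self: "cinner d f f = of_real (\<Sum>i<d. (cmod (f i))\<^sup>2)"
  unfolding cinner_def of_real_sum
  by (rule sum.cong) (simp_all add: complex_norm_square[symmetric] mult.commute flip: of_real_power)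

lemma cinner_self_Re: "Re (cinner d f f) = (\<Sum>i<d. (cmod (f i))\<^sup>2)"
  unfolding cinner_self by simp

lemma cinner_self_nonneg: "0 \<le> Re (cinner d f f)"
  unfolding cinner_self_Re by (simp add: sum_nonneg)

lemma cinner_self_0: "Re (cinner d f f) = 0 \<longleftrightarrow> (\<forall>i<d. f i = 0)"
  unfolding cinner_self_Re by (subst sum_nonneg_eq_0_iff) auto

lemma cinner_cnj: "cinner d f g = cnj (cinner d g f)"
  unfolding cinner_def cnj_sum by (simp add: mult.commute)

lemma cinner_lin:
  "cinner d f (\<lambda>i. g i + h i) = cinner d f g + cinner d f h"
  "cinner d f (\<lambda>i. g i - h i) = cinner d f g - cinner d f h"
  "cinner d f (\<lambda>i. c * g i) = c * cinner d f g"
  "cinner d (\<lambda>i. g i + h i) f = cinner d g f + cinner d h f"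
  "cinner d (\<lambda>i. g i - h i) f = cinner d g f - cinner d h f"
  "cinner d (\<lambda>i. c * g i) f = cnj c * cinner d g f"
  unfolding cinner_def
  by (simp_all add: algebra_simps sum.distrib sum_subtractf sum_distrib_left)

lemma cinner_sum: "cinner d f (\<lambda>i. \<Sum>m<k. g m i) = (\<Sum>m<k. cinner d f (g m))"
  unfolding cinner_def by (simp add: sum_distrib_left) (rule sum.swap)

lemma cinner_cong: "(\<And>i. i < d \<Longrightarrow> f i = f' i) \<Longrightarrow> (\<And>i. i < d \<Longrightarrow> g i = g' i) \<Longrightarrow> cinner d f g = cinner d f' g'"
  unfolding cinner_def by auto

lemma herm_form_eq_cinner: "herm_form d A f = cinner d f (mat_apply d A f)"
  unfolding herm_form_def cinner_def mat_apply_def by (simp add: sum_distrib_left mult.assoc)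

lemma herm_form_cong: "(\<And>i. i < d \<Longrightarrow> f i = g i) \<Longrightarrow> herm_form d A f = herm_form d A g"
  unfolding herm_form_def by auto

lemma mat_apply_lin:
  "mat_apply d A (\<lambda>i. g i + h i) = (\<lambda>i. mat_apply d A g i + mat_apply d A h i)"
  "mat_apply d A (\<lambda>i. c * g i) = (\<lambda>i. c * mat_apply d A g i)"
  unfolding mat_apply_def by (auto simp: algebra_simps sum.distrib sum_distrib_left)

lemma herm_form_scale: "herm_form d A (\<lambda>i. c * f i) = of_real ((cmod c)\<^sup>2) * herm_form d A f"
proof -
  have "herm_form d A (\<lambda>i. c * f i) = cnj c * c * herm_form d A f"
    unfolding herm_form_eq_cinner mat_apply_lin cinner_lin by simp
  also have "cnj c * c = of_real ((cmod c)\<^sup>2)"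
    by (metis complex_norm_square mult.commute)
  finally show ?thesis .
qed

lemma hermitian_cinner:
  assumes "hermitian d A"
  shows "cinner d (mat_apply d A f) g = cinner d f (mat_apply d A g)"
proof -
  have "cinner d (mat_apply d A f) g = (\<Sum>i<d. \<Sum>j<d. cnj (f j) * (cnj (A $$ (i,j)) * g i))"
    unfolding cinner_def mat_apply_def by (simp add: sum_distrib_left sum_distrib_right mult_ac)
  also have "\<dots> = (\<Sum>j<d. \<Sum>i<d. cnj (f j) * (A $$ (j,i) * g i))"
    using assms unfolding hermitian_def by (subst sum.swap) (intro sum.cong refl, metis lessThan_iff)
  also have "\<dots> = cinner d f (mat_apply d A g)"
    unfolding cinner_def mat_apply_def by (simp add: sum_distrib_left)
  finally show ?thesis .
qed

text \<open>First-order condition at an extremum: for small \<open>t\<close> of the right sign the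
  linear term outweighs the quadratic one, whatever the sign of \<open>c\<close>.\<close>

lemma linear_quadratic_nonneg:
  fixes b c :: real
  assumes "\<And>t. 0 \<le> 2 * t * b + t\<^sup>2 * c" shows "b = 0"
proof (rule ccontr)
  assume b: "b \<noteq> 0"
  define e where "e = \<bar>c\<bar> + 1"
  have e: "e > 0" "c < 2 * e" unfolding e_def by auto
  have "2 * (- b / e) * b + (- b / e)\<^sup>2 * c = (b\<^sup>2 / e\<^sup>2) * (c - 2 * e)"
    using e by (simp add: field_simps power2_eq_square)
  also have "\<dots> < 0" using b e by (intro mult_pos_neg) auto
  finally show False using assms[of "- b / e"] by simp
qed

text \<open>\<open>r j\<close> is the \<open>j\<close>-th standard basis vector minus its projection
  onto the span of the \<open>u m\<close>, and the sum of the squared lengths is the trace of the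
  complementary projection. This replaces dimension theory: for \<open>k < d\<close> some residual
  is a nonzero vector orthogonal to the family, for \<open>k = d\<close> all of them vanish.\<close>

lemma orthonormal_residual:
  assumes u: "orthonormal d k u"
  defines "r \<equiv> \<lambda>j i. of_bool (i = j) - (\<Sum>m<k. cnj (u m j) * u m i)"
  shows "\<And>m j. m < k \<Longrightarrow> j < d \<Longrightarrow> cinner d (u m) (r j) = 0"
    and "(\<Sum>j<d. Re (cinner d (r j) (r j))) = real d - real k"
proof -
  have e: "cinner d f (\<lambda>i. of_bool (i = j)) = cnj (f j)" if "j < d" for f j
    using that unfolding cinner_def by (simp add: sum.delta if_distrib of_bool_def cong: if_cong)
  have s: "cinner d f (r j) = cnj (f j) - (\<Sum>m<k. cnj (u m j) * cinner d f (u m))" if "j < d" for f j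
    unfolding r_def cinner_lin cinner_sum e[OF that] by simp
  show o: "cinner d (u m) (r j) = 0" if "m < k" "j < d" for m j
  proof -
    have "(\<Sum>m'<k. cnj (u m' j) * cinner d (u m) (u m')) = (\<Sum>m'<k. cnj (u m' j) * of_bool (m = m'))"
      using u that(1) unfolding orthonormal_def by (intro sum.cong) auto
    then show ?thesis unfolding s[OF that(2)] using that(1)
      by (simp add: sum.delta if_distrib of_bool_def cong: if_cong)
  qed
  have "cinner d (r j) (r j) = 1 - (\<Sum>m<k. cnj (u m j) * u m j)" if "j < d" for j
  proof -
    have "cinner d (r j) (r j) = cnj (r j j) - (\<Sum>m<k. cnj (u m j) * cinner d (r j) (u m))"
      by (rule s[OF that])
    also have "(\<Sum>m<k. cnj (u m j) * cinner d (r j) (u m)) = 0"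
      using o[OF _ that] by (subst cinner_cnj) simp
    finally show ?thesis unfolding r_def by (simp add: cnj_sum mult.commute)
  qed
  then have "(\<Sum>j<d. cinner d (r j) (r j)) = (\<Sum>j<d. 1 - (\<Sum>m<k. cnj (u m j) * u m j))" by simp
  also have "\<dots> = of_nat d - (\<Sum>j<d. \<Sum>m<k. cnj (u m j) * u m j)" by (simp add: sum_subtractf)
  also have "(\<Sum>j<d. \<Sum>m<k. cnj (u m j) * u m j) = (\<Sum>m<k. cinner d (u m) (u m))"
    unfolding cinner_def by (rule sum.swap)
  also have "\<dots> = of_nat k" using u unfolding orthonormal_def by simp
  finally have "Re (\<Sum>j<d. cinner d (r j) (r j)) = Re (of_nat d - of_nat k)" by simp
  then show "(\<Sum>j<d. Re (cinner d (r j) (r j))) = real d - real k" by (simp add: Re_sum)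
qed

lemma orthonormal_complete:
  assumes u: "orthonormal d d u" and "i < d" "j < d"
  shows "(\<Sum>m<d. u m i * cnj (u m j)) = of_bool (i = j)"
proof -
  let ?r = "\<lambda>j i. of_bool (i = j) - (\<Sum>m<d. cnj (u m j) * u m i)"
  have "(\<Sum>j<d. Re (cinner d (?r j) (?r j))) = 0" using orthonormal_residual(2)[OF u] by simp
  then have "Re (cinner d (?r j) (?r j)) = 0" using \<open>j < d\<close>
    by (subst (asm) sum_nonneg_eq_0_iff) (auto simp: cinner_self_nonneg)
  then have "?r j i = 0" using \<open>i < d\<close> unfolding cinner_self_0 by blast
  then show ?thesis by (simp add: mult.commute)
qed

lemma entry_orthonormal:
  assumes u: "orthonormal d d u" and "i < d" "j < d"
  shows "A $$ (i,j) = (\<Sum>m<d. mat_apply d A (u m) i * cnj (u m j))"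
proof -
  have "A $$ (i,j) = (\<Sum>j'<d. A $$ (i,j') * of_bool (j' = j))"
    using assms by (simp add: of_bool_def if_distrib cong: if_cong)
  also have "\<dots> = (\<Sum>j'<d. A $$ (i,j') * (\<Sum>m<d. u m j' * cnj (u m j)))"
    using orthonormal_complete[OF u _ assms(3)] by (intro sum.cong) auto
  also have "\<dots> = (\<Sum>m<d. mat_apply d A (u m) i * cnj (u m j))"
    unfolding mat_apply_def sum_distrib_left sum_distrib_right mult.assoc by (rule sum.swap)
  finally show ?thesis .
qed

lemma orthonormal_norm1: "orthonormal d d u \<Longrightarrow> m < d \<Longrightarrow> (\<Sum>i<d. (cmod (u m i))\<^sup>2) = 1"
  using cinner_self_Re[of d "u m"] unfolding orthonormal_def by simp

lemma orthonormal_entry: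
  assumes "orthonormal d d u" "m < d" "i < d" shows "cmod (u m i) \<le> 1"
proof -
  have "(cmod (u m i))\<^sup>2 \<le> (\<Sum>i<d. (cmod (u m i))\<^sup>2)" using assms by (intro member_le_sum) auto
  then show ?thesis using orthonormal_norm1[OF assms(1,2)] by (simp add: abs_square_le_1)
qed

section \<open>Compactness of the unit sphere and the spectral theorem\<close>

lemma compact_unit_functions: "compact {f :: nat \<Rightarrow> complex. \<forall>i. cmod (f i) \<le> 1}"
proof -
  have "compactin (product_topology (\<lambda>i. euclidean) UNIV) (PiE UNIV (\<lambda>i::nat. cball (0::complex) 1))"
    unfolding compactin_PiE by auto
  moreover have "PiE UNIV (\<lambda>i::nat. cball (0::complex) 1) = {f. \<forall>i. cmod (f i) \<le> 1}"
    by (auto simp: PiE_def)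
  ultimately show ?thesis by (simp add: euclidean_product_topology)
qed

lemma coord_cont [continuous_intros]: "continuous_on S (\<lambda>f. f i)"
  by (rule continuous_on_product_coordinates[THEN continuous_on_subset]) simp

lemma cinner_cont [continuous_intros]: "continuous_on S (\<lambda>f. cinner d g f)"
  "continuous_on S (\<lambda>f. cinner d f f)" "continuous_on S (\<lambda>f. herm_form d A f)"
  unfolding cinner_def herm_form_def by (auto intro!: continuous_intros)

text \<open>The bound on every coordinate, including those from \<open>d\<close> on that
  \<open>cinner d\<close> ignores, is what makes this set compact.\<close>

definition usphere :: "nat \<Rightarrow> (nat \<Rightarrow> complex) set" where
  "usphere d = {f. (\<forall>i. cmod (f i) \<le> 1) \<and> cinner d f f = 1}"

lemma compact_usphere: "compact (usphere d)"
proof -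
  have "usphere d = {f. \<forall>i. cmod (f i) \<le> 1} \<inter> {f. cinner d f f = 1}" unfolding usphere_def by auto
  also have "compact \<dots>"
    by (intro compact_Int_closed compact_unit_functions closed_Collect_eq) (auto intro!: continuous_intros)
  finally show ?thesis .
qed

lemma normalise:
  assumes "Re (cinner d h h) \<noteq> 0"
  obtains f where "f \<in> usphere d" "\<And>i. i < d \<Longrightarrow> h i = of_real (sqrt (Re (cinner d h h))) * f i"
proof -
  define n where "n = Re (cinner d h h)"
  have n: "n > 0" using assms cinner_self_nonneg[of d h] unfolding n_def by linarith
  define f where "f i = (if i < d then of_real (1 / sqrt n) * h i else 0)" for i
  have "cinner d f f = cinner d (\<lambda>i. of_real (1 / sqrt n) * h i) (\<lambda>i. of_real (1 / sqrt n) * h i)"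
    by (rule cinner_cong) (auto simp: f_def)
  also have "\<dots> = of_real (1 / n) * cinner d h h" unfolding cinner_lin
    using n by (simp add: real_sqrt_divide flip: of_real_mult)
  also have "cinner d h h = of_real n" unfolding n_def cinner_self by simp
  finally have 1: "cinner d f f = 1" using n by simp
  have "(cmod (f i))\<^sup>2 \<le> 1" for i
  proof (cases "i < d")
    case True
    then have "(cmod (f i))\<^sup>2 \<le> (\<Sum>i<d. (cmod (f i))\<^sup>2)"
      by (intro member_le_sum) auto
    also have "\<dots> = 1" using 1 cinner_self_Re[of d f] by simp
    finally show ?thesis .
  qed (simp add: f_def)
  then have "f \<in> usphere d" using 1 by (simp add: usphere_def abs_square_le_1)
  moreover have "h i = of_real (sqrt n) * f i" if "i < d" for i
    using that n by (simp add: f_def)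
  ultimately show ?thesis using that unfolding n_def by blast
qed

text \<open>A maximiser of the quadratic form on the unit sphere of the orthogonal complement of the
  eigenvectors found so far is again an eigenvector.\<close>
lemma hermitian_next_eigenvector:
  assumes A: "hermitian d A" and u: "orthonormal d k u" and "k < d"
    and ev: "\<And>m i. m < k \<Longrightarrow> i < d \<Longrightarrow> mat_apply d A (u m) i = of_real (l m) * u m i"
  shows "\<exists>f c. cinner d f f = 1 \<and> (\<forall>m<k. cinner d (u m) f = 0) \<and> (\<forall>i<d. mat_apply d A f i = of_real c * f i)"
proof -
  define S where "S = usphere d \<inter> (\<Inter>m\<in>{..<k}. {f. cinner d (u m) f = 0})"
  have "compact S" unfolding S_def
    by (intro compact_Int_closed compact_usphere closed_INT ballI closed_Collect_eq)
       (auto intro!: continuous_intros)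
  \<comment> \<open>Both forms are homogeneous of degree 2, so every nonzero vector of the
    orthogonal complement can be compared with a point of \<open>S\<close>.\<close>
  have norml: "\<exists>f\<in>S. Re (herm_form d A h) = Re (cinner d h h) * Re (herm_form d A f)"
    if h: "Re (cinner d h h) \<noteq> 0" "\<forall>m<k. cinner d (u m) h = 0" for h
  proof -
    obtain f where f: "f \<in> usphere d"
      and herm_form: "\<And>i. i < d \<Longrightarrow> h i = of_real (sqrt (Re (cinner d h h))) * f i"
      using normalise[OF h(1)] by blast
    have "cinner d (u m) h = of_real (sqrt (Re (cinner d h h))) * cinner d (u m) f" for m
      unfolding cinner_lin(3)[symmetric] by (rule cinner_cong) (auto simp: herm_form)
    then have "f \<in> S" using f h unfolding S_def by auto
    moreover have "herm_form d A h = herm_form d A (\<lambda>i. of_real (sqrt (Re (cinner d h h))) * f i)"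
      by (rule herm_form_cong) (rule herm_form)
    then have "Re (herm_form d A h) = Re (cinner d h h) * Re (herm_form d A f)"
      unfolding herm_form_scale by (simp add: cinner_self_nonneg)
    ultimately show ?thesis by blast
  qed
  obtain h0 where h0: "Re (cinner d h0 h0) \<noteq> 0" "\<forall>m<k. cinner d (u m) h0 = 0"
  proof -
    let ?r = "\<lambda>j i. of_bool (i = j) - (\<Sum>m<k. cnj (u m j) * u m i)"
    have "\<exists>j<d. Re (cinner d (?r j) (?r j)) \<noteq> 0"
    proof (rule ccontr)
      assume "\<not> ?thesis"
      then have "(\<Sum>j<d. Re (cinner d (?r j) (?r j))) = 0" by (intro sum.neutral) auto
      with orthonormal_residual(2)[OF u] \<open>k < d\<close> show False by simp
    qed
    then obtain j where "j < d" "Re (cinner d (?r j) (?r j)) \<noteq> 0" by blast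
    with orthonormal_residual(1)[OF u] show ?thesis using that by blast
  qed
  from norml[OF this] have "S \<noteq> {}" by auto
  have "continuous_on S (\<lambda>f. Re (herm_form d A f))" by (intro continuous_intros)
  from continuous_attains_sup[OF \<open>compact S\<close> \<open>S \<noteq> {}\<close> this]
  obtain f where f: "f \<in> S" and max: "\<And>g. g \<in> S \<Longrightarrow> Re (herm_form d A g) \<le> Re (herm_form d A f)" by auto
  define c where "c = Re (herm_form d A f)"
  have ff: "cinner d f f = 1" and fo: "\<And>m. m < k \<Longrightarrow> cinner d (u m) f = 0" using f unfolding S_def usphere_def by auto
  have le: "Re (herm_form d A g) \<le> c * Re (cinner d g g)" if g: "\<forall>m<k. cinner d (u m) g = 0" for g
  proof (cases "Re (cinner d g g) = 0")
    case True
    then have "\<forall>i<d. g i = 0" unfolding cinner_self_0 .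
    then show ?thesis using True by (simp add: herm_form_def)
  next
    case False
    from norml[OF False g] max show ?thesis unfolding c_def
      by (metis cinner_self_nonneg mult.commute mult_left_mono)
  qed
  \<comment> \<open>\<open>r\<close> is half the gradient at \<open>f\<close> of
    \<open>c |g|^2 - <g, A g>\<close>, which is nonnegative on the complement and vanishes at
    \<open>f\<close>. Since \<open>r\<close> is itself orthogonal to the earlier eigenvectors,
    moving from \<open>f\<close> along \<open>r\<close> is admissible, and the linear term of that
    move is \<open>2 t |r|^2\<close>.\<close>
  define r where "r i = of_real c * f i - mat_apply d A f i" for i
  have ro: "cinner d (u m) r = 0" if "m < k" for m
  proof -
    have "cinner d (u m) (mat_apply d A f) = cinner d (mat_apply d A (u m)) f"
      using hermitian_cinner[OF A] by simp
    also have "\<dots> = cinner d (\<lambda>i. of_real (l m) * u m i) f"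
      by (rule cinner_cong) (auto simp: ev that)
    also have "\<dots> = 0" unfolding cinner_lin using fo[OF that] by simp
    finally show ?thesis unfolding r_def cinner_lin using fo[OF that] by simp
  qed
  have "Re (cinner d r r) = 0"
  proof (rule linear_quadratic_nonneg)
    fix t :: real
    let ?g = "\<lambda>i. f i + of_real t * r i"
    have "\<forall>m<k. cinner d (u m) ?g = 0" using fo ro by (simp add: cinner_lin)
    from le[OF this] have "0 \<le> c * Re (cinner d ?g ?g) - Re (herm_form d A ?g)" by simp
    also have "Re (cinner d ?g ?g) = 1 + 2 * t * Re (cinner d r f) + t\<^sup>2 * Re (cinner d r r)"
      using ff cinner_cnj[of d f r] unfolding cinner_lin by (simp add: power2_eq_square algebra_simps)
    also have "Re (herm_form d A ?g) = c + 2 * t * Re (cinner d r (mat_apply d A f)) + t\<^sup>2 * Re (herm_form d A r)"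
    proof -
      have "cinner d f (mat_apply d A r) = cnj (cinner d r (mat_apply d A f))"
        using hermitian_cinner[OF A, of f r] cinner_cnj by metis
      then show ?thesis unfolding herm_form_eq_cinner mat_apply_lin cinner_lin c_def
        by (simp add: power2_eq_square algebra_simps)
    qed
    also have "c * (1 + 2 * t * Re (cinner d r f) + t\<^sup>2 * Re (cinner d r r)) -
        (c + 2 * t * Re (cinner d r (mat_apply d A f)) + t\<^sup>2 * Re (herm_form d A r)) =
        2 * t * (c * Re (cinner d r f) - Re (cinner d r (mat_apply d A f))) + t\<^sup>2 * (c * Re (cinner d r r) - Re (herm_form d A r))"
      by (simp add: algebra_simps)
    also have "c * Re (cinner d r f) - Re (cinner d r (mat_apply d A f)) = Re (cinner d r r)"
    proof -
      have "cinner d r r = cinner d r (\<lambda>i. of_real c * f i - mat_apply d A f i)"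
        by (rule cinner_cong) (auto simp: r_def)
      then show ?thesis unfolding cinner_lin by simp
    qed
    finally show "0 \<le> 2 * t * Re (cinner d r r) + t\<^sup>2 * (c * Re (cinner d r r) - Re (herm_form d A r))" .
  qed
  then have "\<forall>i<d. mat_apply d A f i = of_real c * f i" unfolding cinner_self_0 r_def by auto
  with ff fo show ?thesis by blast
qed

lemma hermitian_eigenvectors:
  assumes A: "hermitian d A" and "k \<le> d"
  shows "\<exists>u l. orthonormal d k u \<and> (\<forall>m<k. \<forall>i<d. mat_apply d A (u m) i = of_real (l m) * u m i)"
  using \<open>k \<le> d\<close>
proof (induction k)
  case (Suc k)
  then obtain u l where u: "orthonormal d k u"
    and ev: "\<forall>m<k. \<forall>i<d. mat_apply d A (u m) i = of_real (l m) * u m i" by auto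
  from hermitian_next_eigenvector[OF A u, of l] ev Suc.prems obtain f c where
    f: "cinner d f f = 1" "\<forall>m<k. cinner d (u m) f = 0" "\<forall>i<d. mat_apply d A f i = of_real c * f i" by auto
  have f': "\<forall>m<k. cinner d f (u m) = 0" using f(2) by (subst cinner_cnj) simp
  have "orthonormal d (Suc k) (u(k := f))"
    using u f f' unfolding orthonormal_def by (auto simp: less_Suc_eq)
  moreover have "\<forall>m<Suc k. \<forall>i<d. mat_apply d A ((u(k := f)) m) i = of_real ((l(k := c)) m) * (u(k := f)) m i"
    using ev f by (auto simp: less_Suc_eq)
  ultimately show ?case by blast
qed (auto simp: orthonormal_def)

theorem hermitian_spectral:
  assumes A: "hermitian d A"
  obtains u l where "orthonormal d d u"
    and "\<And>m i. m < d \<Longrightarrow> i < d \<Longrightarrow> mat_apply d A (u m) i = of_real (l m) * u m i"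
    and "\<And>i j. i < d \<Longrightarrow> j < d \<Longrightarrow> A $$ (i,j) = (\<Sum>m<d. of_real (l m) * u m i * cnj (u m j))"
proof -
  obtain u l where u: "orthonormal d d u"
    and ev: "\<forall>m<d. \<forall>i<d. mat_apply d A (u m) i = of_real (l m) * u m i"
    using hermitian_eigenvectors[OF A order_refl] by blast
  then have "A $$ (i,j) = (\<Sum>m<d. of_real (l m) * u m i * cnj (u m j))" if "i < d" "j < d" for i j
    using entry_orthonormal[OF u that] that(1) by simp
  with u ev that show ?thesis by blast
qed

section \<open>Functional calculus, square roots and the trace norm\<close>

definition spec_mat :: "nat \<Rightarrow> (nat \<Rightarrow> nat \<Rightarrow> complex) \<Rightarrow> (nat \<Rightarrow> real) \<Rightarrow> complex mat" where
  "spec_mat d u l = mat d d (\<lambda>(i,j). \<Sum>m<d. of_real (l m) * u m i * cnj (u m j))"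

lemma spec_mat_carrier: "spec_mat d u l \<in> carrier_mat d d"
  unfolding spec_mat_def by simp

lemma spec_mat_hermitian: "hermitian d (spec_mat d u l)"
  unfolding spec_mat_def hermitian_def by (auto intro!: sum.cong)

text \<open>Orthonormality kills the cross terms, so matrix products act on eigenvalues alone;
  squares and absolute values can be taken there.\<close>

lemma spec_mat_mult:
  assumes u: "orthonormal d d u"
  shows "spec_mat d u l * spec_mat d u l' = spec_mat d u (\<lambda>m. l m * l' m)"
proof (rule eq_matI)
  fix i j assume "i < dim_row (spec_mat d u (\<lambda>m. l m * l' m))" "j < dim_col (spec_mat d u (\<lambda>m. l m * l' m))"
  then have ij: "i < d" "j < d" by (auto simp: spec_mat_def)
  have "(spec_mat d u l * spec_mat d u l') $$ (i,j) =
    (\<Sum>k<d. (\<Sum>m<d. of_real (l m) * u m i * cnj (u m k)) * (\<Sum>n<d. of_real (l' n) * u n k * cnj (u n j)))"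
    using ij unfolding spec_mat_def by (simp add: scalar_prod_def atLeast0LessThan)
  also have "\<dots> = (\<Sum>k<d. \<Sum>m<d. \<Sum>n<d. of_real (l m) * u m i * (of_real (l' n) * cnj (u n j)) * (cnj (u m k) * u n k))"
    unfolding sum_product by (simp add: mult_ac)
  also have "\<dots> = (\<Sum>m<d. \<Sum>k<d. \<Sum>n<d. of_real (l m) * u m i * (of_real (l' n) * cnj (u n j)) * (cnj (u m k) * u n k))"
    by (rule sum.swap)
  also have "\<dots> = (\<Sum>m<d. \<Sum>n<d. \<Sum>k<d. of_real (l m) * u m i * (of_real (l' n) * cnj (u n j)) * (cnj (u m k) * u n k))"
    by (intro sum.cong refl sum.swap)
  also have "\<dots> = (\<Sum>m<d. \<Sum>n<d. of_real (l m) * u m i * (of_real (l' n) * cnj (u n j)) * cinner d (u m) (u n))"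
    unfolding cinner_def sum_distrib_left by simp
  also have "\<dots> = (\<Sum>m<d. \<Sum>n<d. of_real (l m) * u m i * (of_real (l' n) * cnj (u n j)) * of_bool (m = n))"
    using u unfolding orthonormal_def by (intro sum.cong refl) auto
  also have "\<dots> = (\<Sum>m<d. of_real (l m * l' m) * u m i * cnj (u m j))"
    by (intro sum.cong refl) (simp add: sum.delta if_distrib of_bool_def mult_ac cong: if_cong)
  finally show "(spec_mat d u l * spec_mat d u l') $$ (i,j) = spec_mat d u (\<lambda>m. l m * l' m) $$ (i,j)"
    using ij unfolding spec_mat_def by simp
qed (auto simp: spec_mat_def)

lemma spec_mat_herm_form: "herm_form d (spec_mat d u l) f = (\<Sum>m<d. of_real (l m * (cmod (cinner d (u m) f))\<^sup>2))"
proof -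
  have "herm_form d (spec_mat d u l) f = (\<Sum>i<d. \<Sum>j<d. \<Sum>m<d. of_real (l m) * ((cnj (f i) * u m i) * (cnj (u m j) * f j)))"
    unfolding herm_form_def spec_mat_def
    by (intro sum.cong refl) (simp add: sum_distrib_left sum_distrib_right mult_ac)
  also have "\<dots> = (\<Sum>i<d. \<Sum>m<d. \<Sum>j<d. of_real (l m) * ((cnj (f i) * u m i) * (cnj (u m j) * f j)))"
    by (intro sum.cong refl sum.swap)
  also have "\<dots> = (\<Sum>m<d. \<Sum>i<d. \<Sum>j<d. of_real (l m) * ((cnj (f i) * u m i) * (cnj (u m j) * f j)))"
    by (rule sum.swap)
  also have "\<dots> = (\<Sum>m<d. of_real (l m) * (cinner d f (u m) * cinner d (u m) f))"
    unfolding cinner_def sum_product by (simp add: sum_distrib_left)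
  also have "\<dots> = (\<Sum>m<d. of_real (l m * (cmod (cinner d (u m) f))\<^sup>2))"
  proof (intro sum.cong refl)
    fix m
    have "cinner d f (u m) * cinner d (u m) f = of_real ((cmod (cinner d (u m) f))\<^sup>2)"
      by (subst cinner_cnj) (metis complex_norm_square mult.commute)
    then show "of_real (l m) * (cinner d f (u m) * cinner d (u m) f) = of_real (l m * (cmod (cinner d (u m) f))\<^sup>2)"
      by simp
  qed
  finally show ?thesis .
qed

lemma spec_mat_psd: "(\<And>m. m < d \<Longrightarrow> 0 \<le> l m) \<Longrightarrow> psd d (spec_mat d u l)"
  unfolding psd_iff spec_mat_herm_form
  by (auto simp: spec_mat_carrier spec_mat_hermitian Re_sum intro!: sum_nonneg)

lemma spec_mat_trace: "orthonormal d d u \<Longrightarrow> mtrace (spec_mat d u l) = of_real (\<Sum>m<d. l m)"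
proof -
  assume u: "orthonormal d d u"
  have "mtrace (spec_mat d u l) = (\<Sum>i<d. \<Sum>m<d. of_real (l m * (cmod (u m i))\<^sup>2))"
    unfolding mtrace_def spec_mat_def by (simp add: mult.assoc complex_norm_square[symmetric])
  also have "\<dots> = (\<Sum>m<d. of_real (l m * (\<Sum>i<d. (cmod (u m i))\<^sup>2)))"
    by (subst sum.swap) (simp add: sum_distrib_left)
  finally show ?thesis using orthonormal_norm1[OF u] by simp
qed

lemma spec_mat_mat_apply:
  assumes u: "orthonormal d d u" and "k < d" "i < d"
  shows "mat_apply d (spec_mat d u l) (u k) i = of_real (l k) * u k i"
proof -
  have "mat_apply d (spec_mat d u l) (u k) i = (\<Sum>j<d. \<Sum>m<d. of_real (l m) * u m i * (cnj (u m j) * u k j))"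
    unfolding mat_apply_def spec_mat_def using assms(3)
    by (simp add: sum_distrib_left sum_distrib_right mult_ac)
  also have "\<dots> = (\<Sum>m<d. of_real (l m) * u m i * cinner d (u m) (u k))"
    unfolding cinner_def sum_distrib_left by (rule sum.swap)
  also have "\<dots> = (\<Sum>m<d. of_real (l m) * u m i * of_bool (m = k))"
    using u \<open>k < d\<close> unfolding orthonormal_def by (intro sum.cong refl) auto
  finally show ?thesis using \<open>k < d\<close> by (simp add: of_bool_def if_distrib cong: if_cong)
qed

lemma mat_apply_mult:
  assumes "A \<in> carrier_mat d d" "B \<in> carrier_mat d d" "i < d"
  shows "mat_apply d (A * B) f i = mat_apply d A (mat_apply d B f) i"
proof -
  have "mat_apply d (A * B) f i = (\<Sum>j<d. \<Sum>k<d. A $$ (i,k) * (B $$ (k,j) * f j))"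
    unfolding mat_apply_def using assms
    by (auto simp: scalar_prod_def atLeast0LessThan sum_distrib_left sum_distrib_right mult.assoc intro!: sum.cong)
  also have "\<dots> = (\<Sum>k<d. \<Sum>j<d. A $$ (i,k) * (B $$ (k,j) * f j))" by (rule sum.swap)
  finally show ?thesis unfolding mat_apply_def by (simp add: sum_distrib_left)
qed

lemma mat_eqI_eigenbasis:
  assumes "A \<in> carrier_mat d d" "B \<in> carrier_mat d d" and u: "orthonormal d d u"
    and eq: "\<And>m i. m < d \<Longrightarrow> i < d \<Longrightarrow> mat_apply d A (u m) i = mat_apply d B (u m) i"
  shows "A = B"
proof (rule eq_matI)
  fix i j assume "i < dim_row B" "j < dim_col B"
  then show "A $$ (i,j) = B $$ (i,j)" using entry_orthonormal[OF u, of i j] eq assms(2) by auto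
qed (use assms in auto)

text \<open>On an eigenvector of \<open>B * B\<close> with eigenvalue \<open>c\<^sup>2\<close> the factorisation
  \<open>(B + c) (B - c) = 0\<close> and positivity force eigenvalue \<open>c\<close> for \<open>B\<close>.\<close>
lemma psd_sqrt_unique:
  assumes u: "orthonormal d d u" and l: "\<And>m. m < d \<Longrightarrow> 0 \<le> l m"
    and B: "psd d B" and BB: "B * B = spec_mat d u (\<lambda>m. l m * l m)"
  shows "B = spec_mat d u l"
proof (rule mat_eqI_eigenbasis[OF psd_carrier[OF B] spec_mat_carrier u])
  fix m i assume m: "m < d" "i < d"
  have BC: "B \<in> carrier_mat d d" and H: "hermitian d B" and pos: "\<And>f. 0 \<le> Re (herm_form d B f)"
    using B by (auto simp: psd_iff)
  have sq: "mat_apply d B (mat_apply d B (u m)) i = of_real (l m * l m) * u m i" if "i < d" for i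
    using mat_apply_mult[OF BC BC that, of "u m"] spec_mat_mat_apply[OF u m(1) that, of "\<lambda>m. l m * l m"] BB by simp
  define w where "w i = mat_apply d B (u m) i + of_real (- l m) * u m i" for i
  have w_eq: "w = (\<lambda>i. mat_apply d B (u m) i + of_real (- l m) * u m i)" by (simp add: w_def fun_eq_iff)
  have Bw: "mat_apply d B w i = - of_real (l m) * w i" if "i < d" for i
    unfolding w_eq mat_apply_lin using sq[OF that] by (simp add: algebra_simps)
  have hw: "herm_form d B w = - of_real (l m) * cinner d w w"
  proof -
    have "herm_form d B w = cinner d w (\<lambda>i. - of_real (l m) * w i)"
      unfolding herm_form_eq_cinner by (rule cinner_cong) (auto simp: Bw)
    then show ?thesis by (simp only: cinner_lin)
  qed
  \<comment> \<open>\<open>w\<close> is \<open>(B - l m)\<close> applied to \<open>u m\<close>. For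
    \<open>l m > 0\<close> positivity of \<open><w, B w> = - l m |w|^2\<close> forces
    \<open>w = 0\<close>. For \<open>l m = 0\<close> it gives nothing, but then
    \<open>|w|^2 = <u m, B w>\<close> because \<open>B\<close> is hermitian, and
    \<open>B w = 0\<close>.\<close>
  have "Re (cinner d w w) = 0"
  proof (cases "l m = 0")
    case True
    have w: "w = mat_apply d B (u m)" unfolding w_def using True by simp
    have "cinner d w w = cinner d (u m) (mat_apply d B w)" unfolding w by (rule hermitian_cinner[OF H])
    also have "\<dots> = cinner d (u m) (\<lambda>i. 0)" by (rule cinner_cong) (use Bw True in auto)
    finally show ?thesis by (simp add: cinner_def)
  next
    case False
    with l[OF m(1)] have "l m > 0" by simp
    moreover have "0 \<le> - l m * Re (cinner d w w)" using pos[of w] hw by simp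
    ultimately show ?thesis using cinner_self_nonneg[of d w] by (simp add: mult_le_0_iff)
  qed
  then have "w i = 0" using m(2) unfolding cinner_self_0 by blast
  then show "mat_apply d B (u m) i = mat_apply d (spec_mat d u l) (u m) i"
    unfolding spec_mat_mat_apply[OF u m] w_def by simp
qed

text \<open>The trace norm is the sum of the absolute eigenvalues, and each eigenvalue is the
  quadratic form at a unit vector, whose entries have modulus at most 1. All estimates are made with
  entries; this lemma returns to the trace norm at the very end.\<close>

lemma trace_norm_hermitian_le:
  assumes X: "X \<in> carrier_mat d d" and H: "hermitian d X"
  shows "trace_norm X \<le> real d * (\<Sum>i<d. \<Sum>j<d. cmod (X $$ (i,j)))"
proof -
  obtain u l where u: "orthonormal d d u"
    and ev: "\<And>m i. m < d \<Longrightarrow> i < d \<Longrightarrow> mat_apply d X (u m) i = of_real (l m) * u m i"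
    and dec: "\<And>i j. i < d \<Longrightarrow> j < d \<Longrightarrow> X $$ (i,j) = (\<Sum>m<d. of_real (l m) * u m i * cnj (u m j))"
    by (rule hermitian_spectral[OF H]) blast
  have Xs: "X = spec_mat d u l"
    by (rule eq_matI) (use X dec in \<open>auto simp: spec_mat_def\<close>)
  have "adj X * X = spec_mat d u (\<lambda>m. \<bar>l m\<bar> * \<bar>l m\<bar>)"
    using adj_eq_iff[OF X] H spec_mat_mult[OF u, of l l] Xs by simp
  then have abs: "mat_abs X = spec_mat d u (\<lambda>m. \<bar>l m\<bar>)"
    using X unfolding mat_abs_def psd_sqrt_def
    by (intro the_equality) (auto simp: spec_mat_mult[OF u] intro: spec_mat_psd psd_sqrt_unique[OF u])
  have "trace_norm X = (\<Sum>m<d. \<bar>l m\<bar>)"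
    unfolding trace_norm_def abs spec_mat_trace[OF u] by simp
  also have "\<dots> \<le> (\<Sum>m<d. \<Sum>i<d. \<Sum>j<d. cmod (X $$ (i,j)))"
  proof (rule sum_mono)
    fix m assume "m \<in> {..<d}"
    then have m: "m < d" by simp
    have "herm_form d X (u m) = cinner d (u m) (\<lambda>i. of_real (l m) * u m i)"
      unfolding herm_form_eq_cinner by (rule cinner_cong) (auto simp: ev m)
    also have "\<dots> = of_real (l m)" using u m unfolding cinner_lin orthonormal_def by simp
    finally have "\<bar>l m\<bar> = cmod (herm_form d X (u m))" by simp
    also have "\<dots> \<le> (\<Sum>i<d. \<Sum>j<d. cmod (cnj (u m i) * X $$ (i,j) * u m j))"
      unfolding herm_form_def by (rule order_trans[OF norm_sum]) (intro sum_mono norm_sum)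
    also have "\<dots> \<le> (\<Sum>i<d. \<Sum>j<d. cmod (X $$ (i,j)))"
    proof (intro sum_mono)
      fix i j assume "i \<in> {..<d}" "j \<in> {..<d}"
      then have "cmod (u m i) * cmod (u m j) * cmod (X $$ (i,j)) \<le> 1 * cmod (X $$ (i,j))"
        using orthonormal_entry[OF u m] by (intro mult_right_mono mult_le_one) auto
      then show "cmod (cnj (u m i) * X $$ (i,j) * u m j) \<le> cmod (X $$ (i,j))"
        by (simp add: norm_mult mult_ac)
    qed
    finally show "\<bar>l m\<bar> \<le> (\<Sum>i<d. \<Sum>j<d. cmod (X $$ (i,j)))" .
  qed
  finally show ?thesis by simp
qed

section \<open>Positive maps and their contraction on traceless matrices\<close>

lemma mtrace_add: "A \<in> carrier_mat d d \<Longrightarrow> B \<in> carrier_mat d d \<Longrightarrow> mtrace (A + B) = mtrace A + mtrace B"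
  unfolding mtrace_def by (simp add: sum.distrib)

lemma mtrace_minus: "A \<in> carrier_mat d d \<Longrightarrow> B \<in> carrier_mat d d \<Longrightarrow> mtrace (A - B) = mtrace A - mtrace B"
  unfolding mtrace_def by (simp add: sum_subtractf)

lemma mtrace_smult: "A \<in> carrier_mat d d \<Longrightarrow> mtrace (c \<cdot>\<^sub>m A) = c * mtrace A"
  unfolding mtrace_def by (simp add: sum_distrib_left)

lemma herm_form_minus: "A \<in> carrier_mat d d \<Longrightarrow> B \<in> carrier_mat d d \<Longrightarrow> herm_form d (A - B) f = herm_form d A f - herm_form d B f"
  unfolding herm_form_def by (simp add: algebra_simps sum_subtractf)

lemma herm_form_smult: "A \<in> carrier_mat d d \<Longrightarrow> herm_form d (c \<cdot>\<^sub>m A) f = c * herm_form d A f"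
  unfolding herm_form_def by (simp add: algebra_simps sum_distrib_left)

lemma psd_spectral:
  assumes "psd d X"
  obtains u l where "orthonormal d d u" "\<And>m. m < d \<Longrightarrow> 0 \<le> l m" "X = spec_mat d u l"
proof -
  have X: "X \<in> carrier_mat d d" and H: "hermitian d X" and p: "\<And>f. 0 \<le> Re (herm_form d X f)"
    using assms by (auto simp: psd_iff)
  obtain u l where u: "orthonormal d d u"
    and ev: "\<And>m i. m < d \<Longrightarrow> i < d \<Longrightarrow> mat_apply d X (u m) i = of_real (l m) * u m i"
    and dec: "\<And>i j. i < d \<Longrightarrow> j < d \<Longrightarrow> X $$ (i,j) = (\<Sum>m<d. of_real (l m) * u m i * cnj (u m j))"
    by (rule hermitian_spectral[OF H]) blast
  have "0 \<le> l m" if m: "m < d" for m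
  proof -
    have "herm_form d X (u m) = cinner d (u m) (\<lambda>i. of_real (l m) * u m i)"
      unfolding herm_form_eq_cinner by (rule cinner_cong) (auto simp: ev m)
    also have "\<dots> = of_real (l m)" using u m unfolding cinner_lin orthonormal_def by simp
    finally show ?thesis using p[of "u m"] by simp
  qed
  moreover have "X = spec_mat d u l"
    by (rule eq_matI) (use X dec in \<open>auto simp: spec_mat_def\<close>)
  ultimately show ?thesis using u that by blast
qed

lemma psd_trace: "psd d X \<Longrightarrow> mtrace X = of_real (Re (mtrace X))" "psd d X \<Longrightarrow> 0 \<le> Re (mtrace X)"
  by (metis psd_spectral spec_mat_trace Re_complex_of_real)
     (metis psd_spectral spec_mat_trace Re_complex_of_real sum_nonneg lessThan_iff)

lemma psd_entry_le:
  assumes X: "psd d X" and "i < d" "j < d"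
  shows "cmod (X $$ (i,j)) \<le> Re (mtrace X)"
proof -
  obtain u l where u: "orthonormal d d u" and l: "\<And>m. m < d \<Longrightarrow> 0 \<le> l m" and Xs: "X = spec_mat d u l"
    by (rule psd_spectral[OF X]) blast
  have "cmod (X $$ (i,j)) \<le> (\<Sum>m<d. cmod (of_real (l m) * u m i * cnj (u m j)))"
    unfolding Xs spec_mat_def using assms by (simp add: norm_sum)
  also have "\<dots> \<le> (\<Sum>m<d. l m)"
  proof (rule sum_mono)
    fix m assume "m \<in> {..<d}"
    then have m: "m < d" by simp
    have "l m * (cmod (u m i) * cmod (u m j)) \<le> l m * 1"
      using l m assms orthonormal_entry[OF u m] by (intro mult_left_mono mult_le_one) auto
    then show "cmod (of_real (l m) * u m i * cnj (u m j)) \<le> l m"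
      using l[OF m] by (simp add: norm_mult mult.assoc)
  qed
  finally show ?thesis unfolding Xs spec_mat_trace[OF u] by simp
qed

text \<open>A state is dominated by a multiple of the identity. The crude constant
  \<open>d^2\<close> comes from bounding all entries by the trace.\<close>

lemma psd_herm_form_le:
  assumes X: "psd d X"
  shows "Re (herm_form d X f) \<le> (real d)\<^sup>2 * Re (mtrace X) * Re (cinner d f f)"
proof -
  have le: "cmod (f i) * cmod (f j) \<le> Re (cinner d f f)" if "i < d" "j < d" for i j
  proof -
    have "(cmod (f i))\<^sup>2 \<le> Re (cinner d f f)" "(cmod (f j))\<^sup>2 \<le> Re (cinner d f f)"
      unfolding cinner_self_Re using that by (intro member_le_sum; auto)+
    moreover have "2 * (cmod (f i) * cmod (f j)) \<le> (cmod (f i))\<^sup>2 + (cmod (f j))\<^sup>2"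
      using sum_squares_bound[of "cmod (f i)" "cmod (f j)"] by (simp add: mult.assoc)
    ultimately show ?thesis by linarith
  qed
  have "Re (herm_form d X f) \<le> cmod (herm_form d X f)" by (rule complex_Re_le_cmod)
  also have "\<dots> \<le> (\<Sum>i<d. \<Sum>j<d. cmod (cnj (f i) * X $$ (i,j) * f j))"
    unfolding herm_form_def by (rule order_trans[OF norm_sum]) (intro sum_mono norm_sum)
  also have "\<dots> \<le> (\<Sum>i<d. \<Sum>j<d. Re (mtrace X) * Re (cinner d f f))"
  proof (intro sum_mono)
    fix i j assume ij: "i \<in> {..<d}" "j \<in> {..<d}"
    have "cmod (X $$ (i,j)) * (cmod (f i) * cmod (f j)) \<le> Re (mtrace X) * Re (cinner d f f)"
      using ij psd_entry_le[OF X] le psd_trace(2)[OF X] by (intro mult_mono) auto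
    then show "cmod (cnj (f i) * X $$ (i,j) * f j) \<le> Re (mtrace X) * Re (cinner d f f)"
      by (simp add: norm_mult mult_ac)
  qed
  finally show ?thesis by (simp add: power2_eq_square mult.assoc)
qed

definition rank_one :: "nat \<Rightarrow> (nat \<Rightarrow> complex) \<Rightarrow> complex mat" where
  "rank_one d f = mat d d (\<lambda>(i,j). f i * cnj (f j))"

lemma rank_one_carrier: "rank_one d f \<in> carrier_mat d d" unfolding rank_one_def by simp

lemma rank_one_herm_form: "herm_form d (rank_one d f) g = of_real ((cmod (cinner d f g))\<^sup>2)"
proof -
  have "herm_form d (rank_one d f) g = cinner d g f * cinner d f g"
    unfolding herm_form_def rank_one_def cinner_def sum_product by (intro sum.cong refl) (auto simp: mult_ac)
  also have "\<dots> = of_real ((cmod (cinner d f g))\<^sup>2)"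
    by (subst cinner_cnj) (metis complex_norm_square mult.commute)
  finally show ?thesis .
qed

lemma rank_one_psd: "psd d (rank_one d f)"
  by (rule psdI[OF rank_one_carrier]) (simp_all add: rank_one_herm_form, simp add: rank_one_def)

lemma rank_one_trace: "mtrace (rank_one d f) = cinner d f f"
  unfolding mtrace_def rank_one_def cinner_def by (simp add: mult.commute)

section \<open>Linear and positive maps on matrices\<close>

lemma lin_mapD:
  assumes "lin_map d \<phi>"
  shows "X \<in> carrier_mat d d \<Longrightarrow> \<phi> X \<in> carrier_mat d d"
    "X \<in> carrier_mat d d \<Longrightarrow> Y \<in> carrier_mat d d \<Longrightarrow> \<phi> (X + Y) = \<phi> X + \<phi> Y"
    "X \<in> carrier_mat d d \<Longrightarrow> \<phi> (c \<cdot>\<^sub>m X) = c \<cdot>\<^sub>m \<phi> X"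
  using assms unfolding lin_map_def by auto

lemma lin_map_comp: "lin_map d \<phi> \<Longrightarrow> lin_map d \<psi> \<Longrightarrow> lin_map d (\<lambda>X. \<phi> (\<psi> X))"
  unfolding lin_map_def by simp

lemma lin_map_id: "lin_map d (\<lambda>X. X)"
  unfolding lin_map_def by simp

lemma lin_map_minus:
  assumes "lin_map d \<phi>" "X \<in> carrier_mat d d" "Y \<in> carrier_mat d d"
  shows "\<phi> (X - Y) = \<phi> X - \<phi> Y"
proof -
  have e: "A - B = A + (-1) \<cdot>\<^sub>m B" if "A \<in> carrier_mat d d" "B \<in> carrier_mat d d" for A B :: "complex mat"
    using that by (intro eq_matI) auto
  show ?thesis using assms lin_mapD[OF assms(1)] e by simp
qed

lemma unit_mat_carrier: "unit_mat d k l \<in> carrier_mat d d"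
  unfolding unit_mat_def by simp

lemma lin_map_entry:
  assumes L: "lin_map d \<phi>" and X: "X \<in> carrier_mat d d" and "i < d" "j < d"
  shows "\<phi> X $$ (i,j) = (\<Sum>k<d. \<Sum>l<d. X $$ (k,l) * \<phi> (unit_mat d k l) $$ (i,j))"
proof -
  \<comment> \<open>\<open>XS S\<close> keeps only the entries of \<open>X\<close> with index in
    \<open>S\<close>. Growing \<open>S\<close> by one index at a time reduces the expansion to the
    binary additivity in \<open>lin_map\<close>.\<close>
  define XS where "XS S = mat d d (\<lambda>p. if p \<in> S then X $$ p else 0)" for S
  have XS: "XS S \<in> carrier_mat d d" for S unfolding XS_def by simp
  have "\<phi> (XS S) $$ (i,j) = (\<Sum>p\<in>S. X $$ p * \<phi> (unit_mat d (fst p) (snd p)) $$ (i,j))"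
    if "finite S" for S
    using that
  proof (induction S)
    case empty
    have "XS {} = 0 \<cdot>\<^sub>m XS {}" by (rule eq_matI) (auto simp: XS_def)
    then have "\<phi> (XS {}) = 0 \<cdot>\<^sub>m \<phi> (XS {})" using lin_mapD(3)[OF L XS] by metis
    then have "\<phi> (XS {}) $$ (i,j) = (0 \<cdot>\<^sub>m \<phi> (XS {})) $$ (i,j)" by metis
    then show ?case using lin_mapD(1)[OF L XS[of "{}"]] assms by simp
  next
    case (insert p S)
    have "XS (insert p S) = XS S + X $$ p \<cdot>\<^sub>m unit_mat d (fst p) (snd p)"
      using insert.hyps by (intro eq_matI) (auto simp: XS_def unit_mat_def)
    then have "\<phi> (XS (insert p S)) = \<phi> (XS S) + X $$ p \<cdot>\<^sub>m \<phi> (unit_mat d (fst p) (snd p))"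
      using lin_mapD[OF L] XS unit_mat_carrier by simp
    moreover have "\<phi> (unit_mat d (fst p) (snd p)) \<in> carrier_mat d d" "\<phi> (XS S) \<in> carrier_mat d d"
      using lin_mapD(1)[OF L] XS unit_mat_carrier by auto
    ultimately show ?case using insert assms by simp
  qed
  from this[of "{..<d} \<times> {..<d}"]
  have "\<phi> (XS ({..<d} \<times> {..<d})) $$ (i,j) = (\<Sum>k<d. \<Sum>l<d. X $$ (k,l) * \<phi> (unit_mat d k l) $$ (i,j))"
    by (simp add: sum.cartesian_product case_prod_unfold)
  moreover have "XS ({..<d} \<times> {..<d}) = X" unfolding XS_def using X by (intro eq_matI) auto
  ultimately show ?thesis by simp
qed

definition pos_map :: "nat \<Rightarrow> (complex mat \<Rightarrow> complex mat) \<Rightarrow> bool" where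
  "pos_map d \<phi> \<longleftrightarrow> lin_map d \<phi> \<and> (\<forall>X. psd d X \<longrightarrow> psd d (\<phi> X))"

lemma pos_map_comp: "pos_map d \<phi> \<Longrightarrow> pos_map d \<psi> \<Longrightarrow> pos_map d (\<lambda>X. \<phi> (\<psi> X))"
  unfolding pos_map_def using lin_map_comp by simp

lemma pos_map_id: "pos_map d (\<lambda>X. X)"
  unfolding pos_map_def by (simp add: lin_map_id)

text \<open>A block matrix with a single block is that block, so positivity is the case
  \<open>k = 1\<close>.\<close>

lemma cp_pos_map:
  assumes "completely_positive d \<phi>" shows "pos_map d \<phi>"
proof -
  have L: "lin_map d \<phi>" using assms unfolding completely_positive_def by simp
  have b: "block_mat 1 d (\<lambda>_ _. X) = X" if "X \<in> carrier_mat d d" for X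
    using that unfolding block_mat_def by (intro eq_matI) auto
  have "psd d (\<phi> X)" if X: "psd d X" for X
  proof -
    have "psd (1 * d) (block_mat 1 d (\<lambda>_ _. \<phi> X))"
    proof -
      have "psd (1 * d) (block_mat 1 d (\<lambda>_ _. X))" using X b[OF psd_carrier[OF X]] by simp
      then show ?thesis
        using assms[unfolded completely_positive_def, THEN conjunct2, rule_format, of 1 "\<lambda>_ _. X"] psd_carrier[OF X]
        by simp
    qed
    then show ?thesis using b[OF lin_mapD(1)[OF L psd_carrier[OF X]]] by simp
  qed
  with L show ?thesis unfolding pos_map_def by simp
qed

lemma herm_form_sum: "herm_form d (mat d d (\<lambda>(i,j). \<Sum>a\<in>S. F a $$ (i,j))) f = (\<Sum>a\<in>S. herm_form d (F a) f)"
proof -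
  have "herm_form d (mat d d (\<lambda>(i,j). \<Sum>a\<in>S. F a $$ (i,j))) f = (\<Sum>i<d. \<Sum>j<d. \<Sum>a\<in>S. cnj (f i) * F a $$ (i,j) * f j)"
    unfolding herm_form_def by (intro sum.cong refl) (simp add: sum_distrib_left sum_distrib_right)
  also have "\<dots> = (\<Sum>i<d. \<Sum>a\<in>S. \<Sum>j<d. cnj (f i) * F a $$ (i,j) * f j)"
    by (intro sum.cong refl sum.swap)
  also have "\<dots> = (\<Sum>a\<in>S. herm_form d (F a) f)" unfolding herm_form_def by (rule sum.swap)
  finally show ?thesis .
qed

lemma pos_map_sum:
  assumes "\<And>a. a \<in> S \<Longrightarrow> pos_map d (F a)"
  shows "pos_map d (\<lambda>X. mat d d (\<lambda>(i,j). \<Sum>a\<in>S. F a X $$ (i,j)))"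
proof -
  have L: "lin_map d (F a)" if "a \<in> S" for a using assms that by (simp add: pos_map_def)
  have "lin_map d (\<lambda>X. mat d d (\<lambda>(i,j). \<Sum>a\<in>S. F a X $$ (i,j)))"
    unfolding lin_map_def
  proof (intro conjI ballI allI)
    fix X Y :: "complex mat" assume XY: "X \<in> carrier_mat d d" "Y \<in> carrier_mat d d"
    show "mat d d (\<lambda>(i,j). \<Sum>a\<in>S. F a (X + Y) $$ (i,j)) =
      mat d d (\<lambda>(i,j). \<Sum>a\<in>S. F a X $$ (i,j)) + mat d d (\<lambda>(i,j). \<Sum>a\<in>S. F a Y $$ (i,j))"
    proof (rule eq_matI, goal_cases)
      case (1 i j)
      have "(F a X + F a Y) $$ (i,j) = F a X $$ (i,j) + F a Y $$ (i,j)" if "a \<in> S" for a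
        using 1 lin_mapD(1)[OF L[OF that] XY(2)] by simp
      then show ?case using 1 XY lin_mapD(2)[OF L] by (simp add: sum.distrib)
    qed auto
  next
    fix X :: "complex mat" and c :: complex assume X: "X \<in> carrier_mat d d"
    show "mat d d (\<lambda>(i,j). \<Sum>a\<in>S. F a (c \<cdot>\<^sub>m X) $$ (i,j)) =
      c \<cdot>\<^sub>m mat d d (\<lambda>(i,j). \<Sum>a\<in>S. F a X $$ (i,j))"
    proof (rule eq_matI, goal_cases)
      case (1 i j)
      have "(c \<cdot>\<^sub>m F a X) $$ (i,j) = c * F a X $$ (i,j)" if "a \<in> S" for a
        using 1 lin_mapD(1)[OF L[OF that] X] by simp
      then show ?case using 1 X lin_mapD(3)[OF L] by (simp add: sum_distrib_left)
    qed auto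
  qed simp
  moreover have "psd d (mat d d (\<lambda>(i,j). \<Sum>a\<in>S. F a X $$ (i,j)))" if X: "psd d X" for X
  proof (rule psdI)
    fix i j assume "i < d" "j < d"
    then have "F a X $$ (i,j) = cnj (F a X $$ (j,i))" if "a \<in> S" for a
      using assms[OF that] X unfolding pos_map_def psd_iff hermitian_def by blast
    with \<open>i < d\<close> \<open>j < d\<close> show "mat d d (\<lambda>(i,j). \<Sum>a\<in>S. F a X $$ (i,j)) $$ (i,j) =
        cnj (mat d d (\<lambda>(i,j). \<Sum>a\<in>S. F a X $$ (i,j)) $$ (j,i))"
      by (simp add: cnj_sum cong: sum.cong)
  next
    fix f show "0 \<le> Re (herm_form d (mat d d (\<lambda>(i,j). \<Sum>a\<in>S. F a X $$ (i,j))) f)"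
      unfolding herm_form_sum Re_sum using assms X by (intro sum_nonneg) (auto simp: pos_map_def psd_iff)
  qed simp
  ultimately show ?thesis unfolding pos_map_def by blast
qed

section \<open>A norm for maps on the traceless matrices\<close>

definition enorm :: "nat \<Rightarrow> complex mat \<Rightarrow> real" where
  "enorm d X = (\<Sum>i<d. \<Sum>j<d. cmod (X $$ (i,j)))"

text \<open>Subtracting the corner unit from the diagonal ones removes their trace; these matrices
  span the traceless ones.\<close>

definition traceless_unit :: "nat \<Rightarrow> nat \<Rightarrow> nat \<Rightarrow> complex mat" where
  "traceless_unit d k l = unit_mat d k l - of_bool (k = l) \<cdot>\<^sub>m unit_mat d 0 0"

text \<open>Stands in for the operator norm on the traceless subspace. As a finite sum of moduli of
  entries it is visibly measurable when the map is random, and it is still submultiplicative when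
  the inner map preserves vanishing trace.\<close>

definition dnorm :: "nat \<Rightarrow> (complex mat \<Rightarrow> complex mat) \<Rightarrow> real" where
  "dnorm d \<phi> = (\<Sum>k<d. \<Sum>l<d. enorm d (\<phi> (traceless_unit d k l)))"

lemma traceless_unit_carrier: "traceless_unit d k l \<in> carrier_mat d d"
  unfolding traceless_unit_def by (intro minus_carrier_mat smult_carrier_mat unit_mat_carrier)

lemma lin_map_traceless_unit:
  assumes L: "lin_map d \<phi>" and "i < d" "j < d"
  shows "\<phi> (traceless_unit d k l) $$ (i,j) = \<phi> (unit_mat d k l) $$ (i,j) - of_bool (k = l) * \<phi> (unit_mat d 0 0) $$ (i,j)"
proof -
  have c: "dim_row (\<phi> (unit_mat d 0 0)) = d" "dim_col (\<phi> (unit_mat d 0 0)) = d"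
    using lin_mapD(1)[OF L unit_mat_carrier] by auto
  have "\<phi> (traceless_unit d k l) = \<phi> (unit_mat d k l) - of_bool (k = l) \<cdot>\<^sub>m \<phi> (unit_mat d 0 0)"
    unfolding traceless_unit_def lin_map_minus[OF L unit_mat_carrier smult_carrier_mat[OF unit_mat_carrier]]
      lin_mapD(3)[OF L unit_mat_carrier] ..
  then show ?thesis using c assms by simp
qed

lemma enorm_nonneg: "0 \<le> enorm d X" unfolding enorm_def by (simp add: sum_nonneg)

lemma dnorm_nonneg: "0 \<le> dnorm d \<phi>" unfolding dnorm_def by (simp add: sum_nonneg enorm_nonneg)

lemma entry_le_enorm: "i < d \<Longrightarrow> j < d \<Longrightarrow> cmod (X $$ (i,j)) \<le> enorm d X"
proof -
  assume "i < d" "j < d"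
  then have "cmod (X $$ (i,j)) \<le> (\<Sum>j<d. cmod (X $$ (i,j)))" by (intro member_le_sum) auto
  also have "\<dots> \<le> enorm d X" unfolding enorm_def using \<open>i < d\<close>
    by (intro member_le_sum[where f="\<lambda>i. \<Sum>j<d. cmod (X $$ (i,j))"]) (auto intro: sum_nonneg)
  finally show ?thesis .
qed

lemma mtrace_traceless_unit: "k < d \<Longrightarrow> l < d \<Longrightarrow> mtrace (traceless_unit d k l) = 0"
  unfolding traceless_unit_def mtrace_minus[OF unit_mat_carrier smult_carrier_mat[OF unit_mat_carrier]]
    mtrace_smult[OF unit_mat_carrier]
  unfolding mtrace_def unit_mat_def by (auto simp: sum.If_cases sum.delta)

lemma sum4_swap:
  fixes g :: "'a \<Rightarrow> 'b \<Rightarrow> 'c \<Rightarrow> 'd \<Rightarrow> 'e::comm_monoid_add"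
  shows "(\<Sum>i\<in>A. \<Sum>j\<in>B. \<Sum>k\<in>C. \<Sum>l\<in>D. g i j k l) = (\<Sum>k\<in>C. \<Sum>l\<in>D. \<Sum>i\<in>A. \<Sum>j\<in>B. g i j k l)"
proof -
  have "(\<Sum>i\<in>A. \<Sum>j\<in>B. \<Sum>k\<in>C. \<Sum>l\<in>D. g i j k l) = (\<Sum>i\<in>A. \<Sum>k\<in>C. \<Sum>j\<in>B. \<Sum>l\<in>D. g i j k l)"
    by (intro sum.cong refl sum.swap)
  also have "\<dots> = (\<Sum>k\<in>C. \<Sum>i\<in>A. \<Sum>j\<in>B. \<Sum>l\<in>D. g i j k l)" by (rule sum.swap)
  also have "\<dots> = (\<Sum>k\<in>C. \<Sum>i\<in>A. \<Sum>l\<in>D. \<Sum>j\<in>B. g i j k l)"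
    by (intro sum.cong refl sum.swap)
  also have "\<dots> = (\<Sum>k\<in>C. \<Sum>l\<in>D. \<Sum>i\<in>A. \<Sum>j\<in>B. g i j k l)"
    by (intro sum.cong refl sum.swap)
  finally show ?thesis .
qed

text \<open>Expanding \<open>X\<close> in the matrices \<open>traceless_unit d k l\<close> instead
  of the matrix units changes it by \<open>mtrace X\<close> times the corner unit, hence not at
  all.\<close>

lemma enorm_dnorm:
  assumes L: "lin_map d \<phi>" and X: "X \<in> carrier_mat d d" and t0: "mtrace X = 0"
  shows "enorm d (\<phi> X) \<le> dnorm d \<phi> * enorm d X"
proof -
  have e: "\<phi> X $$ (i,j) = (\<Sum>k<d. \<Sum>l<d. X $$ (k,l) * \<phi> (traceless_unit d k l) $$ (i,j))" if ij: "i < d" "j < d" for i j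
  proof -
    have tb: "\<phi> (traceless_unit d k l) $$ (i,j) = \<phi> (unit_mat d k l) $$ (i,j) - of_bool (k = l) * \<phi> (unit_mat d 0 0) $$ (i,j)" for k l
      by (rule lin_map_traceless_unit[OF L ij])
    have "(\<Sum>k<d. \<Sum>l<d. X $$ (k,l) * (of_bool (k = l) * \<phi> (unit_mat d 0 0) $$ (i,j))) =
      (\<Sum>k<d. X $$ (k,k) * \<phi> (unit_mat d 0 0) $$ (i,j))"
    proof (intro sum.cong refl)
      fix k assume "k \<in> {..<d}"
      have "(\<Sum>l<d. X $$ (k,l) * (of_bool (k = l) * \<phi> (unit_mat d 0 0) $$ (i,j))) =
        (\<Sum>l<d. if l = k then X $$ (k,k) * \<phi> (unit_mat d 0 0) $$ (i,j) else 0)"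
        by (intro sum.cong) auto
      then show "(\<Sum>l<d. X $$ (k,l) * (of_bool (k = l) * \<phi> (unit_mat d 0 0) $$ (i,j))) =
        X $$ (k,k) * \<phi> (unit_mat d 0 0) $$ (i,j)"
        using \<open>k \<in> {..<d}\<close> by (simp add: sum.delta)
    qed
    also have "\<dots> = mtrace X * \<phi> (unit_mat d 0 0) $$ (i,j)"
      unfolding mtrace_def using X by (simp add: sum_distrib_right)
    finally show ?thesis unfolding tb using lin_map_entry[OF L X ij] t0
      by (simp add: right_diff_distrib sum_subtractf)
  qed
  have "enorm d (\<phi> X) \<le> (\<Sum>i<d. \<Sum>j<d. \<Sum>k<d. \<Sum>l<d. enorm d X * cmod (\<phi> (traceless_unit d k l) $$ (i,j)))"
    unfolding enorm_def[of d "\<phi> X"]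
  proof (intro sum_mono)
    fix i j assume ij: "i \<in> {..<d}" "j \<in> {..<d}"
    have "cmod (\<phi> X $$ (i,j)) \<le> (\<Sum>k<d. \<Sum>l<d. cmod (X $$ (k,l) * \<phi> (traceless_unit d k l) $$ (i,j)))"
      using e ij by (auto intro!: order_trans[OF norm_sum] sum_mono norm_sum)
    also have "\<dots> \<le> (\<Sum>k<d. \<Sum>l<d. enorm d X * cmod (\<phi> (traceless_unit d k l) $$ (i,j)))"
      unfolding norm_mult by (intro sum_mono mult_right_mono entry_le_enorm) auto
    finally show "cmod (\<phi> X $$ (i,j)) \<le> (\<Sum>k<d. \<Sum>l<d. enorm d X * cmod (\<phi> (traceless_unit d k l) $$ (i,j)))" .
  qed
  also have "\<dots> = enorm d X * (\<Sum>i<d. \<Sum>j<d. \<Sum>k<d. \<Sum>l<d. cmod (\<phi> (traceless_unit d k l) $$ (i,j)))"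
    by (simp add: sum_distrib_left)
  also have "(\<Sum>i<d. \<Sum>j<d. \<Sum>k<d. \<Sum>l<d. cmod (\<phi> (traceless_unit d k l) $$ (i,j))) = dnorm d \<phi>"
    unfolding dnorm_def enorm_def by (rule sum4_swap)
  finally show ?thesis by (simp add: mult.commute)
qed

lemma dnorm_comp:
  assumes "lin_map d \<phi>" "lin_map d \<psi>"
    and t0: "\<And>X. X \<in> carrier_mat d d \<Longrightarrow> mtrace X = 0 \<Longrightarrow> mtrace (\<psi> X) = 0"
  shows "dnorm d (\<lambda>X. \<phi> (\<psi> X)) \<le> dnorm d \<phi> * dnorm d \<psi>"
proof -
  have "enorm d (\<phi> (\<psi> (traceless_unit d k l))) \<le> dnorm d \<phi> * enorm d (\<psi> (traceless_unit d k l))" if "k < d" "l < d" for k l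
    using that t0[OF traceless_unit_carrier mtrace_traceless_unit]
    by (intro enorm_dnorm[OF assms(1)] lin_mapD(1)[OF assms(2)] traceless_unit_carrier) auto
  then have "dnorm d (\<lambda>X. \<phi> (\<psi> X)) \<le> (\<Sum>k<d. \<Sum>l<d. dnorm d \<phi> * enorm d (\<psi> (traceless_unit d k l)))"
    unfolding dnorm_def by (intro sum_mono) auto
  then show ?thesis unfolding dnorm_def[of d \<psi>] by (simp add: sum_distrib_left)
qed

section \<open>Contraction through positive maps that scale the trace\<close>

definition contracts :: "nat \<Rightarrow> (complex mat \<Rightarrow> complex mat) \<Rightarrow> real \<Rightarrow> bool" where
  "contracts d \<phi> t \<longleftrightarrow> (\<exists>\<psi>. pos_map d \<psi> \<and> (\<forall>X\<in>carrier_mat d d. mtrace (\<psi> X) = of_real t * mtrace X) \<and>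
     (\<forall>X\<in>carrier_mat d d. mtrace X = 0 \<longrightarrow> \<phi> X = \<psi> X))"

text \<open>Scaling the trace keeps traceless matrices traceless, so agreement there survives
  composition while the scaling factors multiply.\<close>

lemma contracts_comp:
  assumes "contracts d \<phi> s" "contracts d \<psi> t" shows "contracts d (\<lambda>X. \<phi> (\<psi> X)) (s * t)"
proof -
  obtain \<phi>' where 1: "pos_map d \<phi>'" "\<forall>X\<in>carrier_mat d d. mtrace (\<phi>' X) = of_real s * mtrace X"
    "\<forall>X\<in>carrier_mat d d. mtrace X = 0 \<longrightarrow> \<phi> X = \<phi>' X" using assms(1) unfolding contracts_def by blast
  obtain \<psi>' where 2: "pos_map d \<psi>'" "\<forall>X\<in>carrier_mat d d. mtrace (\<psi>' X) = of_real t * mtrace X"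
    "\<forall>X\<in>carrier_mat d d. mtrace X = 0 \<longrightarrow> \<psi> X = \<psi>' X" using assms(2) unfolding contracts_def by blast
  have c: "\<psi>' X \<in> carrier_mat d d" if "X \<in> carrier_mat d d" for X
    using 2(1) that unfolding pos_map_def by (auto dest: lin_mapD(1))
  show ?thesis unfolding contracts_def
    by (rule exI[of _ "\<lambda>X. \<phi>' (\<psi>' X)"]) (use 1 2 c pos_map_comp in auto)
qed

lemma contracts_1: "pos_map d \<phi> \<Longrightarrow> trace_preserving d \<phi> \<Longrightarrow> contracts d \<phi> 1"
  unfolding contracts_def trace_preserving_def by (rule exI[of _ \<phi>]) auto

text \<open>Polarisation: the rank-one matrix of \<open>e_k + c e_l\<close> is weighted by
  \<open>c\<close> and averaged over the fourth roots of unity, which leaves only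
  \<open>e_k e_l^*\<close>. It expresses matrix units through positive matrices, on which a positive
  map is controlled by the trace.\<close>

lemma unit_mat_polar:
  assumes "k < d" "l < d"
  shows "unit_mat d k l = (1/4) \<cdot>\<^sub>m (rank_one d (\<lambda>i. of_bool (i = k) + of_bool (i = l)) +
     ((-1) \<cdot>\<^sub>m rank_one d (\<lambda>i. of_bool (i = k) - of_bool (i = l)) +
     (\<i> \<cdot>\<^sub>m rank_one d (\<lambda>i. of_bool (i = k) + \<i> * of_bool (i = l)) +
     (-\<i>) \<cdot>\<^sub>m rank_one d (\<lambda>i. of_bool (i = k) - \<i> * of_bool (i = l)))))"
  by (rule eq_matI) (use assms in \<open>auto simp: rank_one_def unit_mat_def of_bool_def algebra_simps\<close>)

text \<open>The trace is 2 for distinct indices; the bound 4 also covers \<open>k = l\<close>, where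
  the vector is \<open>(1 + c) e_k\<close>.\<close>

lemma rank_one_pair_trace:
  assumes "k < d" "l < d" "cmod c = 1"
  shows "Re (mtrace (rank_one d (\<lambda>i. of_bool (i = k) + c * of_bool (i = l)))) \<le> 4"
proof -
  have "Re (mtrace (rank_one d (\<lambda>i. of_bool (i = k) + c * of_bool (i = l)))) =
     (\<Sum>i<d. (cmod (of_bool (i = k) + c * of_bool (i = l)))\<^sup>2)"
    unfolding rank_one_trace cinner_self_Re ..
  also have "\<dots> \<le> (\<Sum>i<d. 2 * of_bool (i = k) + 2 * of_bool (i = l))"
  proof (rule sum_mono)
    fix i
    have "cmod (1 + c) \<le> 2" using norm_triangle_ineq[of 1 c] assms by simp
    then have "(cmod (1 + c))\<^sup>2 \<le> 2\<^sup>2" by (intro power_mono) auto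
    then show "(cmod (of_bool (i = k) + c * of_bool (i = l)))\<^sup>2 \<le> 2 * of_bool (i = k) + 2 * of_bool (i = l)"
      using assms by (auto simp: of_bool_def)
  qed
  also have "\<dots> = 4"
  proof -
    have "(\<Sum>i<d. of_bool (i = m)) = (1::real)" if "m < d" for m
      using that by (simp add: of_bool_def sum.delta)
    then show ?thesis using assms unfolding sum.distrib sum_distrib_left[symmetric] by simp
  qed
  finally show ?thesis .
qed

text \<open>The image of a positive matrix has entries bounded by its trace, here at most
  \<open>4 t\<close> on the four rank-one matrices of the polarisation and so also on their average.
  A traceless unit is a difference of at most two matrix units, giving \<open>8 t\<close>, and
  \<open>d^4\<close> such entries are added up.\<close>

lemma contracts_dnorm:
  assumes "contracts d \<phi> t" "0 \<le> t" "0 < d"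
  shows "dnorm d \<phi> \<le> 8 * real d ^ 4 * t"
proof -
  obtain \<psi> where P: "pos_map d \<psi>" and tr: "\<And>X. X\<in>carrier_mat d d \<Longrightarrow> mtrace (\<psi> X) = of_real t * mtrace X"
    and eq: "\<And>X. X\<in>carrier_mat d d \<Longrightarrow> mtrace X = 0 \<Longrightarrow> \<phi> X = \<psi> X" using assms(1) unfolding contracts_def by blast
  have L: "lin_map d \<psi>" using P by (simp add: pos_map_def)
  have rb: "cmod (\<psi> (rank_one d f) $$ (i,j)) \<le> t * Re (mtrace (rank_one d f))" if "i < d" "j < d" for i j f
    using psd_entry_le[of d "\<psi> (rank_one d f)" i j] that P rank_one_psd tr[OF rank_one_carrier]
    unfolding pos_map_def by auto
  have rb4: "cmod (\<psi> (rank_one d (\<lambda>i. of_bool (i = k) + c * of_bool (i = l))) $$ (i,j)) \<le> 4 * t"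
    if "i < d" "j < d" "k < d" "l < d" "cmod c = 1" for i j k l c
    using order_trans[OF rb[OF that(1,2)] mult_left_mono[OF rank_one_pair_trace[OF that(3-5)] \<open>0 \<le> t\<close>]]
    by (simp only: mult.commute)
  have E: "cmod (\<psi> (unit_mat d k l) $$ (i,j)) \<le> 4 * t" if ij: "i < d" "j < d" and kl: "k < d" "l < d" for i j k l
  proof -
    define r where "r c = \<psi> (rank_one d (\<lambda>i. of_bool (i = k) + c * of_bool (i = l)))" for c
    have c: "r c \<in> carrier_mat d d" for c unfolding r_def by (rule lin_mapD(1)[OF L rank_one_carrier])
    have "\<psi> (unit_mat d k l) = (1/4) \<cdot>\<^sub>m (r 1 + ((-1) \<cdot>\<^sub>m r (-1) + (\<i> \<cdot>\<^sub>m r \<i> + (-\<i>) \<cdot>\<^sub>m r (-\<i>))))"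
      unfolding unit_mat_polar[OF kl] r_def using rank_one_carrier by (simp add: lin_mapD[OF L])
    then have "\<psi> (unit_mat d k l) $$ (i,j) = (1/4) * (r 1 $$ (i,j) + ((-1) * r (-1) $$ (i,j) +
       (\<i> * r \<i> $$ (i,j) + (-\<i>) * r (-\<i>) $$ (i,j))))"
      using c[of 1] c[of "-1"] c[of \<i>] c[of "-\<i>"] ij by simp
    also have "cmod \<dots> \<le> (1/4) * (cmod (r 1 $$ (i,j)) + (cmod (r (-1) $$ (i,j)) +
       (cmod (r \<i> $$ (i,j)) + cmod (r (-\<i>) $$ (i,j)))))"
    proof -
      have "cmod (a + ((-1) * b + (\<i> * x + (-\<i>) * y))) \<le> cmod a + (cmod b + (cmod x + cmod y))" for a b x y
        using norm_triangle_ineq[of a "(-1) * b + (\<i> * x + (-\<i>) * y)"]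
          norm_triangle_ineq[of "(-1) * b" "\<i> * x + (-\<i>) * y"] norm_triangle_ineq[of "\<i> * x" "(-\<i>) * y"]
        by (simp add: norm_mult)
      then show ?thesis unfolding norm_mult[of "1/4"] by simp
    qed
    also have "\<dots> \<le> 4 * t"
      unfolding r_def using rb4[OF ij kl, of 1] rb4[OF ij kl, of "-1"] rb4[OF ij kl, of \<i>] rb4[OF ij kl, of "-\<i>"] by simp
    finally show ?thesis .
  qed
  have T: "cmod (\<phi> (traceless_unit d k l) $$ (i,j)) \<le> 8 * t" if ij: "i < d" "j < d" and kl: "k < d" "l < d" for i j k l
  proof -
    have "\<phi> (traceless_unit d k l) $$ (i,j) = \<psi> (traceless_unit d k l) $$ (i,j)"
      using eq[OF traceless_unit_carrier mtrace_traceless_unit[OF kl]] by simp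
    also have "\<dots> = \<psi> (unit_mat d k l) $$ (i,j) - of_bool (k = l) * \<psi> (unit_mat d 0 0) $$ (i,j)"
      by (rule lin_map_traceless_unit[OF L ij])
    also have "cmod \<dots> \<le> cmod (\<psi> (unit_mat d k l) $$ (i,j)) + cmod (of_bool (k = l) * \<psi> (unit_mat d 0 0) $$ (i,j))"
      by (rule norm_triangle_ineq4)
    also have "\<dots> \<le> 4 * t + 4 * t" using E[OF ij kl] E[OF ij \<open>0 < d\<close> \<open>0 < d\<close>] \<open>0 \<le> t\<close>
      by (intro add_mono) (auto simp: norm_mult of_bool_def)
    finally show ?thesis by simp
  qed
  have "dnorm d \<phi> \<le> (\<Sum>k<d. \<Sum>l<d. \<Sum>i<d. \<Sum>j<d. 8 * t)"
    unfolding dnorm_def enorm_def by (intro sum_mono T) auto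
  then show ?thesis by (simp add: power4_eq_xxxx mult_ac)
qed

section \<open>Domination of the normalised trace map (a Doeblin condition)\<close>

definition minorised :: "nat \<Rightarrow> real \<Rightarrow> (complex mat \<Rightarrow> complex mat) \<Rightarrow> bool" where
  "minorised d \<kappa> \<phi> \<longleftrightarrow> (\<forall>f g. \<kappa> * Re (cinner d f f) * Re (cinner d g g) \<le> Re (herm_form d (\<phi> (rank_one d f)) g))"

lemma lin_map_spec_mat:
  assumes L: "lin_map d \<phi>" and "i < d" "j < d"
  shows "\<phi> (spec_mat d u l) $$ (i,j) = (\<Sum>m<d. of_real (l m) * \<phi> (rank_one d (u m)) $$ (i,j))"
proof -
  have "\<phi> (spec_mat d u l) $$ (i,j) = (\<Sum>k<d. \<Sum>n<d. \<Sum>m<d. of_real (l m) * (rank_one d (u m) $$ (k,n) * \<phi> (unit_mat d k n) $$ (i,j)))"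
    unfolding lin_map_entry[OF L spec_mat_carrier assms(2,3)]
    by (intro sum.cong refl) (simp add: spec_mat_def rank_one_def sum_distrib_left sum_distrib_right mult_ac)
  also have "\<dots> = (\<Sum>k<d. \<Sum>m<d. \<Sum>n<d. of_real (l m) * (rank_one d (u m) $$ (k,n) * \<phi> (unit_mat d k n) $$ (i,j)))"
    by (intro sum.cong refl sum.swap)
  also have "\<dots> = (\<Sum>m<d. \<Sum>k<d. \<Sum>n<d. of_real (l m) * (rank_one d (u m) $$ (k,n) * \<phi> (unit_mat d k n) $$ (i,j)))"
    by (rule sum.swap)
  also have "\<dots> = (\<Sum>m<d. of_real (l m) * \<phi> (rank_one d (u m)) $$ (i,j))"
    unfolding lin_map_entry[OF L rank_one_carrier assms(2,3)] by (simp add: sum_distrib_left)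
  finally show ?thesis .
qed

text \<open>The spectral decomposition carries the bound from rank-one matrices to all positive
  ones. \<open>minorised\<close> itself speaks of rank-one matrices only, which makes it a condition
  on pairs of vectors, open to compactness and density arguments.\<close>

lemma minorised_psd:
  assumes L: "lin_map d \<phi>" and m: "minorised d \<kappa> \<phi>" and X: "psd d X"
  shows "\<kappa> * Re (mtrace X) * Re (cinner d g g) \<le> Re (herm_form d (\<phi> X) g)"
proof -
  obtain u l where u: "orthonormal d d u" and l: "\<And>m. m < d \<Longrightarrow> 0 \<le> l m" and Xs: "X = spec_mat d u l"
    by (rule psd_spectral[OF X]) blast
  have "herm_form d (\<phi> X) g = (\<Sum>i<d. \<Sum>j<d. \<Sum>m<d. of_real (l m) * (cnj (g i) * \<phi> (rank_one d (u m)) $$ (i,j) * g j))"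
    unfolding herm_form_def Xs by (intro sum.cong refl)
      (simp add: lin_map_spec_mat[OF L] sum_distrib_left sum_distrib_right mult_ac)
  also have "\<dots> = (\<Sum>i<d. \<Sum>m<d. \<Sum>j<d. of_real (l m) * (cnj (g i) * \<phi> (rank_one d (u m)) $$ (i,j) * g j))"
    by (intro sum.cong refl sum.swap)
  also have "\<dots> = (\<Sum>m<d. \<Sum>i<d. \<Sum>j<d. of_real (l m) * (cnj (g i) * \<phi> (rank_one d (u m)) $$ (i,j) * g j))"
    by (rule sum.swap)
  also have "\<dots> = (\<Sum>m<d. of_real (l m) * herm_form d (\<phi> (rank_one d (u m))) g)"
    unfolding herm_form_def by (simp add: sum_distrib_left)
  finally have e: "Re (herm_form d (\<phi> X) g) = (\<Sum>m<d. l m * Re (herm_form d (\<phi> (rank_one d (u m))) g))" by (simp add: Re_sum)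
  have "(\<Sum>m<d. l m * (\<kappa> * Re (cinner d g g))) \<le> (\<Sum>m<d. l m * Re (herm_form d (\<phi> (rank_one d (u m))) g))"
  proof (intro sum_mono mult_left_mono)
    fix k assume "k \<in> {..<d}"
    then have "cinner d (u k) (u k) = 1" using u unfolding orthonormal_def by auto
    then show "\<kappa> * Re (cinner d g g) \<le> Re (herm_form d (\<phi> (rank_one d (u k))) g)"
      using m unfolding minorised_def by (metis mult.right_neutral one_complex.sel(1))
  qed (use l in auto)
  moreover have "(\<Sum>m<d. l m * (\<kappa> * Re (cinner d g g))) = \<kappa> * Re (mtrace X) * Re (cinner d g g)"
    unfolding Xs spec_mat_trace[OF u] by (simp add: sum_distrib_left sum_distrib_right mult_ac)
  ultimately show ?thesis unfolding e by simp
qed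

lemma minorised_contracts:
  assumes P: "pos_map d \<phi>" and tp: "trace_preserving d \<phi>" and m: "minorised d \<kappa> \<phi>"
  shows "contracts d \<phi> (1 - \<kappa> * real d)"
proof -
  have L: "lin_map d \<phi>" using P by (simp add: pos_map_def)
  define \<psi> where "\<psi> X = \<phi> X - (of_real \<kappa> * mtrace X) \<cdot>\<^sub>m 1\<^sub>m d" for X
  have \<phi>c: "\<phi> X \<in> carrier_mat d d" if "X \<in> carrier_mat d d" for X using lin_mapD(1)[OF L that] .
  have hf1: "herm_form d (1\<^sub>m d) g = cinner d g g" for g
    unfolding herm_form_def cinner_def by (intro sum.cong refl) (simp add: if_distrib if_distribR sum.delta cong: if_cong)
  have "lin_map d \<psi>" unfolding lin_map_def
  proof (intro conjI ballI allI)
    fix X Y :: "complex mat" assume XY: "X \<in> carrier_mat d d" "Y \<in> carrier_mat d d"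
    show "\<psi> (X + Y) = \<psi> X + \<psi> Y"
      using \<phi>c[OF XY(1)] \<phi>c[OF XY(2)] unfolding \<psi>_def lin_mapD(2)[OF L XY] mtrace_add[OF XY]
      by (intro eq_matI) (auto simp: algebra_simps)
  next
    fix X :: "complex mat" and c :: complex assume X: "X \<in> carrier_mat d d"
    show "\<psi> (c \<cdot>\<^sub>m X) = c \<cdot>\<^sub>m \<psi> X"
      using \<phi>c[OF X] unfolding \<psi>_def lin_mapD(3)[OF L X] mtrace_smult[OF X]
      by (intro eq_matI) (auto simp: algebra_simps)
  qed (auto simp: \<psi>_def intro!: minus_carrier_mat)
  moreover have "psd d (\<psi> X)" if X: "psd d X" for X
  proof (rule psdI)
    note Xc = psd_carrier[OF X]
    show "\<psi> X \<in> carrier_mat d d" unfolding \<psi>_def by (intro minus_carrier_mat) simp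
    fix i j assume ij: "i < d" "j < d"
    have h: "\<phi> X $$ (i,j) = cnj (\<phi> X $$ (j,i))"
      using P X ij unfolding pos_map_def psd_iff hermitian_def by blast
    show "\<psi> X $$ (i,j) = cnj (\<psi> X $$ (j,i))"
      unfolding \<psi>_def using ij \<phi>c[OF Xc] psd_trace(1)[OF X] by (simp add: h complex_cnj_mult) (metis complex_cnj_complex_of_real)
  next
    fix f
    have "herm_form d (\<psi> X) f = herm_form d (\<phi> X) f - of_real \<kappa> * mtrace X * cinner d f f"
      unfolding \<psi>_def using \<phi>c[OF psd_carrier[OF X]] by (simp add: herm_form_minus herm_form_smult hf1)
    also have "\<dots> = herm_form d (\<phi> X) f - of_real (\<kappa> * Re (mtrace X) * Re (cinner d f f))"
      using psd_trace(1)[OF X] cinner_self[of d f] cinner_self_Re[of d f] by simp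
    finally show "0 \<le> Re (herm_form d (\<psi> X) f)" using minorised_psd[OF L m X, of f] by simp
  qed
  moreover have "mtrace (\<psi> X) = of_real (1 - \<kappa> * real d) * mtrace X" if X: "X \<in> carrier_mat d d" for X
  proof -
    have "mtrace (1\<^sub>m d) = of_nat d" unfolding mtrace_def by simp
    then show ?thesis unfolding \<psi>_def mtrace_minus[OF \<phi>c[OF X] smult_carrier_mat[OF one_carrier_mat]] mtrace_smult[OF one_carrier_mat]
      using tp X unfolding trace_preserving_def by (simp add: algebra_simps)
  qed
  moreover have "\<phi> X = \<psi> X" if X: "X \<in> carrier_mat d d" "mtrace X = 0" for X
    unfolding \<psi>_def using \<phi>c[OF X(1)] X(2) by (intro eq_matI) auto
  ultimately show ?thesis unfolding contracts_def pos_map_def by blast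
qed

text \<open>A positive map cannot give a state a negative trace. Thus a \<open>\<kappa>\<close> that
  occurs in a minorisation of a channel satisfies \<open>\<kappa> * d \<le> 1\<close>
  automatically.\<close>

lemma contracts_nonneg:
  assumes "contracts d \<phi> t" "0 < d" shows "0 \<le> t"
proof -
  obtain \<psi> where P: "pos_map d \<psi>" and tr: "\<And>X. X\<in>carrier_mat d d \<Longrightarrow> mtrace (\<psi> X) = of_real t * mtrace X"
    using assms(1) unfolding contracts_def by blast
  have "psd d (\<psi> (rank_one d (\<lambda>i. of_bool (i = 0))))" using P rank_one_psd unfolding pos_map_def by simp
  from psd_trace(2)[OF this] have "0 \<le> Re (of_real t * cinner d (\<lambda>i. of_bool (i = 0)) (\<lambda>i. of_bool (i = 0)))"
    unfolding tr[OF rank_one_carrier] rank_one_trace .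
  also have "cinner d (\<lambda>i. of_bool (i = 0)) (\<lambda>i. of_bool (i = 0)) = 1"
    unfolding cinner_def using assms(2) by (simp add: of_bool_def if_distrib if_distribR sum.delta cong: if_cong)
  finally show ?thesis by simp
qed

text \<open>Expanding in matrix units exhibits the form as a polynomial in finitely many coordinates
  and their conjugates. Its continuity yields both the minimum over the spheres and the reduction to
  a countable dense set.\<close>

lemma rank_one_form_cont:
  assumes L: "lin_map d \<phi>"
  shows "continuous_on S (\<lambda>p. Re (herm_form d (\<phi> (rank_one d (fst p))) (snd p)))"
proof -
  have c1: "continuous_on S (\<lambda>p::(nat \<Rightarrow> complex) \<times> (nat \<Rightarrow> complex). fst p i)" for i
    by (rule continuous_on_compose2[OF coord_cont[of UNIV] continuous_on_fst[OF continuous_on_id]]) auto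
  have c2: "continuous_on S (\<lambda>p::(nat \<Rightarrow> complex) \<times> (nat \<Rightarrow> complex). snd p i)" for i
    by (rule continuous_on_compose2[OF coord_cont[of UNIV] continuous_on_snd[OF continuous_on_id]]) auto
  have "herm_form d (\<phi> (rank_one d f)) g = (\<Sum>i<d. \<Sum>j<d. cnj (g i) *
      (\<Sum>k<d. \<Sum>l<d. f k * cnj (f l) * \<phi> (unit_mat d k l) $$ (i,j)) * g j)" for f g
    unfolding herm_form_def by (intro sum.cong refl) (simp add: lin_map_entry[OF L rank_one_carrier], simp add: rank_one_def)
  then show ?thesis by (auto intro!: continuous_intros c1 c2)
qed

lemma strictly_positive_minorised:
  assumes L: "lin_map d \<phi>" and sp: "strictly_positive d \<phi>" and "0 < d"
  shows "\<exists>\<kappa>>0. minorised d \<kappa> \<phi>"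
proof -
  let ?S = "usphere d \<times> usphere d"
  have e: "(\<lambda>i. of_bool (i = 0)) \<in> usphere d" unfolding usphere_def cinner_def
    using \<open>0 < d\<close> by (auto simp: of_bool_def if_distrib if_distribR sum.delta cong: if_cong)
  have "compact ?S" by (intro compact_Times compact_usphere)
  moreover have "?S \<noteq> {}" using e by auto
  ultimately obtain p where p: "p \<in> ?S" and
    min: "\<And>q. q \<in> ?S \<Longrightarrow> Re (herm_form d (\<phi> (rank_one d (fst p))) (snd p)) \<le> Re (herm_form d (\<phi> (rank_one d (fst q))) (snd q))"
    using continuous_attains_inf[OF _ _ rank_one_form_cont[OF L, of ?S]] by blast
  define \<kappa> where "\<kappa> = Re (herm_form d (\<phi> (rank_one d (fst p))) (snd p))"
  have pos: "0 < \<kappa>"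
  proof -
    have c: "cinner d (fst p) (fst p) = 1" "cinner d (snd p) (snd p) = 1" using p unfolding usphere_def by auto
    have "rank_one d (fst p) \<noteq> 0\<^sub>m d d"
    proof
      assume "rank_one d (fst p) = 0\<^sub>m d d"
      then have "mtrace (rank_one d (fst p)) = 0" by (simp add: mtrace_def)
      with c show False unfolding rank_one_trace by simp
    qed
    then have "pd d (\<phi> (rank_one d (fst p)))" using sp rank_one_psd unfolding strictly_positive_def by blast
    moreover have "vec d (snd p) \<noteq> 0\<^sub>v d"
    proof
      assume "vec d (snd p) = 0\<^sub>v d"
      then have "\<forall>i<d. snd p i = 0" by (metis index_vec index_zero_vec(1))
      then have "cinner d (snd p) (snd p) = 0" by (simp add: cinner_def)
      with c show False by simp
    qed
    ultimately have "0 < Re (qform (\<phi> (rank_one d (fst p))) (vec d (snd p)))" unfolding pd_def by simp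
    then show ?thesis unfolding \<kappa>_def using qform_vec[OF lin_mapD(1)[OF L rank_one_carrier]] by simp
  qed
  \<comment> \<open>The minimum over unit vectors extends by homogeneity of degree 2 in
    \<open>f\<close> and in \<open>g\<close>; vectors of norm 0 cannot be normalised and are treated
    apart.\<close>
  have "\<kappa> * Re (cinner d f f) * Re (cinner d g g) \<le> Re (herm_form d (\<phi> (rank_one d f)) g)" for f g
  proof (cases "Re (cinner d f f) = 0 \<or> Re (cinner d g g) = 0")
    case True
    have "herm_form d (\<phi> (rank_one d f)) g = 0"
    proof (cases "Re (cinner d g g) = 0")
      case True
      then show ?thesis unfolding cinner_self_0 herm_form_def by simp
    next
      case False
      then have "rank_one d f = 0 \<cdot>\<^sub>m rank_one d f" using True unfolding cinner_self_0 by (intro eq_matI) (auto simp: rank_one_def)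
      then have "\<phi> (rank_one d f) = 0 \<cdot>\<^sub>m \<phi> (rank_one d f)" using lin_mapD(3)[OF L rank_one_carrier] by metis
      then have "herm_form d (\<phi> (rank_one d f)) g = herm_form d (0 \<cdot>\<^sub>m \<phi> (rank_one d f)) g" by metis
      then show ?thesis using herm_form_smult[OF lin_mapD(1)[OF L rank_one_carrier]] by simp
    qed
    with True show ?thesis by auto
  next
    case False
    obtain f' where f': "f' \<in> usphere d" "\<And>i. i < d \<Longrightarrow> f i = of_real (sqrt (Re (cinner d f f))) * f' i"
      using normalise False by blast
    obtain g' where g': "g' \<in> usphere d" "\<And>i. i < d \<Longrightarrow> g i = of_real (sqrt (Re (cinner d g g))) * g' i"
      using normalise False by blast
    have "rank_one d f = of_real (Re (cinner d f f)) \<cdot>\<^sub>m rank_one d f'"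
    proof (rule eq_matI)
      fix i j assume "i < dim_row (of_real (Re (cinner d f f)) \<cdot>\<^sub>m rank_one d f')" "j < dim_col (of_real (Re (cinner d f f)) \<cdot>\<^sub>m rank_one d f')"
      then have ij: "i < d" "j < d" by (auto simp: rank_one_def)
      have "rank_one d f $$ (i,j) = (of_real (sqrt (Re (cinner d f f))) * f' i) * cnj (of_real (sqrt (Re (cinner d f f))) * f' j)"
        using ij by (simp add: rank_one_def f'(2)[symmetric])
      also have "\<dots> = of_real (sqrt (Re (cinner d f f)) * sqrt (Re (cinner d f f))) * (f' i * cnj (f' j))"
        unfolding of_real_mult by simp
      finally show "rank_one d f $$ (i,j) = (of_real (Re (cinner d f f)) \<cdot>\<^sub>m rank_one d f') $$ (i,j)"
        using ij cinner_self_nonneg by (simp add: rank_one_def)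
    qed (auto simp: rank_one_def)
    then have "\<phi> (rank_one d f) = of_real (Re (cinner d f f)) \<cdot>\<^sub>m \<phi> (rank_one d f')" using lin_mapD(3)[OF L rank_one_carrier] by simp
    then have 1: "herm_form d (\<phi> (rank_one d f)) g' = of_real (Re (cinner d f f)) * herm_form d (\<phi> (rank_one d f')) g'"
      using herm_form_smult[OF lin_mapD(1)[OF L rank_one_carrier]] by simp
    have "herm_form d (\<phi> (rank_one d f)) g = herm_form d (\<phi> (rank_one d f)) (\<lambda>i. of_real (sqrt (Re (cinner d g g))) * g' i)"
      by (rule herm_form_cong) (rule g'(2))
    also have "\<dots> = of_real (Re (cinner d g g)) * herm_form d (\<phi> (rank_one d f)) g'"
      unfolding herm_form_scale by (simp add: cinner_self_nonneg)
    finally have "Re (herm_form d (\<phi> (rank_one d f)) g) = Re (cinner d g g) * (Re (cinner d f f) * Re (herm_form d (\<phi> (rank_one d f')) g'))"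
      unfolding 1 by simp
    moreover have "\<kappa> \<le> Re (herm_form d (\<phi> (rank_one d f')) g')" using min[of "(f',g')"] f' g' unfolding \<kappa>_def by simp
    then have "Re (cinner d g g) * (Re (cinner d f f) * \<kappa>) \<le> Re (cinner d g g) * (Re (cinner d f f) * Re (herm_form d (\<phi> (rank_one d f')) g'))"
      by (intro mult_left_mono cinner_self_nonneg)
    ultimately show ?thesis by (simp add: mult_ac)
  qed
  with pos show ?thesis unfolding minorised_def by blast
qed

text \<open>By continuity it suffices to test the minorisation on a countable dense set, which makes it
  a measurable condition.\<close>
lemma minorised_countable:
  obtains Q :: "(nat \<Rightarrow> complex) set" where "countable Q"
    "\<And>d \<phi> \<kappa>. lin_map d \<phi> \<Longrightarrow>
       minorised d \<kappa> \<phi> \<longleftrightarrow> (\<forall>f\<in>Q. \<forall>g\<in>Q. \<kappa> * Re (cinner d f f) * Re (cinner d g g) \<le> Re (herm_form d (\<phi> (rank_one d f)) g))"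
proof -
  obtain Q :: "(nat \<Rightarrow> complex) set" where Q: "countable Q" "\<And>X. open X \<Longrightarrow> X \<noteq> {} \<Longrightarrow> \<exists>q\<in>Q. q \<in> X"
    by (rule countable_dense_setE) blast
  have "minorised d \<kappa> \<phi>" if L: "lin_map d \<phi>"
    and *: "\<forall>f\<in>Q. \<forall>g\<in>Q. \<kappa> * Re (cinner d f f) * Re (cinner d g g) \<le> Re (herm_form d (\<phi> (rank_one d f)) g)" for d \<phi> \<kappa>
  proof (rule ccontr)
    define F where "F p = \<kappa> * Re (cinner d (fst p) (fst p)) * Re (cinner d (snd p) (snd p)) - Re (herm_form d (\<phi> (rank_one d (fst p))) (snd p))" for p
    assume "\<not> ?thesis"
    then obtain f g where "F (f,g) > 0" unfolding minorised_def F_def by (auto simp: not_le)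
    moreover have "continuous_on UNIV F" unfolding F_def
      by (intro continuous_intros rank_one_form_cont[OF L]
          continuous_on_compose2[OF cinner_cont(2)[of UNIV] continuous_on_fst[OF continuous_on_id]]
          continuous_on_compose2[OF cinner_cont(2)[of UNIV] continuous_on_snd[OF continuous_on_id]]) auto
    then have "open {p. F p > 0}" by (intro open_Collect_less continuous_intros) auto
    ultimately obtain A B where AB: "open A" "open B" "f \<in> A" "g \<in> B" "A \<times> B \<subseteq> {p. F p > 0}"
      by (elim open_prod_elim[of _ "(f,g)"]) auto
    then obtain f' g' where "f' \<in> Q" "f' \<in> A" "g' \<in> Q" "g' \<in> B" using Q(2) by (metis empty_iff)
    then show False using AB(5) * unfolding F_def by fastforce
  qed
  then show ?thesis using that[OF Q(1)] unfolding minorised_def by blast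
qed

section \<open>Measures on the sequence space\<close>

definition cyl :: "nat \<Rightarrow> (nat \<Rightarrow> 'b) \<Rightarrow> (nat \<Rightarrow> 'b) set" where
  "cyl n as = {x. \<forall>i<n. x i = as i}"

lemma space_seq_space: "space seq_space = UNIV"
  unfolding seq_space_def space_PiM by simp

text \<open>Over a finite alphabet a condition on one coordinate is a finite union of cylinders. The
  empty set is put into the generator because incompatible cylinders are disjoint and the generator
  has to be closed under intersections.\<close>

lemma sets_seq_space:
  "sets (seq_space :: (nat \<Rightarrow> 'b::finite) measure) = sigma_sets UNIV (insert {} {cyl n as | n as. True})"
proof -
  let ?G = "insert {} {cyl n as | n as. True} :: (nat \<Rightarrow> 'b) set set"
  interpret sigma_algebra UNIV "sigma_sets UNIV ?G" by (rule sigma_algebra_sigma_sets) simp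
  have "{x. x i \<in> A} \<in> sigma_sets UNIV ?G" for i and A :: "'b set"
  proof -
    \<comment> \<open>The words of length \<open>i + 1\<close> with last letter in \<open>A\<close>,
      as extensional functions, so that there are only finitely many.\<close>
    let ?W = "{as \<in> PiE {..<Suc i} (\<lambda>_. UNIV). as i \<in> A}"
    have "finite ?W" by (intro finite_subset[OF _ finite_PiE[of "{..<Suc i}" "\<lambda>_. UNIV"]]) auto
    have "{x. x i \<in> A} = (\<Union>as\<in>?W. cyl (Suc i) as)"
    proof (rule equalityI; rule subsetI)
      fix x assume "x \<in> {x. x i \<in> A}"
      then have "restrict x {..<Suc i} \<in> ?W" "x \<in> cyl (Suc i) (restrict x {..<Suc i})"
        by (auto simp: cyl_def)
      then show "x \<in> (\<Union>as\<in>?W. cyl (Suc i) as)" by blast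
    qed (auto simp: cyl_def)
    moreover have "(\<Union>as\<in>?W. cyl (Suc i) as) \<in> sigma_sets UNIV ?G"
      using \<open>finite ?W\<close> by (intro finite_UN) (auto intro!: sigma_sets.Basic)
    ultimately show ?thesis by simp
  qed
  then have "sigma_sets UNIV {{f \<in> UNIV. f i \<in> A} | i (A :: 'b set). True} \<subseteq> sigma_sets UNIV ?G"
    by (intro sigma_sets_mono) auto
  moreover have "cyl n as \<in> sigma_sets UNIV {{f \<in> UNIV. f i \<in> A} | i (A :: 'b set). True}" for n and as :: "nat \<Rightarrow> 'b"
  proof -
    let ?H = "{{f \<in> UNIV. f i \<in> A} | i (A :: 'b set). True}"
    interpret H: sigma_algebra UNIV "sigma_sets UNIV ?H" by (rule sigma_algebra_sigma_sets) simp
    have "cyl n as = UNIV \<inter> (\<Inter>i\<in>{..<n}. {f \<in> UNIV. f i \<in> {as i}})" by (auto simp: cyl_def)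
    also have "\<dots> \<in> sigma_sets UNIV ?H"
    proof (cases "n = 0")
      case False
      have "{f \<in> UNIV. f i \<in> {as i}} \<in> sigma_sets UNIV ?H" for i by (rule sigma_sets.Basic) blast
      with False show ?thesis by (intro H.Int H.finite_INT H.top) auto
    qed (simp add: sigma_sets_top)
    finally show ?thesis .
  qed
  then have "sigma_sets UNIV ?G \<subseteq> sigma_sets UNIV {{f \<in> UNIV. f i \<in> A} | i (A :: 'b set). True}"
    by (intro sigma_sets_mono) (auto intro: sigma_sets.Empty)
  ultimately show ?thesis unfolding seq_space_def sets_PiM_single by simp
qed

lemma Int_stable_cyl: "Int_stable (insert {} {cyl n as | n as. True} :: (nat \<Rightarrow> 'b) set set)"
proof -
  have "cyl n as \<inter> cyl m bs = cyl (max n m) x" if "x \<in> cyl n as \<inter> cyl m bs" for n m and as bs x :: "nat \<Rightarrow> 'b"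
    using that by (auto simp: cyl_def less_max_iff_disj)
  then have *: "cyl n as \<inter> cyl m bs \<in> insert {} {cyl n as | n as. True}" for n m and as bs :: "nat \<Rightarrow> 'b"
    by blast
  show ?thesis
  proof (rule Int_stableI)
    fix a b :: "(nat \<Rightarrow> 'b) set"
    assume "a \<in> insert {} {cyl n as | n as. True}" "b \<in> insert {} {cyl n as | n as. True}"
    then consider "a = {} \<or> b = {}" | n as m bs where "a = cyl n as" "b = cyl m bs" by blast
    then show "a \<inter> b \<in> insert {} {cyl n as | n as. True}"
    proof cases
      case 1
      then show ?thesis by auto
    next
      case (2 n as m bs)
      show ?thesis unfolding 2 by (rule *)
    qed
  qed
qed

text \<open>Dynkin's argument: both sides are countably additive and, as the weights
  \<open>c\<close> and \<open>1 - c\<close> add up to the total mass 1, compatible with complements.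
  The case \<open>c = 1\<close> gives uniqueness, the case \<open>0 < c < 1\<close> absolute
  continuity.\<close>

lemma seq_measure_mixture:
  fixes Q Q1 Q2 :: "(nat \<Rightarrow> 'b::finite) measure"
  assumes "prob_space Q" "sets Q = sets seq_space" "prob_space Q1" "sets Q1 = sets seq_space"
    "prob_space Q2" "sets Q2 = sets seq_space"
    and cyl: "\<And>n as. measure Q (cyl n as) = c * measure Q1 (cyl n as) + (1 - c) * measure Q2 (cyl n as)"
    and A: "A \<in> sets seq_space"
  shows "measure Q A = c * measure Q1 A + (1 - c) * measure Q2 A"
proof -
  interpret Q: prob_space Q by fact
  interpret Q1: prob_space Q1 by fact
  interpret Q2: prob_space Q2 by fact
  have sp: "space Q = UNIV" "space Q1 = UNIV" "space Q2 = UNIV"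
    using assms sets_eq_imp_space_eq space_seq_space by metis+
  let ?G = "insert {} {cyl n as | n as. True} :: (nat \<Rightarrow> 'b) set set"
  have e: "sigma_sets UNIV ?G = sets Q" "sigma_sets UNIV ?G = sets Q1" "sigma_sets UNIV ?G = sets Q2"
    using assms sets_seq_space by auto
  show ?thesis
  proof (rule sigma_sets_induct_disjoint[OF Int_stable_cyl, of UNIV A])
    show "A \<in> sigma_sets UNIV ?G" using A unfolding sets_seq_space .
  next
    fix B assume "B \<in> ?G" then show "measure Q B = c * measure Q1 B + (1 - c) * measure Q2 B"
      using cyl by auto
  next
    fix B assume B: "B \<in> sigma_sets UNIV ?G" "measure Q B = c * measure Q1 B + (1 - c) * measure Q2 B"
    then show "measure Q (UNIV - B) = c * measure Q1 (UNIV - B) + (1 - c) * measure Q2 (UNIV - B)"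
    proof -
      have "measure Q (UNIV - B) = 1 - measure Q B" "measure Q1 (UNIV - B) = 1 - measure Q1 B"
        "measure Q2 (UNIV - B) = 1 - measure Q2 B"
        using Q.prob_compl[of B] Q1.prob_compl[of B] Q2.prob_compl[of B] e sp B(1) by auto
      then show ?thesis using B(2) by (simp only:) (simp add: algebra_simps)
    qed
  next
    fix B :: "nat \<Rightarrow> (nat \<Rightarrow> 'b) set"
    assume B: "disjoint_family B" "range B \<subseteq> sigma_sets UNIV ?G"
      "\<And>i. measure Q (B i) = c * measure Q1 (B i) + (1 - c) * measure Q2 (B i)"
    have "(\<lambda>i. measure Q (B i)) sums measure Q (\<Union>i. B i)" using B(1,2) e by (intro Q.finite_measure_UNION) auto
    moreover have "(\<lambda>i. c * measure Q1 (B i) + (1 - c) * measure Q2 (B i)) sums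
        (c * measure Q1 (\<Union>i. B i) + (1 - c) * measure Q2 (\<Union>i. B i))"
      using B(1,2) e by (intro sums_add sums_mult Q1.finite_measure_UNION Q2.finite_measure_UNION) auto
    ultimately show "measure Q (\<Union>i. B i) = c * measure Q1 (\<Union>i. B i) + (1 - c) * measure Q2 (\<Union>i. B i)"
      unfolding B(3) by (rule sums_unique2)
  qed auto
qed

lemma seq_measure_unique:
  fixes Q Q1 :: "(nat \<Rightarrow> 'b::finite) measure"
  assumes "prob_space Q" "sets Q = sets seq_space" "prob_space Q1" "sets Q1 = sets seq_space"
    and "\<And>n as. measure Q (cyl n as) = measure Q1 (cyl n as)"
  shows "Q = Q1"
proof (rule measure_eqI)
  interpret Q: prob_space Q by fact
  interpret Q1: prob_space Q1 by fact
  show "sets Q = sets Q1" using assms by simp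
  fix A assume "A \<in> sets Q"
  then show "emeasure Q A = emeasure Q1 A"
    using seq_measure_mixture[of Q Q1 Q1 1 A] assms
    by (simp add: Q.emeasure_eq_measure Q1.emeasure_eq_measure)
qed

text \<open>The theorem of Ionescu-Tulcea, applied to the conditional law of the next letter given
  the word read so far.\<close>

lemma seq_measure_exists:
  fixes p :: "nat \<Rightarrow> (nat \<Rightarrow> 'b::finite) \<Rightarrow> real"
  assumes p0: "\<And>as. p 0 as = 1" and pos: "\<And>n as. 0 \<le> p n as"
    and cong: "\<And>n as bs. (\<And>i. i < n \<Longrightarrow> as i = bs i) \<Longrightarrow> p n as = p n bs"
    and consistent: "\<And>n as. (\<Sum>a\<in>UNIV. p (Suc n) (as(n := a))) = p n as"
  shows "\<exists>Q. prob_space Q \<and> sets Q = sets seq_space \<and> (\<forall>n as. measure Q (cyl n as) = p n as)"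
proof -
  \<comment> \<open>Stated as a product to avoid division: if the word has weight 0, consistency
    makes all its continuations weightless and any law of the next letter will do.\<close>
  have "\<exists>k :: 'b pmf. \<forall>a. p n x * pmf k a = p (Suc n) (x(n := a))" for n x
  proof (cases "p n x = 0")
    case True
    then have "p (Suc n) (x(n := a)) = 0" for a
    proof -
      have "(\<Sum>a\<in>UNIV. p (Suc n) (x(n := a))) = 0" using True consistent[of n x] by simp
      then have "\<forall>a\<in>UNIV. p (Suc n) (x(n := a)) = 0" using pos by (subst sum_nonneg_eq_0_iff[symmetric]) auto
      then show ?thesis by simp
    qed
    with True show ?thesis by simp
  next
    case False
    with pos[of n x] have px: "p n x > 0" by simp
    have "(\<integral>\<^sup>+a. ennreal (p (Suc n) (x(n := a)) / p n x) \<partial>count_space UNIV) =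
        ennreal (\<Sum>a\<in>UNIV. p (Suc n) (x(n := a)) / p n x)"
      using pos by (subst nn_integral_count_space_finite) (auto simp: sum_ennreal)
    also have "(\<Sum>a\<in>UNIV. p (Suc n) (x(n := a)) / p n x) = 1"
      using consistent[of n x] px by (simp add: sum_divide_distrib[symmetric])
    finally have int1: "(\<integral>\<^sup>+a. ennreal (p (Suc n) (x(n := a)) / p n x) \<partial>count_space UNIV) = 1"
      by (simp only: ennreal_1)
    have "pmf (embed_pmf (\<lambda>a. p (Suc n) (x(n := a)) / p n x)) a = p (Suc n) (x(n := a)) / p n x" for a
      by (rule pmf_embed_pmf[OF _ int1]) (simp add: pos)
    with px show ?thesis by (intro exI[of _ "embed_pmf (\<lambda>a. p (Suc n) (x(n := a)) / p n x)"]) simp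
  qed
  then obtain k :: "nat \<Rightarrow> (nat \<Rightarrow> 'b) \<Rightarrow> 'b pmf"
    where k: "\<And>n x a. p n x * pmf (k n x) a = p (Suc n) (x(n := a))" by metis
  \<comment> \<open>Finite products of the discrete alphabet are discrete, which settles the
    measurability of the kernels and of single words.\<close>
  have fin: "PiM {0..<n} (\<lambda>_. count_space (UNIV :: 'b set)) = count_space (PiE {0..<n} (\<lambda>_. UNIV))" for n :: nat
    by (rule count_space_PiM_finite) auto
  interpret IT: Ionescu_Tulcea "\<lambda>n x. measure_pmf (k n x)" "\<lambda>_. count_space (UNIV :: 'b set)"
  proof
    show "(\<lambda>x. measure_pmf (k n x)) \<in> measurable (PiM {0..<n} (\<lambda>_. count_space UNIV)) (subprob_algebra (count_space UNIV))" for n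
      unfolding fin by (auto simp: measurable_def space_subprob_algebra measure_pmf.subprob_space_axioms)
  qed
  \<comment> \<open>The only point of the empty product, from which the construction starts.\<close>
  let ?u = "\<lambda>_::nat. undefined :: 'b"
  have C: "emeasure (IT.C 0 n ?u) {restrict as {0..<n}} = ennreal (p n as)" for n as
  proof (induction n)
    case 0
    have "{restrict as {0..<0}} \<in> sets (PiM {0..<0} (\<lambda>_. count_space (UNIV :: 'b set)))"
      unfolding fin by auto
    from emeasure_return[OF this, of ?u] show ?case by (simp add: p0 restrict_def)
  next
    case (Suc n)
    \<comment> \<open>A word of length \<open>n + 1\<close> is reached only from its own prefix, so
      the integrand below is a multiple of the indicator of \<open>{x0}\<close>.\<close>
    define x0 where "x0 = restrict as {0..<n}"
    let ?y = "restrict as {0..<Suc n}"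
    have u: "?u \<in> space (PiM {0..<0} (\<lambda>_. count_space UNIV))" by (simp add: space_PiM)
    have sp: "space (IT.C 0 n ?u) = PiE {0..<n} (\<lambda>_. UNIV)" using IT.space_C[OF u, of n] by (simp add: space_PiM)
    have y: "{?y} \<in> sets (PiM {0..<Suc n} (\<lambda>_. count_space (UNIV :: 'b set)))" unfolding fin by auto
    have Cs: "sets (IT.C 0 n ?u) = sets (PiM {0..<n} (\<lambda>_. count_space (UNIV :: 'b set)))"
      using IT.sets_C[OF u, of n] by (simp only: add_0)
    have m: "IT.eP n \<in> measurable (IT.C 0 n ?u) (subprob_algebra (PiM {0..<Suc n} (\<lambda>_. count_space UNIV)))"
      by (rule subst[of _ _ "\<lambda>S. IT.eP n \<in> S", OF measurable_cong_sets[OF Cs refl, symmetric] IT.measurable_eP])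
    have "emeasure (IT.C 0 (Suc n) ?u) {?y} = (\<integral>\<^sup>+x. emeasure (IT.eP n x) {?y} \<partial>IT.C 0 n ?u)"
      using emeasure_bind[OF _ m y] sp by (simp add: PiE_eq_empty_iff)
    also have "\<dots> = (\<integral>\<^sup>+x. ennreal (pmf (k n x0) (as n)) * indicator {x0} x \<partial>IT.C 0 n ?u)"
    proof (rule nn_integral_cong)
      fix x assume "x \<in> space (IT.C 0 n ?u)"
      then have x: "x \<in> PiE {0..<n} (\<lambda>_. UNIV)" using sp by simp
      then have "emeasure (IT.eP n x) {?y} = emeasure (measure_pmf (k n x)) ((\<lambda>a. x(n := a)) -` {?y})"
        using IT.emeasure_eP[of x n "{?y}"] y by (simp add: space_PiM)
      also have "(\<lambda>a. x(n := a)) -` {?y} = (if x = x0 then {as n} else {})"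
      proof -
        have "x(n := a) = ?y \<longleftrightarrow> a = as n \<and> x = x0" for a
          using x unfolding x0_def by (auto simp: fun_eq_iff PiE_def extensional_def)
        then show ?thesis by auto
      qed
      finally show "emeasure (IT.eP n x) {?y} = ennreal (pmf (k n x0) (as n)) * indicator {x0} x"
        by (cases "x = x0") (simp_all only: if_True if_False emeasure_pmf_single emeasure_empty
            indicator_simps singletonI singleton_iff mult_1_right mult_zero_right simp_thms)
    qed
    also have "\<dots> = ennreal (pmf (k n x0) (as n)) * emeasure (IT.C 0 n ?u) {x0}"
    proof (rule nn_integral_cmult_indicator)
      show "{x0} \<in> sets (IT.C 0 n ?u)" unfolding Cs fin x0_def by auto
    qed
    also have "\<dots> = ennreal (p n x0 * pmf (k n x0) (as n))"
      using cong[of n as "restrict as {0..<n}"] pos unfolding x0_def Suc by (simp add: ennreal_mult' mult.commute)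
    also have "\<dots> = ennreal (p (Suc n) as)" 
    proof -
      have "p (Suc n) (x0(n := as n)) = p (Suc n) as" by (rule cong) (auto simp: x0_def less_Suc_eq)
      then show ?thesis unfolding k by simp
    qed
    finally show ?case .
  qed
  have "emeasure IT.PF.lim (cyl n as) = ennreal (p n as)" for n as
  proof -
    let ?x = "restrict as {0..<n}"
    have x: "{?x} \<in> sets (PiM {0..<n} (\<lambda>_. count_space (UNIV :: 'b set)))" unfolding fin by auto
    have "cyl n as = prod_emb UNIV (\<lambda>_. count_space UNIV) {0..<n} {?x}"
    proof -
      have "restrict x {0..<n} = ?x \<longleftrightarrow> (\<forall>i<n. x i = as i)" for x
        unfolding restrict_def fun_eq_iff by (metis atLeastLessThan_iff le0)
      then show ?thesis by (auto simp: cyl_def prod_emb_def)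
    qed
    then have "emeasure IT.PF.lim (cyl n as) = emeasure (IT.CI {0..<n}) {?x}"
      using IT.lim[OF _ x] by simp
    also have "\<dots> = emeasure (IT.C 0 n ?u) (prod_emb {0..<n} (\<lambda>_. count_space UNIV) {0..<n} {?x})"
      by (rule IT.emeasure_CI[OF order_refl x])
    also have "prod_emb {0..<n} (\<lambda>_. count_space (UNIV::'b set)) {0..<n} {?x} = {?x}"
      by (rule prod_emb_id) auto
    finally show ?thesis unfolding C .
  qed
  then have "measure IT.PF.lim (cyl n as) = p n as" for n as
    using pos by (simp add: measure_def)
  moreover have "prob_space IT.PF.lim"
  proof
    have "emeasure IT.PF.lim (cyl 0 undefined) = 1" using \<open>\<And>n as. emeasure IT.PF.lim (cyl n as) = ennreal (p n as)\<close>[of 0] p0 by simp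
    then show "emeasure IT.PF.lim (space IT.PF.lim) = 1" by (simp add: cyl_def space_PiM)
  qed
  moreover have "sets IT.PF.lim = sets seq_space" by (simp add: seq_space_def)
  ultimately show ?thesis by blast
qed

section \<open>Forgetting of the initial state\<close>

locale random_channel = prob_space M for M :: "'w measure" +
  fixes d :: nat and \<theta> :: "'w \<Rightarrow> 'w" and T :: "'b::finite \<Rightarrow> 'w \<Rightarrow> complex mat \<Rightarrow> complex mat"
  assumes d_pos: "0 < d"
    and mpt: "ergodic_mpt M \<theta>"
    and instrument: "random_instrument d M T"
    and esp: "AE \<omega> in M. \<exists>N0. \<forall>n\<ge>N0. strictly_positive d (Phi_n d \<theta> T n \<omega>)"
begin

definition \<theta>i :: "'w \<Rightarrow> 'w" where "\<theta>i = the_inv_into (space M) \<theta>"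

definition channel :: "'w \<Rightarrow> complex mat \<Rightarrow> complex mat" where
  "channel \<omega> X = mat d d (\<lambda>(i,j). \<Sum>a\<in>UNIV. T a \<omega> X $$ (i,j))"

abbreviation Phi :: "nat \<Rightarrow> 'w \<Rightarrow> complex mat \<Rightarrow> complex mat" where
  "Phi \<equiv> Phi_n d \<theta> T"

definition D :: "nat \<Rightarrow> 'w \<Rightarrow> real" where "D n \<omega> = dnorm d (Phi n \<omega>)"

text \<open>The constant of \<open>contracts_dnorm\<close> at \<open>t = 1\<close>.\<close>

definition K :: real where "K = 8 * real d ^ 4"

lemma K_pos: "0 < K" unfolding K_def using d_pos by simp

lemma D_nonneg: "0 \<le> D n \<omega>" unfolding D_def by (rule dnorm_nonneg)

lemma T_pos: "pos_map d (T a \<omega>)"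
  using instrument cp_pos_map unfolding random_instrument_def by blast

lemma channel_pos: "pos_map d (channel \<omega>)"
  using pos_map_sum[of UNIV d "\<lambda>a. T a \<omega>"] T_pos unfolding channel_def[abs_def] by simp

lemma Phi_k_channel: "Phi_k d \<theta> T k \<omega> = channel ((\<theta> ^^ k) \<omega>)"
  by (rule ext) (simp add: Phi_k_def channel_def)

lemma Phi_Suc: "Phi (Suc n) \<omega> X = channel ((\<theta> ^^ Suc n) \<omega>) (Phi n \<omega> X)"
  by (simp add: Phi_k_channel)

lemma Phi_pos: "pos_map d (Phi n \<omega>)"
proof (induction n)
  case 0
  have "Phi 0 \<omega> = (\<lambda>X. X)" by (rule ext) simp
  then show ?case by (simp add: pos_map_id)
next
  case (Suc n)
  have "Phi (Suc n) \<omega> = (\<lambda>X. channel ((\<theta> ^^ Suc n) \<omega>) (Phi n \<omega> X))" by (rule ext) (rule Phi_Suc)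
  then show ?case using pos_map_comp[OF channel_pos Suc] by simp
qed

lemma Phi_lin: "lin_map d (Phi n \<omega>)"
  using Phi_pos unfolding pos_map_def by blast

lemma Phi_add: "Phi (n + k) \<omega> X = Phi k ((\<theta> ^^ n) \<omega>) (Phi n \<omega> X)"
proof (induction k)
  case (Suc k)
  have "(\<theta> ^^ Suc (n + k)) \<omega> = (\<theta> ^^ Suc k) ((\<theta> ^^ n) \<omega>)"
    by (metis add.commute add_Suc_right comp_apply funpow_add)
  then show ?case using Suc by (simp only: add_Suc_right Phi_Suc)
qed simp

section \<open>Measurability and invariance of the shifts\<close>

lemma theta_meas [measurable]: "\<theta> \<in> M \<rightarrow>\<^sub>M M" and thetai_meas [measurable]: "\<theta>i \<in> M \<rightarrow>\<^sub>M M"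
  using mpt unfolding ergodic_mpt_def \<theta>i_def by auto

lemma theta_pow_meas [measurable]: "(\<theta> ^^ n) \<in> M \<rightarrow>\<^sub>M M" "(\<theta>i ^^ n) \<in> M \<rightarrow>\<^sub>M M"
  by (induction n) (auto intro: measurable_comp[OF _ theta_meas] measurable_comp[OF _ thetai_meas] simp: comp_def)

lemma theta_space: "\<omega> \<in> space M \<Longrightarrow> (\<theta> ^^ n) \<omega> \<in> space M" "\<omega> \<in> space M \<Longrightarrow> (\<theta>i ^^ n) \<omega> \<in> space M"
  using measurable_space theta_pow_meas by metis+

lemma theta_inv: "\<omega> \<in> space M \<Longrightarrow> \<theta> (\<theta>i \<omega>) = \<omega>" "\<omega> \<in> space M \<Longrightarrow> \<theta>i (\<theta> \<omega>) = \<omega>"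
  using mpt unfolding ergodic_mpt_def \<theta>i_def bij_betw_def
  by (auto intro: f_the_inv_into_f the_inv_into_f_f)

lemma theta_pow_inv: "\<omega> \<in> space M \<Longrightarrow> (\<theta> ^^ k) ((\<theta>i ^^ (n + k)) \<omega>) = (\<theta>i ^^ n) \<omega>"
proof (induction k)
  case (Suc k)
  have "(\<theta> ^^ Suc k) ((\<theta>i ^^ (n + Suc k)) \<omega>) = (\<theta> ^^ k) (\<theta> (\<theta>i ((\<theta>i ^^ (n + k)) \<omega>)))"
    by (simp add: funpow_swap1)
  then show ?case using Suc theta_inv(1)[OF theta_space(2)[OF Suc.prems]] by simp
qed simp

lemma thetai_pow_Suc: "\<omega> \<in> space M \<Longrightarrow> (\<theta>i ^^ Suc n) (\<theta> \<omega>) = (\<theta>i ^^ n) \<omega>"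
  by (simp add: funpow_swap1 theta_inv)

lemma distr_theta: "distr M M \<theta> = M" "distr M M \<theta>i = M"
proof -
  show 1: "distr M M \<theta> = M"
  proof (rule measure_eqI)
    fix A assume "A \<in> sets (distr M M \<theta>)"
    then have "A \<in> sets M" by simp
    then show "emeasure (distr M M \<theta>) A = emeasure M A"
      using mpt unfolding ergodic_mpt_def by (simp add: emeasure_distr emeasure_eq_measure)
  qed simp
  have "distr M M \<theta>i = distr (distr M M \<theta>) M \<theta>i" by (simp add: 1)
  also have "\<dots> = distr M M (\<theta>i \<circ> \<theta>)" by (rule distr_distr) auto
  also have "\<dots> = distr M M (\<lambda>x. x)" by (rule distr_cong) (auto simp: theta_inv)
  finally show "distr M M \<theta>i = M" by simp
qed

lemma distr_pow: "distr M M (\<theta> ^^ n) = M" "distr M M (\<theta>i ^^ n) = M"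
proof -
  have "distr M M (f ^^ n) = M" if f: "distr M M f = M" "f \<in> M \<rightarrow>\<^sub>M M" "\<And>n. (f ^^ n) \<in> M \<rightarrow>\<^sub>M M" for f n
  proof (induction n)
    case (Suc n)
    have "distr M M (f ^^ Suc n) = distr (distr M M (f ^^ n)) M f"
      using distr_distr[OF f(2) f(3)[of n]] by (simp only: funpow.simps(2))
    then show ?case using Suc f(1) by (simp only:)
  qed (simp add: id_def)
  then show "distr M M (\<theta> ^^ n) = M" "distr M M (\<theta>i ^^ n) = M" using distr_theta by auto
qed

lemma AE_pow:
  assumes "AE \<omega> in M. Q \<omega>"
  shows "AE \<omega> in M. \<forall>n. Q ((\<theta> ^^ n) \<omega>)" "AE \<omega> in M. \<forall>n. Q ((\<theta>i ^^ n) \<omega>)"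
proof -
  have "AE \<omega> in M. Q ((\<theta> ^^ n) \<omega>)" for n
  proof (rule AE_distrD[OF theta_pow_meas(1)[of n]])
    show "AE \<omega> in distr M M (\<theta> ^^ n). Q \<omega>" unfolding distr_pow by (rule assms)
  qed
  then show "AE \<omega> in M. \<forall>n. Q ((\<theta> ^^ n) \<omega>)" by (simp add: AE_all_countable)
  have "AE \<omega> in M. Q ((\<theta>i ^^ n) \<omega>)" for n
  proof (rule AE_distrD[OF theta_pow_meas(2)[of n]])
    show "AE \<omega> in distr M M (\<theta>i ^^ n). Q \<omega>" unfolding distr_pow by (rule assms)
  qed
  then show "AE \<omega> in M. \<forall>n. Q ((\<theta>i ^^ n) \<omega>)" by (simp add: AE_all_countable)
qed

lemma integral_pow:
  assumes "f \<in> borel_measurable M"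
  shows "(\<integral>\<omega>. f ((\<theta> ^^ n) \<omega>) \<partial>M) = (\<integral>\<omega>. (f \<omega> :: real) \<partial>M)"
    and "(\<integral>\<omega>. f ((\<theta>i ^^ n) \<omega>) \<partial>M) = (\<integral>\<omega>. f \<omega> \<partial>M)"
  using integral_distr[OF theta_pow_meas(1)[of n] assms] integral_distr[OF theta_pow_meas(2)[of n] assms]
  by (simp_all add: distr_pow)

lemma prob_pow:
  assumes "A \<in> sets M"
  shows "prob {\<omega> \<in> space M. (\<theta> ^^ n) \<omega> \<in> A} = prob A" "prob {\<omega> \<in> space M. (\<theta>i ^^ n) \<omega> \<in> A} = prob A"
proof -
  have *: "prob {\<omega> \<in> space M. f \<omega> \<in> A} = prob A" if "f \<in> M \<rightarrow>\<^sub>M M" "distr M M f = M" for f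
  proof -
    have "measure (distr M M f) A = prob (f -` A \<inter> space M)" by (rule measure_distr[OF that(1) assms])
    also have "f -` A \<inter> space M = {\<omega> \<in> space M. f \<omega> \<in> A}" by auto
    finally show ?thesis using that(2) by simp
  qed
  show "prob {\<omega> \<in> space M. (\<theta> ^^ n) \<omega> \<in> A} = prob A" "prob {\<omega> \<in> space M. (\<theta>i ^^ n) \<omega> \<in> A} = prob A"
    by (rule *; simp add: distr_pow)+
qed

text \<open>Trace preservation holds only almost surely. Demanding it along the whole forward orbit
  gives a property inherited by \<open>\<theta> ^^ n\<close>, so that pointwise estimates can be
  iterated.\<close>

definition Good :: "'w \<Rightarrow> bool" where
  "Good \<omega> \<longleftrightarrow> (\<forall>k. trace_preserving d (channel ((\<theta> ^^ k) \<omega>)))"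

lemma AE_Good: "AE \<omega> in M. Good \<omega>"
proof -
  have "AE \<omega> in M. trace_preserving d (channel \<omega>)"
    using instrument unfolding random_instrument_def channel_def[abs_def] by simp
  then show ?thesis unfolding Good_def by (rule AE_pow)
qed

lemma Good_pow: "Good \<omega> \<Longrightarrow> Good ((\<theta> ^^ n) \<omega>)"
  unfolding Good_def by (metis comp_apply funpow_add)

lemma Phi_tp: "Good \<omega> \<Longrightarrow> trace_preserving d (Phi n \<omega>)"
proof (induction n)
  case (Suc n)
  have "Phi n \<omega> X \<in> carrier_mat d d" if "X \<in> carrier_mat d d" for X
    using lin_mapD(1)[OF Phi_lin that] .
  then show ?case using Suc unfolding trace_preserving_def Good_def by (simp only: Phi_Suc) (metis)
qed (simp add: trace_preserving_def)

lemma Phi_contracts: "Good \<omega> \<Longrightarrow> contracts d (Phi n \<omega>) 1"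
  by (rule contracts_1[OF Phi_pos Phi_tp])

lemma D_le_K: "Good \<omega> \<Longrightarrow> D n \<omega> \<le> K"
  using contracts_dnorm[OF Phi_contracts _ d_pos] unfolding D_def K_def by fastforce

lemma D_add: "Good \<omega> \<Longrightarrow> D (n + k) \<omega> \<le> D k ((\<theta> ^^ n) \<omega>) * D n \<omega>"
proof -
  assume G: "Good \<omega>"
  have "Phi (n + k) \<omega> = (\<lambda>X. Phi k ((\<theta> ^^ n) \<omega>) (Phi n \<omega> X))" by (rule ext) (rule Phi_add)
  then show ?thesis unfolding D_def
    using dnorm_comp[OF Phi_lin[of k "(\<theta> ^^ n) \<omega>"] Phi_lin[of n \<omega>]] Phi_tp[OF G, of n]
    unfolding trace_preserving_def by simp
qed

text \<open>The additional steps form a trace preserving map, whose norm on traceless matrices is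
  bounded by \<open>K\<close>.\<close>

lemma D_mono: "Good \<omega> \<Longrightarrow> m \<le> n \<Longrightarrow> D n \<omega> \<le> K * D m \<omega>"
proof -
  assume G: "Good \<omega>" and "m \<le> n"
  then obtain k where k: "n = m + k" using le_Suc_ex by blast
  have "D n \<omega> \<le> D k ((\<theta> ^^ m) \<omega>) * D m \<omega>" unfolding k by (rule D_add[OF G])
  also have "\<dots> \<le> K * D m \<omega>" by (intro mult_right_mono D_le_K Good_pow G D_nonneg)
  finally show ?thesis .
qed

text \<open>Only the instruments at times \<open>m + 1\<close> to \<open>m + n\<close> enter. The
  \<sigma>-algebra \<open>N\<close> and the shift \<open>m\<close> are kept general because the
  mixing argument needs the same fact for the past and the future \<sigma>-algebra.\<close>

lemma Phi_meas_gen: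
  assumes sp: "space N = space M"
    and c: "\<And>k a g. 1 \<le> k \<Longrightarrow> k \<le> n \<Longrightarrow> g \<in> map_coords d \<Longrightarrow> (\<lambda>\<omega>. g (T a ((\<theta> ^^ (k + m)) \<omega>))) \<in> borel_measurable N"
    and X: "X \<in> carrier_mat d d" and "i < d" "j < d"
  shows "(\<lambda>\<omega>. Phi n ((\<theta> ^^ m) \<omega>) X $$ (i,j)) \<in> borel_measurable N"
  using c \<open>i < d\<close> \<open>j < d\<close>
proof (induction n arbitrary: i j)
  case 0
  then show ?case by simp
next
  case (Suc n)
  have IH: "(\<lambda>\<omega>. Phi n ((\<theta> ^^ m) \<omega>) X $$ (k,l)) \<in> borel_measurable N" if "k < d" "l < d" for k l
    by (rule Suc.IH) (use Suc.prems(1) that in auto)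
  have Tm: "(\<lambda>\<omega>. T a ((\<theta> ^^ (Suc n + m)) \<omega>) (unit_mat d k l) $$ (i,j)) \<in> borel_measurable N" if "k < d" "l < d" for a k l
  proof -
    have "(\<lambda>\<phi>. Re (\<phi> (unit_mat d k l) $$ (i,j))) \<in> map_coords d" "(\<lambda>\<phi>. Im (\<phi> (unit_mat d k l) $$ (i,j))) \<in> map_coords d"
      using that Suc.prems unfolding map_coords_def by blast+
    then show ?thesis using Suc.prems(1)[of "Suc n", OF _ order_refl]
      unfolding borel_measurable_complex_iff by (auto simp del: funpow.simps)
  qed
  have "(\<lambda>\<omega>. Phi (Suc n) ((\<theta> ^^ m) \<omega>) X $$ (i,j)) =
     (\<lambda>\<omega>. \<Sum>a\<in>UNIV. \<Sum>k<d. \<Sum>l<d. Phi n ((\<theta> ^^ m) \<omega>) X $$ (k,l) * T a ((\<theta> ^^ (Suc n + m)) \<omega>) (unit_mat d k l) $$ (i,j))"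
  proof
    fix \<omega>
    have "Phi (Suc n) ((\<theta> ^^ m) \<omega>) X $$ (i,j) =
       (\<Sum>a\<in>UNIV. T a ((\<theta> ^^ Suc n) ((\<theta> ^^ m) \<omega>)) (Phi n ((\<theta> ^^ m) \<omega>) X) $$ (i,j))"
      unfolding Phi_Suc channel_def using Suc.prems by simp
    moreover have "(\<theta> ^^ Suc n) ((\<theta> ^^ m) \<omega>) = (\<theta> ^^ (Suc n + m)) \<omega>" by (simp only: funpow_add comp_apply)
    moreover have "T a \<omega>' (Phi n ((\<theta> ^^ m) \<omega>) X) $$ (i,j) =
      (\<Sum>k<d. \<Sum>l<d. Phi n ((\<theta> ^^ m) \<omega>) X $$ (k,l) * T a \<omega>' (unit_mat d k l) $$ (i,j))" for a \<omega>'
      using T_pos[of a \<omega>'] Suc.prems lin_mapD(1)[OF Phi_lin X]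
      by (intro lin_map_entry) (auto simp: pos_map_def)
    ultimately show "Phi (Suc n) ((\<theta> ^^ m) \<omega>) X $$ (i,j) = (\<Sum>a\<in>UNIV. \<Sum>k<d. \<Sum>l<d. Phi n ((\<theta> ^^ m) \<omega>) X $$ (k,l) * T a ((\<theta> ^^ (Suc n + m)) \<omega>) (unit_mat d k l) $$ (i,j))"
      by simp
  qed
  also have "\<dots> \<in> borel_measurable N"
    by (intro borel_measurable_sum borel_measurable_times IH Tm) auto
  finally show ?case .
qed

lemma D_meas_gen:
  assumes sp: "space N = space M"
    and c: "\<And>k a g. 1 \<le> k \<Longrightarrow> k \<le> n \<Longrightarrow> g \<in> map_coords d \<Longrightarrow> (\<lambda>\<omega>. g (T a ((\<theta> ^^ (k + m)) \<omega>))) \<in> borel_measurable N"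
  shows "(\<lambda>\<omega>. D n ((\<theta> ^^ m) \<omega>)) \<in> borel_measurable N"
  unfolding D_def dnorm_def enorm_def
  by (intro borel_measurable_sum borel_measurable_norm Phi_meas_gen[OF sp c] traceless_unit_carrier
        measurable_compose[OF _ borel_measurable_norm]) auto

lemma T_coord_meas: "g \<in> map_coords d \<Longrightarrow> (\<lambda>\<omega>. g (T a \<omega>)) \<in> borel_measurable M"
  using instrument unfolding random_instrument_def by blast

lemma Phi_meas: "X \<in> carrier_mat d d \<Longrightarrow> i < d \<Longrightarrow> j < d \<Longrightarrow> (\<lambda>\<omega>. Phi n \<omega> X $$ (i,j)) \<in> borel_measurable M"
  using Phi_meas_gen[OF refl, of n 0 X i j] measurable_compose[OF theta_pow_meas(1) T_coord_meas] by simp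

lemma D_meas [measurable]: "D n \<in> borel_measurable M"
  using D_meas_gen[OF refl, of n 0] measurable_compose[OF theta_pow_meas(1) T_coord_meas] by simp

lemma D_integrable: "integrable M (D n)"
proof (rule integrable_const_bound[of _ K])
  show "AE \<omega> in M. norm (D n \<omega>) \<le> K"
    using AE_Good by eventually_elim (simp add: D_le_K D_nonneg)
qed simp

section \<open>Good blocks and almost sure forgetting\<close>

definition G :: "nat \<Rightarrow> real \<Rightarrow> 'w set" where "G n \<kappa> = {\<omega> \<in> space M. minorised d \<kappa> (Phi n \<omega>)}"

lemma G_sets [measurable]: "G n \<kappa> \<in> sets M"
proof -
  obtain Q where Q: "countable Q"
    "\<And>d \<phi> \<kappa>. lin_map d \<phi> \<Longrightarrow>
       minorised d \<kappa> \<phi> \<longleftrightarrow> (\<forall>f\<in>Q. \<forall>g\<in>Q. \<kappa> * Re (cinner d f f) * Re (cinner d g g) \<le> Re (herm_form d (\<phi> (rank_one d f)) g))"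
    by (rule minorised_countable) blast
  have [measurable]: "(\<lambda>\<omega>. Re (herm_form d (Phi n \<omega> (rank_one d f)) g)) \<in> borel_measurable M" for f g
    unfolding herm_form_def
    by (intro measurable_compose[OF _ borel_measurable_Re] borel_measurable_sum borel_measurable_times
        borel_measurable_const Phi_meas rank_one_carrier) auto
  have [simp]: "countable Q" by (rule Q(1))
  have "{\<omega> \<in> space M. \<forall>f\<in>Q. \<forall>g\<in>Q. \<kappa> * Re (cinner d f f) * Re (cinner d g g) \<le> Re (herm_form d (Phi n \<omega> (rank_one d f)) g)} \<in> sets M"
    by measurable
  then show ?thesis unfolding G_def Q(2)[OF Phi_lin] .
qed

lemma G_contracts: "\<omega> \<in> G n \<kappa> \<Longrightarrow> Good \<omega> \<Longrightarrow> contracts d (Phi n \<omega>) (1 - \<kappa> * real d)"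
  unfolding G_def using minorised_contracts[OF Phi_pos Phi_tp] by blast

text \<open>Block \<open>j\<close> covers the times \<open>j * n + 1\<close> to
  \<open>(j + 1) * n\<close>. A bad block still contracts with factor 1, so only the number of good
  ones counts.\<close>

lemma block_contracts:
  assumes "Good \<omega>"
  shows "contracts d (Phi (m * n) \<omega>) ((1 - \<kappa> * real d) ^ card {j. j < m \<and> (\<theta> ^^ (j * n)) \<omega> \<in> G n \<kappa>})"
proof (induction m)
  case 0
  show ?case using Phi_contracts[OF assms, of 0] by (simp del: Phi_n.simps)
next
  case (Suc m)
  let ?A = "\<lambda>m. {j. j < m \<and> (\<theta> ^^ (j * n)) \<omega> \<in> G n \<kappa>}"
  let ?t = "1 - \<kappa> * real d"
  define t where "t = (if (\<theta> ^^ (m * n)) \<omega> \<in> G n \<kappa> then ?t else 1)"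
  have "contracts d (Phi n ((\<theta> ^^ (m * n)) \<omega>)) t"
    unfolding t_def using G_contracts Phi_contracts Good_pow[OF assms] by auto
  from contracts_comp[OF this Suc]
  have "contracts d (\<lambda>X. Phi n ((\<theta> ^^ (m * n)) \<omega>) (Phi (m * n) \<omega> X)) (t * ?t ^ card (?A m))" .
  moreover have "(\<lambda>X. Phi n ((\<theta> ^^ (m * n)) \<omega>) (Phi (m * n) \<omega> X)) = Phi (Suc m * n) \<omega>"
    by (rule ext) (simp only: Phi_add[symmetric] mult_Suc add.commute)
  moreover have "t * ?t ^ card (?A m) = ?t ^ card (?A (Suc m))"
  proof (cases "(\<theta> ^^ (m * n)) \<omega> \<in> G n \<kappa>")
    case True
    then have "?A (Suc m) = insert m (?A m)" by (auto simp: less_Suc_eq)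
    then show ?thesis using True by (simp add: t_def)
  next
    case False
    then have "?A (Suc m) = ?A m" by (auto simp: less_Suc_eq)
    then show ?thesis using False by (simp add: t_def)
  qed
  ultimately show ?case by simp
qed

lemma D_tendsto_0:
  assumes Gd: "Good \<omega>" and "0 < \<kappa>" and inf: "\<exists>\<^sub>\<infinity>j. (\<theta> ^^ (j * n)) \<omega> \<in> G n \<kappa>"
  shows "(\<lambda>m. D m \<omega>) \<longlonglongrightarrow> 0"
proof -
  let ?t = "1 - \<kappa> * real d"
  let ?S = "{j. (\<theta> ^^ (j * n)) \<omega> \<in> G n \<kappa>}"
  have infS: "infinite ?S" using inf by (simp add: INFM_iff_infinite)
  have t: "0 \<le> ?t" "?t < 1"
  proof -
    obtain j where "(\<theta> ^^ (j * n)) \<omega> \<in> G n \<kappa>" using infS not_finite_existsD by blast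
    from contracts_nonneg[OF G_contracts[OF this Good_pow[OF Gd]] d_pos] show "0 \<le> ?t" .
    show "?t < 1" using \<open>0 < \<kappa>\<close> d_pos by simp
  qed
  show ?thesis
  proof (rule LIMSEQ_I)
    fix r :: real assume "0 < r"
    \<comment> \<open>One \<open>K\<close> converts contraction into norm at the end of a block, the
      other covers the later times through \<open>D_mono\<close>.\<close>
    have "(\<lambda>k. K * (K * ?t ^ k)) \<longlonglongrightarrow> K * (K * 0)"
      using t by (intro tendsto_mult tendsto_const LIMSEQ_power_zero) auto
    from LIMSEQ_D[OF this \<open>0 < r\<close>] obtain k where k: "norm (K * (K * ?t ^ k)) < r" by auto
    obtain B where B: "B \<subseteq> ?S" "finite B" "card B = k"
      using infinite_arbitrarily_large[OF infS] by blast
    \<comment> \<open>Enough blocks to contain the \<open>k\<close> good ones; 0 is inserted because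
      \<open>B\<close> is empty for \<open>k = 0\<close>.\<close>
    define m where "m = Suc (Max (insert 0 B))"
    have "B \<subseteq> {j. j < m \<and> (\<theta> ^^ (j * n)) \<omega> \<in> G n \<kappa>}"
      using B Max_ge[of "insert 0 B"] unfolding m_def by (auto simp: less_Suc_eq_le)
    then have "k \<le> card {j. j < m \<and> (\<theta> ^^ (j * n)) \<omega> \<in> G n \<kappa>}"
      using card_mono[of "{j. j < m \<and> (\<theta> ^^ (j * n)) \<omega> \<in> G n \<kappa>}" B] B(3) by simp
    then have "?t ^ card {j. j < m \<and> (\<theta> ^^ (j * n)) \<omega> \<in> G n \<kappa>} \<le> ?t ^ k"
      using t by (intro power_decreasing) auto
    then have "D (m * n) \<omega> \<le> K * ?t ^ k"
      using contracts_dnorm[OF block_contracts[OF Gd, of m n \<kappa>] _ d_pos] t K_pos unfolding D_def K_def[symmetric]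
      by (meson mult_left_mono order_trans zero_le_power less_imp_le)
    then have "D p \<omega> < r" if "m * n \<le> p" for p
      using D_mono[OF Gd that] k K_pos t by (smt (verit, best) mult_left_mono norm_ge_zero real_norm_def)
    then show "\<exists>no. \<forall>p\<ge>no. norm (D p \<omega> - 0) < r" using D_nonneg by (intro exI[of _ "m * n"]) auto
  qed
qed

text \<open>Minorisation with some positive constant, written as a countable increasing union for
  the sake of measurability.\<close>

definition E :: "nat \<Rightarrow> 'w set" where "E n = (\<Union>j. G n (1 / real (Suc j)))"

lemma E_sets [measurable]: "E n \<in> sets M" unfolding E_def by measurable

lemma minorised_mono: "minorised d \<kappa> \<phi> \<Longrightarrow> \<kappa>' \<le> \<kappa> \<Longrightarrow> minorised d \<kappa>' \<phi>"
  unfolding minorised_def by (meson cinner_self_nonneg mult_right_mono order_trans)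

lemma AE_eventually_E: "AE \<omega> in M. \<exists>N. \<forall>n\<ge>N. \<omega> \<in> E n"
proof -
  have "\<omega> \<in> E n" if sp: "strictly_positive d (Phi n \<omega>)" and "\<omega> \<in> space M" for n \<omega>
  proof -
    obtain \<kappa> where \<kappa>: "\<kappa> > 0" "minorised d \<kappa> (Phi n \<omega>)"
      using strictly_positive_minorised[OF Phi_lin sp d_pos] by blast
    obtain j where "1 / real (Suc j) < \<kappa>" using \<kappa>(1) nat_approx_posE by blast
    then show ?thesis using minorised_mono[OF \<kappa>(2)] that(2) unfolding E_def G_def by (auto intro: less_imp_le)
  qed
  note * = this
  from esp AE_space show ?thesis by eventually_elim (use * in blast)
qed

lemma prob_E: "(\<lambda>n. prob (E n)) \<longlonglongrightarrow> 1"
proof -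
  have "(\<lambda>n. \<integral>\<omega>. indicator (E n) \<omega> \<partial>M) \<longlonglongrightarrow> (\<integral>\<omega>. (1::real) \<partial>M)"
  proof (rule integral_dominated_convergence[where w="\<lambda>_. 1"])
    show "AE \<omega> in M. (\<lambda>n. indicator (E n) \<omega> :: real) \<longlonglongrightarrow> 1"
      using AE_eventually_E
    proof (rule AE_mp, intro AE_I2 impI)
      fix \<omega> assume "\<exists>N. \<forall>n\<ge>N. \<omega> \<in> E n"
      then have "eventually (\<lambda>n. indicator (E n) \<omega> = (1::real)) sequentially"
        unfolding eventually_sequentially by (auto simp: indicator_def)
      then show "(\<lambda>n. indicator (E n) \<omega> :: real) \<longlonglongrightarrow> 1" by (rule tendsto_eventually)
    qed
  qed (auto simp: indicator_def)
  then show ?thesis by (simp add: prob_space)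
qed

text \<open>The constant supplied by strict positivity depends on the sample point. Fixing
  \<open>n\<close> with \<open>E n\<close> likely and then using continuity from below trades it for
  a deterministic one, which all blocks can share.\<close>

lemma good_block:
  assumes "0 < \<epsilon>"
  obtains n \<kappa> where "0 < \<kappa>" "1 - \<epsilon> < prob (G n \<kappa>)"
proof -
  obtain n where n: "1 - \<epsilon> < prob (E n)"
    using order_tendstoD(1)[OF prob_E, of "1 - \<epsilon>"] assms by (auto simp: eventually_sequentially)
  have "incseq (\<lambda>j. G n (1 / real (Suc j)))"
    unfolding incseq_def G_def by (auto intro: minorised_mono simp: frac_le)
  then have "(\<lambda>j. prob (G n (1 / real (Suc j)))) \<longlonglongrightarrow> prob (E n)"
    unfolding E_def by (intro finite_Lim_measure_incseq) auto
  from order_tendstoD(1)[OF this n] obtain j where "1 - \<epsilon> < prob (G n (1 / real (Suc j)))"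
    by (auto simp: eventually_sequentially)
  then show ?thesis using that[of "1 / real (Suc j)" n] by simp
qed

text \<open>Continuity from above along the tails, that is, Fatou's inequality for limits superior
  of events. It takes the place of Borel-Cantelli for blocks that may depend on each other.\<close>

lemma prob_limsup_ge:
  fixes A :: "nat \<Rightarrow> 'w set"
  assumes A: "\<And>j. A j \<in> sets M" and p: "\<And>j. p \<le> prob (A j)"
  shows "{\<omega> \<in> space M. \<exists>\<^sub>\<infinity>j. \<omega> \<in> A j} \<in> sets M" "p \<le> prob {\<omega> \<in> space M. \<exists>\<^sub>\<infinity>j. \<omega> \<in> A j}"
proof -
  have e: "{\<omega> \<in> space M. \<exists>\<^sub>\<infinity>j. \<omega> \<in> A j} = (\<Inter>m. \<Union>j\<in>{m..}. A j)"
  proof (rule Set.set_eqI)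
    fix \<omega>
    have "\<omega> \<in> space M" if "\<omega> \<in> A j" for j using A that sets.sets_into_space by blast
    moreover have "\<omega> \<in> (\<Inter>m. \<Union>j\<in>{m..}. A j) \<longleftrightarrow> (\<forall>m. \<exists>j\<ge>m. \<omega> \<in> A j)" by auto
    ultimately show "\<omega> \<in> {\<omega> \<in> space M. \<exists>\<^sub>\<infinity>j. \<omega> \<in> A j} \<longleftrightarrow> \<omega> \<in> (\<Inter>m. \<Union>j\<in>{m..}. A j)"
      unfolding INFM_nat_le by blast
  qed
  show "{\<omega> \<in> space M. \<exists>\<^sub>\<infinity>j. \<omega> \<in> A j} \<in> sets M" unfolding e using A by auto
  have "(\<lambda>m. prob (\<Union>j\<in>{m..}. A j)) \<longlonglongrightarrow> prob (\<Inter>m. \<Union>j\<in>{m..}. A j)"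
    using A by (intro finite_Lim_measure_decseq) (auto simp: decseq_def, force)
  moreover have "p \<le> prob (\<Union>j\<in>{m..}. A j)" for m
    using p[of m] finite_measure_mono[of "A m" "\<Union>j\<in>{m..}. A j"] A by force
  ultimately show "p \<le> prob {\<omega> \<in> space M. \<exists>\<^sub>\<infinity>j. \<omega> \<in> A j}"
    unfolding e by (intro LIMSEQ_le_const) auto
qed

lemma AE_D_tendsto_0: "AE \<omega> in M. (\<lambda>n. D n \<omega>) \<longlonglongrightarrow> 0"
proof -
  \<comment> \<open>A single block length yields infinitely many good blocks only with probability
    close to 1, so countably many lengths are combined.\<close>
  have "\<exists>n \<kappa>. 0 < \<kappa> \<and> 1 - 1 / real (Suc m) < prob (G n \<kappa>)" for m
    using good_block[of "1 / real (Suc m)"] by (metis of_nat_0_less_iff zero_less_Suc zero_less_divide_1_iff)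
  then obtain n \<kappa> where n\<kappa>: "\<And>m. 0 < \<kappa> m" "\<And>m. 1 - 1 / real (Suc m) < prob (G (n m) (\<kappa> m))" by metis
  define A where "A m j = {\<omega> \<in> space M. (\<theta> ^^ (j * n m)) \<omega> \<in> G (n m) (\<kappa> m)}" for m j
  define L where "L m = {\<omega> \<in> space M. \<exists>\<^sub>\<infinity>j. \<omega> \<in> A m j}" for m
  have As: "A m j \<in> sets M" for m j unfolding A_def by measurable
  have "prob (G (n m) (\<kappa> m)) \<le> prob (A m j)" for m j
    unfolding A_def by (simp add: prob_pow)
  from prob_limsup_ge[OF As this] have Ls: "L m \<in> sets M" and Lp: "prob (G (n m) (\<kappa> m)) \<le> prob (L m)" for m
    unfolding L_def by auto
  have "prob (\<Union>m. L m) = 1"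
  proof (rule antisym)
    have "1 - 1 / real (Suc m) \<le> prob (\<Union>m. L m)" for m
      using n\<kappa>(2)[of m] Lp[of m] finite_measure_mono[of "L m" "\<Union>m. L m"] Ls by force
    moreover have "(\<lambda>m. 1 - 1 / real (Suc m)) \<longlonglongrightarrow> 1 - 0"
      by (intro tendsto_diff tendsto_const LIMSEQ_Suc lim_1_over_n)
    ultimately show "1 \<le> prob (\<Union>m. L m)" by (intro LIMSEQ_le_const2[where X="\<lambda>m. 1 - 1 / real (Suc m)"]) auto
  qed simp
  then have "AE \<omega> in M. \<omega> \<in> (\<Union>m. L m)" using Ls AE_in_set_eq_1[of "\<Union>m. L m"] by blast
  with AE_Good show ?thesis
  proof (eventually_elim)
    case (elim \<omega>)
    then obtain m where "\<exists>\<^sub>\<infinity>j. \<omega> \<in> A m j" unfolding L_def by auto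
    then have "\<exists>\<^sub>\<infinity>j. (\<theta> ^^ (j * n m)) \<omega> \<in> G (n m) (\<kappa> m)" unfolding A_def by (auto elim: INFM_mono)
    from D_tendsto_0[OF elim(1) n\<kappa>(1) this] show ?case .
  qed
qed

definition b :: "nat \<Rightarrow> real" where "b n = (\<integral>\<omega>. D n \<omega> \<partial>M)"

lemma b_tendsto_0: "b \<longlonglongrightarrow> 0"
proof -
  have "(\<lambda>n. \<integral>\<omega>. D n \<omega> \<partial>M) \<longlonglongrightarrow> (\<integral>\<omega>. 0 \<partial>M)"
  proof (rule integral_dominated_convergence[where w="\<lambda>_. K"])
    show "AE \<omega> in M. norm (D n \<omega>) \<le> K" for n
      using AE_Good by eventually_elim (simp add: D_le_K D_nonneg)
  qed (use AE_D_tendsto_0 in auto)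
  then show ?thesis unfolding b_def[abs_def] by simp
qed

lemma b_nonneg: "0 \<le> b n" unfolding b_def by (intro Bochner_Integration.integral_nonneg D_nonneg)

lemma b_mono: "m \<le> n \<Longrightarrow> b n \<le> K * b m"
proof -
  assume "m \<le> n"
  have "b n \<le> (\<integral>\<omega>. K * D m \<omega> \<partial>M)" unfolding b_def
  proof (rule integral_mono_AE)
    show "AE \<omega> in M. D n \<omega> \<le> K * D m \<omega>" using AE_Good by eventually_elim (simp add: D_mono \<open>m \<le> n\<close>)
  qed (auto intro: D_integrable)
  then show ?thesis by (simp add: b_def)
qed

end

section \<open>The stationary state and quenched laws\<close>

lemma statesD:
  assumes "\<rho> \<in> states d"
  shows "psd d \<rho>" "mtrace \<rho> = 1" "\<rho> \<in> carrier_mat d d"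
  using assms psd_carrier unfolding states_def by auto

lemma enorm_state_diff:
  assumes "\<rho> \<in> states d" "\<sigma> \<in> states d"
  shows "enorm d (\<rho> - \<sigma>) \<le> 2 * (real d)\<^sup>2"
proof -
  have "enorm d (\<rho> - \<sigma>) \<le> (\<Sum>i<d. \<Sum>j<d. 2)"
    unfolding enorm_def
  proof (intro sum_mono)
    fix i j assume ij: "i \<in> {..<d}" "j \<in> {..<d}"
    have "cmod (\<rho> $$ (i,j)) \<le> 1" "cmod (\<sigma> $$ (i,j)) \<le> 1"
      using psd_entry_le[of d _ i j] ij statesD[OF assms(1)] statesD[OF assms(2)] by force+
    then show "cmod ((\<rho> - \<sigma>) $$ (i,j)) \<le> 2"
      using ij statesD(3)[OF assms(1)] statesD(3)[OF assms(2)] norm_triangle_ineq4[of "\<rho> $$ (i,j)" "\<sigma> $$ (i,j)"]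
      by auto
  qed
  then show ?thesis by (simp add: power2_eq_square)
qed

lemma states_closed:
  assumes X: "\<And>n::nat. X n \<in> states d"
    and lim: "\<And>i j. i < d \<Longrightarrow> j < d \<Longrightarrow> (\<lambda>n. X n $$ (i,j)) \<longlonglongrightarrow> L i j"
  shows "mat d d (\<lambda>(i,j). L i j) \<in> states d"
proof -
  have "psd d (mat d d (\<lambda>(i,j). L i j))"
  proof (rule psdI)
    fix i j assume ij: "i < d" "j < d"
    have "X n $$ (i,j) = cnj (X n $$ (j,i))" for n
      using statesD(1)[OF X] ij unfolding psd_iff hermitian_def by blast
    then have "(\<lambda>n. X n $$ (i,j)) \<longlonglongrightarrow> cnj (L j i)"
      using tendsto_cnj[OF lim[OF ij(2,1)]] by (simp only:)
    from LIMSEQ_unique[OF lim[OF ij] this]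
    show "mat d d (\<lambda>(i,j). L i j) $$ (i,j) = cnj (mat d d (\<lambda>(i,j). L i j) $$ (j,i))" using ij by simp
  next
    fix f
    have "(\<lambda>n. Re (herm_form d (X n) f)) \<longlonglongrightarrow> Re (\<Sum>i<d. \<Sum>j<d. cnj (f i) * L i j * f j)"
      unfolding herm_form_def by (intro tendsto_Re tendsto_sum tendsto_mult tendsto_const lim) auto
    moreover have "(\<Sum>i<d. \<Sum>j<d. cnj (f i) * L i j * f j) = herm_form d (mat d d (\<lambda>(i,j). L i j)) f"
      unfolding herm_form_def by (intro sum.cong refl) auto
    moreover have "0 \<le> Re (herm_form d (X n) f)" for n using statesD(1)[OF X] unfolding psd_iff by blast
    ultimately show "0 \<le> Re (herm_form d (mat d d (\<lambda>(i,j). L i j)) f)" by (intro LIMSEQ_le_const) auto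
  qed simp
  moreover have "mtrace (mat d d (\<lambda>(i,j). L i j)) = 1"
  proof -
    have "(\<lambda>n. \<Sum>i<d. X n $$ (i,i)) \<longlonglongrightarrow> (\<Sum>i<d. L i i)" by (intro tendsto_sum lim) auto
    moreover have "(\<Sum>i<d. X n $$ (i,i)) = 1" for n
      using statesD(2,3)[OF X[of n]] unfolding mtrace_def by auto
    ultimately have "(\<Sum>i<d. L i i) = 1" using LIMSEQ_unique[OF _ tendsto_const] by simp
    then show ?thesis unfolding mtrace_def by simp
  qed
  ultimately show ?thesis unfolding states_def by simp
qed

lemma hermitian_minus:
  assumes "hermitian d A" "hermitian d B" "A \<in> carrier_mat d d" "B \<in> carrier_mat d d"
  shows "hermitian d (A - B)"
  unfolding hermitian_def
proof (intro allI impI)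
  fix i j assume ij: "i < d" "j < d"
  have "A $$ (i,j) = cnj (A $$ (j,i))" "B $$ (i,j) = cnj (B $$ (j,i))"
    using assms(1,2) ij unfolding hermitian_def by blast+
  then have "A $$ (i,j) - B $$ (i,j) = cnj (A $$ (j,i) - B $$ (j,i))" by simp
  then show "(A - B) $$ (i,j) = cnj ((A - B) $$ (j,i))" using assms(3,4) ij by simp
qed

context random_channel
begin

definition \<rho>0 :: "complex mat" where "\<rho>0 = rank_one d (\<lambda>i. of_bool (i = 0))"

lemma \<rho>0_state: "\<rho>0 \<in> states d"
proof -
  have "cinner d (\<lambda>i. of_bool (i = 0)) (\<lambda>i. of_bool (i = 0)) = 1"
    unfolding cinner_def using d_pos by (simp add: of_bool_def if_distrib if_distribR sum.delta cong: if_cong)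
  then show ?thesis unfolding states_def \<rho>0_def using rank_one_psd rank_one_trace by simp
qed

lemma Phi_state: "Good \<omega> \<Longrightarrow> \<rho> \<in> states d \<Longrightarrow> Phi n \<omega> \<rho> \<in> states d"
proof -
  assume G: "Good \<omega>" and \<rho>: "\<rho> \<in> states d"
  have "psd d (Phi n \<omega> \<rho>)" using Phi_pos statesD(1)[OF \<rho>] unfolding pos_map_def by blast
  moreover have "mtrace (Phi n \<omega> \<rho>) = 1"
    using Phi_tp[OF G] statesD(2,3)[OF \<rho>] unfolding trace_preserving_def by simp
  ultimately show ?thesis unfolding states_def by simp
qed

lemma Phi_diff:
  assumes "\<rho> \<in> states d" "\<sigma> \<in> states d"
  shows "enorm d (Phi n \<omega> \<rho> - Phi n \<omega> \<sigma>) \<le> 2 * (real d)\<^sup>2 * D n \<omega>"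
proof -
  note c = statesD(3)[OF assms(1)] statesD(3)[OF assms(2)]
  have "mtrace (\<rho> - \<sigma>) = 0" using mtrace_minus[OF c] statesD(2) assms by simp
  then have "enorm d (Phi n \<omega> (\<rho> - \<sigma>)) \<le> D n \<omega> * enorm d (\<rho> - \<sigma>)"
    unfolding D_def using c by (intro enorm_dnorm[OF Phi_lin]) auto
  also have "\<dots> \<le> D n \<omega> * (2 * (real d)\<^sup>2)"
    by (intro mult_left_mono enorm_state_diff assms D_nonneg)
  finally show ?thesis using lin_map_minus[OF Phi_lin c] by (simp add: mult.commute)
qed

lemma Phi_diff_entry:
  assumes "\<rho> \<in> states d" "\<sigma> \<in> states d" "i < d" "j < d"
  shows "cmod (Phi n \<omega> \<rho> $$ (i,j) - Phi n \<omega> \<sigma> $$ (i,j)) \<le> 2 * (real d)\<^sup>2 * D n \<omega>"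
proof -
  have "Phi n \<omega> \<rho> \<in> carrier_mat d d" "Phi n \<omega> \<sigma> \<in> carrier_mat d d"
    using lin_mapD(1)[OF Phi_lin] statesD(3) assms by auto
  then have "Phi n \<omega> \<rho> $$ (i,j) - Phi n \<omega> \<sigma> $$ (i,j) = (Phi n \<omega> \<rho> - Phi n \<omega> \<sigma>) $$ (i,j)"
    using assms by auto
  then show ?thesis using entry_le_enorm[OF assms(3,4)] Phi_diff[OF assms(1,2)] order_trans by metis
qed

section \<open>Convergence from the remote past\<close>

lemma D_past_meas [measurable]: "(\<lambda>\<omega>. D n ((\<theta>i ^^ n) \<omega>)) \<in> borel_measurable M"
  by (rule measurable_compose[OF theta_pow_meas(2) D_meas])

text \<open>Starting earlier puts more channels in front of the last \<open>m\<close> steps and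
  leaves those steps unchanged.\<close>

lemma D_past_mono:
  assumes "\<omega> \<in> space M" "\<forall>k. Good ((\<theta>i ^^ k) \<omega>)" "m \<le> n"
  shows "D n ((\<theta>i ^^ n) \<omega>) \<le> K * D m ((\<theta>i ^^ m) \<omega>)"
proof -
  obtain k where k: "n = m + k" using assms(3) le_Suc_ex by blast
  have "D n ((\<theta>i ^^ n) \<omega>) \<le> D m ((\<theta> ^^ k) ((\<theta>i ^^ n) \<omega>)) * D k ((\<theta>i ^^ n) \<omega>)"
    using D_add[of "(\<theta>i ^^ n) \<omega>" k m] assms(2) unfolding k by (simp add: add.commute)
  also have "(\<theta> ^^ k) ((\<theta>i ^^ n) \<omega>) = (\<theta>i ^^ m) \<omega>" unfolding k by (rule theta_pow_inv[OF assms(1)])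
  also have "D m ((\<theta>i ^^ m) \<omega>) * D k ((\<theta>i ^^ n) \<omega>) \<le> D m ((\<theta>i ^^ m) \<omega>) * K"
    using D_le_K assms(2) by (intro mult_left_mono D_nonneg) auto
  finally show ?thesis by (simp add: mult.commute)
qed

definition regular :: "'w \<Rightarrow> bool" where
  "regular \<omega> \<longleftrightarrow> \<omega> \<in> space M \<and> (\<forall>k. Good ((\<theta>i ^^ k) \<omega>)) \<and> (\<lambda>n. D n ((\<theta>i ^^ n) \<omega>)) \<longlonglongrightarrow> 0"

text \<open>Markov's inequality: the shifted norm has mean \<open>b n\<close>, so the event that no
  \<open>n\<close> works has probability at most \<open>(m + 1) * b n\<close> for every
  \<open>n\<close>.\<close>

lemma AE_small_past: "AE \<omega> in M. \<exists>n. D n ((\<theta>i ^^ n) \<omega>) < 1 / real (Suc m)"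
proof -
  define F where "F = {\<omega> \<in> space M. \<forall>n. 1 / real (Suc m) \<le> D n ((\<theta>i ^^ n) \<omega>)}"
  have Fs [measurable]: "F \<in> sets M" unfolding F_def by measurable
  have "prob F \<le> real (Suc m) * b n" for n
  proof -
    have int: "integrable M (\<lambda>\<omega>. D n ((\<theta>i ^^ n) \<omega>))"
      using integrable_distr[OF theta_pow_meas(2)[of n], of "D n"] D_integrable distr_pow by simp
    have "prob F = (\<integral>\<omega>. indicator F \<omega> \<partial>M)" by simp
    also have "\<dots> \<le> (\<integral>\<omega>. real (Suc m) * D n ((\<theta>i ^^ n) \<omega>) \<partial>M)"
    proof (rule integral_mono)
      fix \<omega> assume "\<omega> \<in> space M"
      show "indicator F \<omega> \<le> real (Suc m) * D n ((\<theta>i ^^ n) \<omega>)"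
      proof (cases "\<omega> \<in> F")
        case True
        then have "1 / real (Suc m) \<le> D n ((\<theta>i ^^ n) \<omega>)" unfolding F_def by blast
        then show ?thesis using True by (simp add: field_simps)
      qed (simp add: D_nonneg)
    next
      show "integrable M (indicat_real F)"
        by (rule integrable_const_bound[of _ 1]) (simp_all add: indicator_def)
    qed (use int in auto)
    also have "\<dots> = real (Suc m) * b n" unfolding b_def using integral_pow(2)[OF D_meas] by simp
    finally show ?thesis .
  qed
  then have "prob F \<le> real (Suc m) * 0"
    by (intro LIMSEQ_le_const[OF tendsto_mult[OF tendsto_const b_tendsto_0]] exI[of _ 0] allI impI)
  then have "prob F = 0" by (simp add: measure_le_0_iff)
  then have "AE \<omega> in M. \<omega> \<notin> F" by (simp add: AE_iff_measurable[OF Fs] emeasure_eq_measure Collect_conv_if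
        sets.sets_into_space[OF Fs] AE_not_in null_setsI)
  with AE_space show ?thesis by eventually_elim (auto simp: F_def not_le)
qed

lemma AE_regular: "AE \<omega> in M. regular \<omega>"
proof -
  have "AE \<omega> in M. \<forall>m. \<exists>n. D n ((\<theta>i ^^ n) \<omega>) < 1 / real (Suc m)"
    using AE_small_past by (simp add: AE_all_countable)
  with AE_pow(2)[OF AE_Good] AE_space show ?thesis
  proof eventually_elim
    case (elim \<omega>)
    have "(\<lambda>n. D n ((\<theta>i ^^ n) \<omega>)) \<longlonglongrightarrow> 0"
    proof (rule LIMSEQ_I)
      fix r :: real assume "0 < r"
      \<comment> \<open>The threshold \<open>r / K\<close> absorbs the factor lost in
        \<open>D_past_mono\<close>.\<close>
      then obtain m where m: "1 / real (Suc m) < r / K" using K_pos nat_approx_posE by (metis divide_pos_pos)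
      obtain n where "D n ((\<theta>i ^^ n) \<omega>) < 1 / real (Suc m)" using elim by blast
      then have "K * D n ((\<theta>i ^^ n) \<omega>) < K * (1 / real (Suc m))"
        by (intro mult_strict_left_mono K_pos)
      also have "\<dots> < r" using m K_pos by (simp add: pos_less_divide_eq mult.commute)
      finally have "K * D n ((\<theta>i ^^ n) \<omega>) < r" .
      then have "D p ((\<theta>i ^^ p) \<omega>) < r" if "n \<le> p" for p
        using D_past_mono[OF elim(2,1) that] by simp
      then show "\<exists>no. \<forall>p\<ge>no. norm (D p ((\<theta>i ^^ p) \<omega>) - 0) < r" using D_nonneg by (intro exI[of _ n]) auto
    qed
    with elim show ?case unfolding regular_def by blast
  qed
qed

definition lims :: "'w \<Rightarrow> complex mat" where
  "lims \<omega> = mat d d (\<lambda>(i,j). lim (\<lambda>n. Phi n ((\<theta>i ^^ n) \<omega>) \<rho>0 $$ (i,j)))"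

text \<open>The initial states may vary with the starting time. This is what identifies every
  stationary state with the limit, by starting from its own values in the past.\<close>

lemma past_tendsto_lims:
  assumes R: "regular \<omega>" and \<rho>: "\<And>n. \<rho> n \<in> states d" and ij: "i < d" "j < d"
  shows "(\<lambda>n. Phi n ((\<theta>i ^^ n) \<omega>) (\<rho> n) $$ (i,j)) \<longlonglongrightarrow> lims \<omega> $$ (i,j)"
proof -
  have G: "Good ((\<theta>i ^^ k) \<omega>)" and sp: "\<omega> \<in> space M" and D0: "(\<lambda>n. D n ((\<theta>i ^^ n) \<omega>)) \<longlonglongrightarrow> 0" for k
    using R unfolding regular_def by auto
  let ?c = "2 * (real d)\<^sup>2"
  let ?x = "\<lambda>n. Phi n ((\<theta>i ^^ n) \<omega>) \<rho>0 $$ (i,j)"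
  have c: "?c > 0" using d_pos by simp
  have D0': "(\<lambda>n. ?c * D n ((\<theta>i ^^ n) \<omega>)) \<longlonglongrightarrow> 0"
    using tendsto_mult[OF tendsto_const D0, of ?c] by simp
  \<comment> \<open>A run started \<open>k\<close> steps earlier is just another state at time
    \<open>-n\<close>; both states are then moved by the same \<open>n\<close> channels.\<close>
  have step: "cmod (?x (n + k) - ?x n) \<le> ?c * D n ((\<theta>i ^^ n) \<omega>)" for n k
  proof -
    have "Phi (n + k) ((\<theta>i ^^ (n + k)) \<omega>) \<rho>0 =
        Phi n ((\<theta> ^^ k) ((\<theta>i ^^ (n + k)) \<omega>)) (Phi k ((\<theta>i ^^ (n + k)) \<omega>) \<rho>0)"
      using Phi_add[of k n] by (simp add: add.commute)
    then show ?thesis unfolding theta_pow_inv[OF sp]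
      using Phi_diff_entry[OF Phi_state[OF G \<rho>0_state] \<rho>0_state ij] by simp
  qed
  have "Cauchy ?x"
  proof (rule CauchyI')
    fix e :: real assume "0 < e"
    from LIMSEQ_D[OF D0' this] obtain N where N: "\<And>n. n \<ge> N \<Longrightarrow> norm (?c * D n ((\<theta>i ^^ n) \<omega>)) < e" by auto
    have "norm (?x m - ?x n) < e" if "N \<le> m" "m < n" for m n
    proof -
      obtain k where "n = m + k" using \<open>m < n\<close> less_imp_le le_Suc_ex by blast
      then show ?thesis using step[of m k] N[OF \<open>N \<le> m\<close>] by (simp add: norm_minus_commute)
    qed
    then show "\<exists>N. \<forall>m\<ge>N. \<forall>n>m. dist (?x m) (?x n) < e" by (auto simp: dist_norm)
  qed
  then have "?x \<longlonglongrightarrow> lim ?x" using Cauchy_convergent convergent_LIMSEQ_iff by blast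
  moreover have "(\<lambda>n. Phi n ((\<theta>i ^^ n) \<omega>) (\<rho> n) $$ (i,j) - ?x n) \<longlonglongrightarrow> 0"
    by (rule Lim_null_comparison[OF _ D0']) (intro always_eventually allI Phi_diff_entry \<rho> \<rho>0_state ij)
  ultimately have "(\<lambda>n. (Phi n ((\<theta>i ^^ n) \<omega>) (\<rho> n) $$ (i,j) - ?x n) + ?x n) \<longlonglongrightarrow> 0 + lim ?x"
    by (intro tendsto_add)
  then show ?thesis using ij by (simp add: lims_def)
qed

lemma lims_state: "regular \<omega> \<Longrightarrow> lims \<omega> \<in> states d"
proof -
  assume R: "regular \<omega>"
  have "mat d d (\<lambda>(i,j). lims \<omega> $$ (i,j)) \<in> states d"
    using R \<rho>0_state
    by (intro states_closed[of "\<lambda>n. Phi n ((\<theta>i ^^ n) \<omega>) \<rho>0"] Phi_state past_tendsto_lims[of \<omega> "\<lambda>_. \<rho>0"])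
       (auto simp: regular_def)
  moreover have "mat d d (\<lambda>(i,j). lims \<omega> $$ (i,j)) = lims \<omega>" by (rule eq_matI) (auto simp: lims_def)
  ultimately show ?thesis by simp
qed

lemma channel_lin: "lin_map d (channel \<omega>)"
  using channel_pos unfolding pos_map_def by blast

text \<open>A channel is linear in finitely many entries, hence continuous, and it turns the
  approximating sequence at \<open>\<omega>\<close> into that at \<open>\<theta> \<omega>\<close>
  with the index moved by one.\<close>

lemma lims_step:
  assumes R: "regular \<omega>" "regular (\<theta> \<omega>)"
  shows "channel (\<theta> \<omega>) (lims \<omega>) = lims (\<theta> \<omega>)"
proof (rule eq_matI)
  fix i j assume "i < dim_row (lims (\<theta> \<omega>))" "j < dim_col (lims (\<theta> \<omega>))"
  then have ij: "i < d" "j < d" by (auto simp: lims_def)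
  have sp: "\<omega> \<in> space M" and G: "\<And>k. Good ((\<theta>i ^^ k) \<omega>)" using R(1) unfolding regular_def by auto
  let ?X = "\<lambda>n. Phi n ((\<theta>i ^^ n) \<omega>) \<rho>0"
  have Xc: "?X n \<in> carrier_mat d d" for n using statesD(3)[OF Phi_state[OF G \<rho>0_state]] .
  have 1: "(\<lambda>n. channel (\<theta> \<omega>) (?X n) $$ (i,j)) \<longlonglongrightarrow> channel (\<theta> \<omega>) (lims \<omega>) $$ (i,j)"
    unfolding lin_map_entry[OF channel_lin Xc ij] lin_map_entry[OF channel_lin statesD(3)[OF lims_state[OF R(1)]] ij]
    by (intro tendsto_sum tendsto_mult tendsto_const past_tendsto_lims[OF R(1) \<rho>0_state]) auto
  have 2: "channel (\<theta> \<omega>) (?X n) = Phi (Suc n) ((\<theta>i ^^ Suc n) (\<theta> \<omega>)) \<rho>0" for n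
  proof -
    have "(\<theta> ^^ Suc n) ((\<theta>i ^^ n) \<omega>) = \<theta> \<omega>" using theta_pow_inv[OF sp, of n 0] by simp
    then show ?thesis unfolding thetai_pow_Suc[OF sp] Phi_Suc by simp
  qed
  have "(\<lambda>n. Phi (Suc n) ((\<theta>i ^^ Suc n) (\<theta> \<omega>)) \<rho>0 $$ (i,j)) \<longlonglongrightarrow> lims (\<theta> \<omega>) $$ (i,j)"
    using LIMSEQ_Suc[OF past_tendsto_lims[OF R(2) \<rho>0_state ij]] .
  from LIMSEQ_unique[OF 1[unfolded 2] this]
  show "channel (\<theta> \<omega>) (lims \<omega>) $$ (i,j) = lims (\<theta> \<omega>) $$ (i,j)" .
qed (auto simp: lims_def channel_def)

lemma lims_meas: "i < d \<Longrightarrow> j < d \<Longrightarrow> (\<lambda>\<omega>. lims \<omega> $$ (i,j)) \<in> borel_measurable M"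
proof -
  assume ij: "i < d" "j < d"
  have "(\<lambda>\<omega>. Phi n ((\<theta>i ^^ n) \<omega>) \<rho>0 $$ (i,j)) \<in> borel_measurable M" for n
    by (rule measurable_compose[OF theta_pow_meas(2) Phi_meas]) (use ij statesD(3)[OF \<rho>0_state] in auto)
  then have "(\<lambda>\<omega>. lim (\<lambda>n. Phi n ((\<theta>i ^^ n) \<omega>) \<rho>0 $$ (i,j))) \<in> borel_measurable M"
    by (rule borel_measurable_lim_metric)
  then show ?thesis using ij by (simp add: lims_def)
qed

section \<open>Existence, uniqueness and positivity of the stationary state\<close>

lemma dyn_stationary_exists:
  "\<exists>s. dyn_stationary d M \<theta> T s \<and> (AE \<omega> in M. s \<omega> = lims \<omega>)"
proof -
  obtain N where N: "{\<omega> \<in> space M. \<not> regular \<omega>} \<subseteq> N" "emeasure M N = 0" "N \<in> sets M"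
    using AE_E[OF AE_regular] by blast
  \<comment> \<open>A random state must be a state at every point of the space, but
    \<open>lims\<close> is known to be one only at regular points. It is redefined on a measurable
    null set that contains the others.\<close>
  define s where "s \<omega> = (if \<omega> \<in> N then \<rho>0 else lims \<omega>)" for \<omega>
  have "AE \<omega> in M. \<omega> \<notin> N" using N by (intro AE_not_in) (auto simp: null_sets_def)
  then have s: "AE \<omega> in M. s \<omega> = lims \<omega>" by eventually_elim (simp add: s_def)
  have "s \<omega> \<in> states d" if "\<omega> \<in> space M" for \<omega>
    using N(1) that \<rho>0_state lims_state unfolding s_def by auto
  moreover have "(\<lambda>\<omega>. g (s \<omega>)) \<in> borel_measurable M" if g: "g \<in> mat_coords d" for g
  proof -
    from g obtain f i j where fg: "g = (\<lambda>X. f (X $$ (i,j)))" "i < d" "j < d" "f = Re \<or> f = Im"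
      unfolding mat_coords_def by blast
    have "(\<lambda>\<omega>. s \<omega> $$ (i,j)) = (\<lambda>\<omega>. if \<omega> \<in> N then \<rho>0 $$ (i,j) else lims \<omega> $$ (i,j))"
      by (auto simp: s_def)
    also have "\<dots> \<in> borel_measurable M"
      using lims_meas[OF fg(2,3)] N(3) by (intro measurable_If_set) auto
    finally show ?thesis using fg(4) unfolding fg(1) by (auto simp: borel_measurable_complex_iff)
  qed
  ultimately have rs: "random_state d M s" unfolding random_state_def by blast
  have "AE \<omega> in M. \<forall>n. regular ((\<theta> ^^ n) \<omega>) \<and> s ((\<theta> ^^ n) \<omega>) = lims ((\<theta> ^^ n) \<omega>)"
    using s AE_regular by (intro AE_pow(1)) auto
  then have "AE \<omega> in M. \<forall>n. Phi n \<omega> (s \<omega>) = s ((\<theta> ^^ n) \<omega>)"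
  proof eventually_elim
    case (elim \<omega>)
    show ?case
    proof
      fix n show "Phi n \<omega> (s \<omega>) = s ((\<theta> ^^ n) \<omega>)"
      proof (induction n)
        case (Suc n)
        have "Phi (Suc n) \<omega> (s \<omega>) = channel (\<theta> ((\<theta> ^^ n) \<omega>)) (lims ((\<theta> ^^ n) \<omega>))"
          unfolding Phi_Suc Suc using elim[rule_format, of n] by simp
        also have "\<dots> = lims (\<theta> ((\<theta> ^^ n) \<omega>))"
          using elim[rule_format, of n] elim[rule_format, of "Suc n"] by (intro lims_step) auto
        finally show ?case using elim[rule_format, of "Suc n"] by simp
      qed simp
    qed
  qed
  with rs s show ?thesis unfolding dyn_stationary_def by blast
qed

text \<open>The backward shift preserves probabilities, so the exceptional event has probability at
  most \<open>1 - prob (E n)\<close> for every \<open>n\<close>.\<close>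

lemma AE_E_cover: "AE \<omega> in M. \<exists>n. (\<theta>i ^^ n) \<omega> \<in> E n"
proof -
  define F where "F = {\<omega> \<in> space M. \<forall>n. (\<theta>i ^^ n) \<omega> \<notin> E n}"
  have Fs [measurable]: "F \<in> sets M" unfolding F_def by measurable
  have "prob F \<le> 1 - prob (E n)" for n
  proof -
    have "prob F \<le> prob {\<omega> \<in> space M. (\<theta>i ^^ n) \<omega> \<in> space M - E n}"
      by (intro finite_measure_mono) (auto simp: F_def theta_space)
    also have "\<dots> = prob (space M - E n)" by (rule prob_pow) auto
    finally show ?thesis by (simp add: prob_compl)
  qed
  moreover have "(\<lambda>n. 1 - prob (E n)) \<longlonglongrightarrow> 1 - 1" by (intro tendsto_diff tendsto_const prob_E)
  ultimately have "prob F \<le> 1 - 1" by (intro LIMSEQ_le_const) auto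
  then have "F \<in> null_sets M" using Fs by (auto simp: null_sets_def emeasure_eq_measure measure_le_0_iff)
  then have "AE \<omega> in M. \<omega> \<notin> F" by (rule AE_not_in)
  with AE_space show ?thesis by eventually_elim (auto simp: F_def)
qed

lemma dyn_stationary_past:
  assumes "dyn_stationary d M \<theta> T s"
  shows "AE \<omega> in M. \<forall>n. Phi n ((\<theta>i ^^ n) \<omega>) (s ((\<theta>i ^^ n) \<omega>)) = s \<omega> \<and> s ((\<theta>i ^^ n) \<omega>) \<in> states d"
proof -
  have "AE \<omega> in M. \<forall>n. Phi n \<omega> (s \<omega>) = s ((\<theta> ^^ n) \<omega>)" "random_state d M s"
    using assms unfolding dyn_stationary_def by auto
  from AE_pow(2)[OF this(1)] AE_space show ?thesis
  proof eventually_elim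
    case (elim \<omega>)
    have "(\<theta> ^^ n) ((\<theta>i ^^ n) \<omega>) = \<omega>" for n using theta_pow_inv[OF elim(2), of n 0] by simp
    then show ?case using elim \<open>random_state d M s\<close> theta_space(2) unfolding random_state_def by metis
  qed
qed

text \<open>Started from \<open>s\<close> at time \<open>-n\<close>, the dynamics returns
  \<open>s \<omega>\<close> for every \<open>n\<close>; a constant sequence equals its
  limit.\<close>

lemma dyn_stationary_lims:
  assumes "dyn_stationary d M \<theta> T s" shows "AE \<omega> in M. s \<omega> = lims \<omega>"
  using dyn_stationary_past[OF assms] AE_regular
proof eventually_elim
  case (elim \<omega>)
  then have 1: "Phi n ((\<theta>i ^^ n) \<omega>) (s ((\<theta>i ^^ n) \<omega>)) = s \<omega>" and 2: "s ((\<theta>i ^^ n) \<omega>) \<in> states d" for n by auto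
  have sc: "s \<omega> \<in> carrier_mat d d" using 2[of 0] statesD(3) by simp
  have "s \<omega> $$ (i,j) = lims \<omega> $$ (i,j)" if "i < d" "j < d" for i j
    using past_tendsto_lims[of \<omega> "\<lambda>n. s ((\<theta>i ^^ n) \<omega>)", OF elim(2) 2 that] unfolding 1 by (simp add: LIMSEQ_const_iff)
  then show ?case using sc by (intro eq_matI) (auto simp: lims_def)
qed

lemma dyn_stationary_pd:
  assumes "dyn_stationary d M \<theta> T s"
  shows "AE \<omega> in M. \<exists>\<kappa>>0. \<forall>g. \<kappa> * Re (cinner d g g) \<le> Re (herm_form d (s \<omega>) g)"
  using dyn_stationary_past[OF assms] AE_E_cover
proof eventually_elim
  case (elim \<omega>)
  obtain n j where m: "minorised d (1 / real (Suc j)) (Phi n ((\<theta>i ^^ n) \<omega>))"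
    using elim(2) unfolding E_def G_def by blast
  have 1: "Phi n ((\<theta>i ^^ n) \<omega>) (s ((\<theta>i ^^ n) \<omega>)) = s \<omega>" and 2: "s ((\<theta>i ^^ n) \<omega>) \<in> states d" using elim by auto
  have "1 / real (Suc j) * Re (cinner d g g) \<le> Re (herm_form d (s \<omega>) g)" for g
    using minorised_psd[OF Phi_lin m statesD(1)[OF 2], of g] statesD(2)[OF 2] unfolding 1 by simp
  then show ?case by (intro exI[of _ "1 / real (Suc j)"]) auto
qed

section \<open>Quenched laws and absolute continuity\<close>

lemma instr_pos: "pos_map d (instr_word \<theta> T as n \<omega>)"
proof (induction n)
  case 0
  have "instr_word \<theta> T as 0 \<omega> = (\<lambda>X. X)" by (rule ext) simp
  then show ?case by (simp add: pos_map_id)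
next
  case (Suc n)
  have "instr_word \<theta> T as (Suc n) \<omega> = (\<lambda>X. T (as n) ((\<theta> ^^ Suc n) \<omega>) (instr_word \<theta> T as n \<omega> X))" by (rule ext) simp
  then show ?case using pos_map_comp[OF T_pos Suc] by simp
qed

lemma instr_cong: "(\<And>i. i < n \<Longrightarrow> as i = bs i) \<Longrightarrow> instr_word \<theta> T as n \<omega> X = instr_word \<theta> T bs n \<omega> X"
  by (induction n) auto

lemma mtrace_channel: "Y \<in> carrier_mat d d \<Longrightarrow> mtrace (channel \<omega> Y) = (\<Sum>a\<in>UNIV. mtrace (T a \<omega> Y))"
proof -
  assume Y: "Y \<in> carrier_mat d d"
  have "dim_row (T a \<omega> Y) = d" for a using T_pos[of a \<omega>] Y unfolding pos_map_def by (auto dest: lin_mapD(1))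
  then have "(\<Sum>a\<in>UNIV. mtrace (T a \<omega> Y)) = (\<Sum>a\<in>UNIV. \<Sum>i<d. T a \<omega> Y $$ (i,i))" unfolding mtrace_def by simp
  also have "\<dots> = mtrace (channel \<omega> Y)" unfolding mtrace_def channel_def by (subst sum.swap) simp
  finally show ?thesis by simp
qed

text \<open>The weights of words are traces of positive matrices, hence nonnegative reals, and their
  consistency is trace preservation of the channel at the next time. Existence and uniqueness
  together unlock the definite description in \<open>quenched\<close>.\<close>

lemma quenched_props:
  assumes G: "Good \<omega>" and \<rho>: "\<rho> \<in> states d"
  shows "prob_space (quenched \<theta> T \<rho> \<omega>)" "sets (quenched \<theta> T \<rho> \<omega>) = sets seq_space"
    "measure (quenched \<theta> T \<rho> \<omega>) (cyl n as) = Re (mtrace (instr_word \<theta> T as n \<omega> \<rho>))"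
proof -
  define p where "p n as = Re (mtrace (instr_word \<theta> T as n \<omega> \<rho>))" for n as
  have wpsd: "psd d (instr_word \<theta> T as n \<omega> \<rho>)" for n as
    using instr_pos statesD(1)[OF \<rho>] unfolding pos_map_def by blast
  have pc: "complex_of_real (p n as) = mtrace (instr_word \<theta> T as n \<omega> \<rho>)" for n as
    unfolding p_def using psd_trace(1)[OF wpsd] by simp
  have cons: "(\<Sum>a\<in>UNIV. p (Suc n) (as(n := a))) = p n as" for n as
  proof -
    let ?Y = "instr_word \<theta> T as n \<omega> \<rho>"
    have "instr_word \<theta> T (as(n := a)) n \<omega> \<rho> = ?Y" for a by (rule instr_cong) simp
    then have "(\<Sum>a\<in>UNIV. p (Suc n) (as(n := a))) = Re (\<Sum>a\<in>UNIV. mtrace (T a ((\<theta> ^^ Suc n) \<omega>) ?Y))"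
      unfolding p_def by (simp add: Re_sum del: funpow.simps)
    also have "\<dots> = Re (mtrace (channel ((\<theta> ^^ Suc n) \<omega>) ?Y))"
      using mtrace_channel[OF psd_carrier[OF wpsd]] by simp
    also have "\<dots> = p n as" unfolding p_def
      using G psd_carrier[OF wpsd] unfolding Good_def trace_preserving_def by metis
    finally show ?thesis .
  qed
  have "\<exists>Q. prob_space Q \<and> sets Q = sets seq_space \<and> (\<forall>n as. measure Q (cyl n as) = p n as)"
  proof (rule seq_measure_exists)
    show "p 0 as = 1" for as unfolding p_def using statesD(2)[OF \<rho>] by simp
    show "0 \<le> p n as" for n as unfolding p_def by (rule psd_trace(2)[OF wpsd])
    show "p n as = p n bs" if "\<And>i. i < n \<Longrightarrow> as i = bs i" for n as bs
      unfolding p_def using instr_cong[OF that] by simp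
  qed (rule cons)
  then obtain Q where Q: "prob_space Q" "sets Q = sets seq_space" "\<And>n as. measure Q (cyl n as) = p n as" by blast
  have cyl: "{x \<in> space seq_space. \<forall>i<n. x i = as i} = cyl n as" for n and as :: "nat \<Rightarrow> 'b"
    unfolding cyl_def space_seq_space by simp
  have "quenched \<theta> T \<rho> \<omega> = Q" unfolding quenched_def cyl pc[symmetric] of_real_eq_iff
    using Q by (intro the_equality) (auto intro!: seq_measure_unique)
  with Q show "prob_space (quenched \<theta> T \<rho> \<omega>)" "sets (quenched \<theta> T \<rho> \<omega>) = sets seq_space"
    "measure (quenched \<theta> T \<rho> \<omega>) (cyl n as) = Re (mtrace (instr_word \<theta> T as n \<omega> \<rho>))" by (auto simp: p_def)
qed

lemma quenched_ac:
  assumes G: "Good \<omega>" and s: "s \<in> states d" and \<rho>: "\<rho> \<in> states d"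
    and \<kappa>: "0 < \<kappa>" "\<And>g. \<kappa> * Re (cinner d g g) \<le> Re (herm_form d s g)"
  shows "absolutely_continuous (quenched \<theta> T s \<omega>) (quenched \<theta> T \<rho> \<omega>)"
proof -
  \<comment> \<open>A state is at most \<open>d^2\<close> times the identity, so
    \<open>c \<le> \<kappa> / d^2\<close> makes \<open>s - c \<rho>\<close> positive;
    \<open>c \<le> 1/2\<close> permits the division by \<open>1 - c\<close>.\<close>
  define c where "c = min (1/2) (\<kappa> / (real d)\<^sup>2)"
  have c: "0 < c" "c < 1" "c * (real d)\<^sup>2 \<le> \<kappa>" using \<kappa>(1) d_pos unfolding c_def
    by (auto simp: min_def field_simps)
  note sc = statesD(3)[OF s] and \<rho>c = statesD(3)[OF \<rho>]
  define \<sigma> where "\<sigma> = complex_of_real (1 / (1 - c)) \<cdot>\<^sub>m (s - complex_of_real c \<cdot>\<^sub>m \<rho>)"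
  have \<sigma>c: "\<sigma> \<in> carrier_mat d d" unfolding \<sigma>_def using sc \<rho>c by auto
  have s_eq: "s = complex_of_real c \<cdot>\<^sub>m \<rho> + complex_of_real (1 - c) \<cdot>\<^sub>m \<sigma>"
    unfolding \<sigma>_def using c sc \<rho>c by (intro eq_matI) (auto simp: field_simps simp flip: of_real_diff of_real_mult)
  have "psd d \<sigma>"
  proof (rule psdI[OF \<sigma>c])
    fix i j assume ij: "i < d" "j < d"
    have "s $$ (i,j) = cnj (s $$ (j,i))" "\<rho> $$ (i,j) = cnj (\<rho> $$ (j,i))"
      using statesD(1)[OF s] statesD(1)[OF \<rho>] ij unfolding psd_iff hermitian_def by blast+
    then have "s $$ (i,j) - of_real c * \<rho> $$ (i,j) = cnj (s $$ (j,i) - of_real c * \<rho> $$ (j,i))" by simp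
    then show "\<sigma> $$ (i,j) = cnj (\<sigma> $$ (j,i))"
      unfolding \<sigma>_def using ij sc \<rho>c by simp
  next
    fix f
    have "c * Re (herm_form d \<rho> f) \<le> c * ((real d)\<^sup>2 * Re (cinner d f f))"
      using psd_herm_form_le[OF statesD(1)[OF \<rho>], of f] statesD(2)[OF \<rho>] c by (intro mult_left_mono) auto
    also have "\<dots> \<le> \<kappa> * Re (cinner d f f)"
      using c(3) cinner_self_nonneg[of d f] by (simp add: mult.assoc[symmetric] mult_right_mono)
    also have "\<dots> \<le> Re (herm_form d s f)" by (rule \<kappa>(2))
    finally have "0 \<le> Re (herm_form d (s - complex_of_real c \<cdot>\<^sub>m \<rho>) f)"
      using sc \<rho>c by (simp add: herm_form_minus herm_form_smult)
    moreover have "herm_form d \<sigma> f = complex_of_real (1 / (1 - c)) * herm_form d (s - complex_of_real c \<cdot>\<^sub>m \<rho>) f"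
      unfolding \<sigma>_def using sc \<rho>c by (intro herm_form_smult) auto
    ultimately show "0 \<le> Re (herm_form d \<sigma> f)" using c by simp
  qed
  moreover have "mtrace \<sigma> = 1"
  proof -
    have "s - complex_of_real c \<cdot>\<^sub>m \<rho> \<in> carrier_mat d d" using sc \<rho>c by auto
    then have "mtrace \<sigma> = complex_of_real (1 / (1 - c)) * (mtrace s - complex_of_real c * mtrace \<rho>)"
      unfolding \<sigma>_def mtrace_minus[OF sc smult_carrier_mat[OF \<rho>c], symmetric] mtrace_smult[OF \<rho>c, symmetric]
      by (rule mtrace_smult)
    also have "\<dots> = complex_of_real (1 / (1 - c) * (1 - c))"
      unfolding statesD(2)[OF s] statesD(2)[OF \<rho>] of_real_mult of_real_diff by simp
    finally show ?thesis using c by simp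
  qed
  ultimately have \<sigma>: "\<sigma> \<in> states d" unfolding states_def by simp
  have cylm: "measure (quenched \<theta> T s \<omega>) (cyl n as) =
    c * measure (quenched \<theta> T \<rho> \<omega>) (cyl n as) + (1 - c) * measure (quenched \<theta> T \<sigma> \<omega>) (cyl n as)" for n as
  proof -
    let ?W = "instr_word \<theta> T as n \<omega>"
    have L: "lin_map d ?W" using instr_pos unfolding pos_map_def by blast
    have "?W s = complex_of_real c \<cdot>\<^sub>m ?W \<rho> + complex_of_real (1 - c) \<cdot>\<^sub>m ?W \<sigma>"
      by (subst s_eq) (use \<rho>c \<sigma>c in \<open>simp add: lin_mapD[OF L]\<close>)
    then have "mtrace (?W s) = complex_of_real c * mtrace (?W \<rho>) + complex_of_real (1 - c) * mtrace (?W \<sigma>)"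
      using lin_mapD(1)[OF L \<rho>c] lin_mapD(1)[OF L \<sigma>c] by (simp add: mtrace_add[of _ d] mtrace_smult[of _ d])
    then show ?thesis unfolding quenched_props(3)[OF G s] quenched_props(3)[OF G \<rho>] quenched_props(3)[OF G \<sigma>]
      by (simp del: of_real_diff)
  qed
  interpret Qs: prob_space "quenched \<theta> T s \<omega>" by (rule quenched_props[OF G s])
  interpret Q\<rho>: prob_space "quenched \<theta> T \<rho> \<omega>" by (rule quenched_props[OF G \<rho>])
  show ?thesis unfolding absolutely_continuous_def
  proof
    fix A assume "A \<in> null_sets (quenched \<theta> T s \<omega>)"
    then have A: "A \<in> sets seq_space" and 0: "measure (quenched \<theta> T s \<omega>) A = 0"
      using quenched_props(2)[OF G s] by (auto simp: null_sets_def measure_def)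
    have "c * measure (quenched \<theta> T \<rho> \<omega>) A + (1 - c) * measure (quenched \<theta> T \<sigma> \<omega>) A = 0"
      using seq_measure_mixture[OF quenched_props(1,2)[OF G s] quenched_props(1,2)[OF G \<rho>]
          quenched_props(1,2)[OF G \<sigma>] cylm A] 0 by simp
    moreover have "0 \<le> (1 - c) * measure (quenched \<theta> T \<sigma> \<omega>) A" using c by simp
    ultimately have "c * measure (quenched \<theta> T \<rho> \<omega>) A \<le> 0" by linarith
    then have "measure (quenched \<theta> T \<rho> \<omega>) A = 0" using c by (simp add: mult_le_0_iff measure_le_0_iff)
    then show "A \<in> null_sets (quenched \<theta> T \<rho> \<omega>)"
      using A quenched_props(2)[OF G \<rho>] by (auto simp: null_sets_def Q\<rho>.emeasure_eq_measure)
  qed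
qed

text \<open>Stationarity makes this a difference of two states under the same map. The constant
  collects \<open>d\<close> from \<open>trace_norm_hermitian_le\<close> and \<open>2 d^2\<close>
  from \<open>Phi_diff\<close>.\<close>

lemma trace_norm_bound:
  assumes s: "dyn_stationary d M \<theta> T s" and \<phi>0: "random_state d M \<phi>0"
  shows "(\<integral>\<omega>. trace_norm (Phi n \<omega> (\<phi>0 \<omega>) - s ((\<theta> ^^ n) \<omega>)) \<partial>M) \<le> 2 * real d ^ 3 * b n"
proof (cases "integrable M (\<lambda>\<omega>. trace_norm (Phi n \<omega> (\<phi>0 \<omega>) - s ((\<theta> ^^ n) \<omega>)))")
  case True
  have "AE \<omega> in M. trace_norm (Phi n \<omega> (\<phi>0 \<omega>) - s ((\<theta> ^^ n) \<omega>)) \<le> 2 * real d ^ 3 * D n \<omega>"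
  proof -
    have "AE \<omega> in M. \<forall>n. Phi n \<omega> (s \<omega>) = s ((\<theta> ^^ n) \<omega>)" using s unfolding dyn_stationary_def by blast
    from this AE_space show ?thesis
    proof eventually_elim
      case (elim \<omega>)
      have st: "\<phi>0 \<omega> \<in> states d" "s \<omega> \<in> states d"
        using s \<phi>0 elim(2) unfolding dyn_stationary_def random_state_def by auto
      let ?X = "Phi n \<omega> (\<phi>0 \<omega>)" and ?Y = "Phi n \<omega> (s \<omega>)"
      have p: "psd d ?X" "psd d ?Y" using Phi_pos statesD(1) st unfolding pos_map_def by blast+
      then have "hermitian d ?X" "hermitian d ?Y" "?X \<in> carrier_mat d d" "?Y \<in> carrier_mat d d" unfolding psd_iff by auto
      then have H: "hermitian d (?X - ?Y)" "?X - ?Y \<in> carrier_mat d d"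
        by (auto intro: hermitian_minus)
      have "trace_norm (?X - ?Y) \<le> real d * enorm d (?X - ?Y)"
        unfolding enorm_def by (rule trace_norm_hermitian_le[OF H(2,1)])
      also have "\<dots> \<le> real d * (2 * (real d)\<^sup>2 * D n \<omega>)"
        by (intro mult_left_mono Phi_diff st) auto
      finally show ?case using elim(1) by (simp add: power2_eq_square power3_eq_cube mult_ac)
    qed
  qed
  from integral_mono_AE[OF True _ this] show ?thesis by (simp add: D_integrable b_def)
next
  \<comment> \<open>The integral of a function that is not integrable is 0 by convention, and
    \<open>b n\<close> is nonnegative.\<close>
  case False
  then show ?thesis using b_nonneg by (simp add: not_integrable_integral_eq)
qed

end

section \<open>Decay under mixing\<close>

context prob_space
begin

lemma covariance_Cauchy_Schwarz:
  fixes U V :: "'a \<Rightarrow> real"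
  assumes [measurable]: "U \<in> borel_measurable M" "V \<in> borel_measurable M"
    and U2: "integrable M (\<lambda>x. (U x)\<^sup>2)" and V2: "integrable M (\<lambda>x. (V x)\<^sup>2)"
  shows "(expectation (\<lambda>x. U x * V x) - expectation U * expectation V)\<^sup>2 \<le>
    (expectation (\<lambda>x. (U x)\<^sup>2) - (expectation U)\<^sup>2) * (expectation (\<lambda>x. (V x)\<^sup>2) - (expectation V)\<^sup>2)"
proof -
  have U1: "integrable M U" and V1: "integrable M V"
    by (auto intro: square_integrable_imp_integrable U2 V2)
  have UV: "integrable M (\<lambda>x. U x * V x)"
  proof (rule Bochner_Integration.integrable_bound[OF Bochner_Integration.integrable_add[OF U2 V2]])
    have "\<bar>U x * V x\<bar> \<le> (U x)\<^sup>2 + (V x)\<^sup>2" for x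
    proof -
      have "2 * (\<bar>U x\<bar> * \<bar>V x\<bar>) \<le> (U x)\<^sup>2 + (V x)\<^sup>2"
        using sum_squares_bound[of "\<bar>U x\<bar>" "\<bar>V x\<bar>"] by (simp add: mult.assoc)
      moreover have "0 \<le> \<bar>U x\<bar> * \<bar>V x\<bar>" by simp
      ultimately show ?thesis unfolding abs_mult by linarith
    qed
    then show "AE x in M. norm (U x * V x) \<le> norm ((U x)\<^sup>2 + (V x)\<^sup>2)" by simp
  qed simp
  define u where "u = expectation U"
  define v where "v = expectation V"
  define a where "a = expectation (\<lambda>x. (U x)\<^sup>2) - u\<^sup>2"
  define c where "c = expectation (\<lambda>x. (V x)\<^sup>2) - v\<^sup>2"
  define w where "w = expectation (\<lambda>x. U x * V x) - u * v"
  have q: "0 \<le> a + 2 * t * w + t\<^sup>2 * c" for t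
  proof -
    have "0 \<le> expectation (\<lambda>x. ((U x - u) + t * (V x - v))\<^sup>2)"
      by (intro Bochner_Integration.integral_nonneg) simp
    also have "(\<lambda>x. ((U x - u) + t * (V x - v))\<^sup>2) = (\<lambda>x. (U x)\<^sup>2 + 2 * t * (U x * V x) + t\<^sup>2 * (V x)\<^sup>2
        - 2 * (u + t * v) * U x - 2 * t * (u + t * v) * V x + (u + t * v)\<^sup>2)"
      by (auto simp: power2_eq_square algebra_simps)
    also have "expectation \<dots> = expectation (\<lambda>x. (U x)\<^sup>2) + 2 * t * expectation (\<lambda>x. U x * V x)
        + t\<^sup>2 * expectation (\<lambda>x. (V x)\<^sup>2) - 2 * (u + t * v) * u - 2 * t * (u + t * v) * v + (u + t * v)\<^sup>2"
      using U1 V1 U2 V2 UV by (simp add: prob_space u_def v_def)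
    also have "\<dots> = a + 2 * t * w + t\<^sup>2 * c"
      unfolding a_def c_def w_def by (simp add: power2_eq_square algebra_simps)
    finally show ?thesis .
  qed
  have c0: "0 \<le> c"
    using variance_positive[of V] variance_eq[OF V1 V2] unfolding c_def v_def by simp
  have "w\<^sup>2 \<le> a * c"
  \<comment> \<open>The quadratic \<open>q\<close> is the variance of \<open>U + t V\<close>. If
    \<open>V\<close> has variance 0, it degenerates to an affine function of \<open>t\<close>,
    nonnegative only with slope 0; otherwise the minimiser \<open>t = - w / c\<close> gives the
    discriminant inequality.\<close>
  proof (cases "c = 0")
    case True
    have "w = 0"
    proof (rule ccontr)
      assume "w \<noteq> 0"
      then have "2 * (- (\<bar>a\<bar> + 1) / w) * w = - 2 * (\<bar>a\<bar> + 1)" by simp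
      then show False using q[of "- (\<bar>a\<bar> + 1) / w"] True by simp
    qed
    then show ?thesis using True by simp
  next
    case False
    with c0 have c: "c > 0" by simp
    have "0 \<le> a + 2 * (- w / c) * w + (- w / c)\<^sup>2 * c" by (rule q)
    also have "\<dots> = a - w\<^sup>2 / c" using c by (simp add: power2_eq_square field_simps)
    finally show ?thesis using c by (simp add: field_simps)
  qed
  then show ?thesis unfolding a_def c_def w_def u_def v_def .
qed

text \<open>Supplies the upper bound without which the \<open>Sup\<close> in \<open>max_corr\<close>
  would not be a genuine supremum.\<close>

lemma corr_le_1:
  assumes "U \<in> borel_measurable M" "V \<in> borel_measurable M"
    "integrable M (\<lambda>x. (U x)\<^sup>2)" "integrable M (\<lambda>x. (V x)\<^sup>2)"
  shows "\<bar>corr M U V\<bar> \<le> 1"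
proof -
  have "\<bar>expectation (\<lambda>x. U x * V x) - expectation U * expectation V\<bar> \<le>
    sqrt ((expectation (\<lambda>x. (U x)\<^sup>2) - (expectation U)\<^sup>2) * (expectation (\<lambda>x. (V x)\<^sup>2) - (expectation V)\<^sup>2))"
    using covariance_Cauchy_Schwarz[OF assms] by (rule real_le_rsqrt[of "\<bar>_\<bar>", simplified])
  then show ?thesis unfolding corr_def abs_divide
    by (intro divide_le_eq_1[THEN iffD2]) (auto simp: less_le)
qed

lemma max_corr_bounds:
  assumes B: "subalgebra M B" and C: "subalgebra M C"
  shows "0 \<le> max_corr M B C" "max_corr M B C \<le> 1"
    "U \<in> L2_nonconst M B \<Longrightarrow> V \<in> L2_nonconst M C \<Longrightarrow> \<bar>corr M U V\<bar> \<le> max_corr M B C"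
proof -
  let ?S = "{0} \<union> {\<bar>corr M U V\<bar> | U V. U \<in> L2_nonconst M B \<and> V \<in> L2_nonconst M C}"
  have le1: "x \<le> 1" if "x \<in> ?S" for x
  proof -
    have "\<bar>corr M U V\<bar> \<le> 1" if "U \<in> L2_nonconst M B" "V \<in> L2_nonconst M C" for U V
    proof -
      have U: "U \<in> borel_measurable B" "integrable M (\<lambda>\<omega>. (U \<omega>)\<^sup>2)"
        using that(1) unfolding L2_nonconst_def by blast+
      have V: "V \<in> borel_measurable C" "integrable M (\<lambda>\<omega>. (V \<omega>)\<^sup>2)"
        using that(2) unfolding L2_nonconst_def by blast+
      show ?thesis
        by (rule corr_le_1[OF measurable_from_subalg[OF B U(1)] measurable_from_subalg[OF C V(1)] U(2) V(2)])
    qed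
    then show ?thesis using that by auto
  qed
  then have bdd: "bdd_above ?S" by (rule bdd_aboveI)
  show "0 \<le> max_corr M B C" unfolding max_corr_def by (rule cSup_upper[OF _ bdd]) simp
  show "max_corr M B C \<le> 1" unfolding max_corr_def by (rule cSup_least) (use le1 in auto)
  show "\<bar>corr M U V\<bar> \<le> max_corr M B C" if "U \<in> L2_nonconst M B" "V \<in> L2_nonconst M C"
    unfolding max_corr_def by (rule cSup_upper[OF _ bdd]) (use that in blast)
qed

text \<open>The covariance is the correlation times the two standard deviations, which are enlarged
  to second-moment norms, the only quantities estimated later.\<close>

lemma max_corr_product_le:
  fixes U V :: "'a \<Rightarrow> real"
  assumes B: "subalgebra M B" and C: "subalgebra M C"
    and UB: "U \<in> borel_measurable B" and VC: "V \<in> borel_measurable C"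
    and U2: "integrable M (\<lambda>x. (U x)\<^sup>2)" and V2: "integrable M (\<lambda>x. (V x)\<^sup>2)"
  shows "expectation (\<lambda>x. U x * V x) \<le> expectation U * expectation V +
    max_corr M B C * sqrt (expectation (\<lambda>x. (U x)\<^sup>2) * expectation (\<lambda>x. (V x)\<^sup>2))"
proof -
  let ?r = "max_corr M B C"
  have [measurable]: "U \<in> borel_measurable M" "V \<in> borel_measurable M"
    using measurable_from_subalg B C UB VC by auto
  have r: "0 \<le> ?r" by (rule max_corr_bounds[OF B C])
  have nn: "0 \<le> expectation (\<lambda>x. (U x)\<^sup>2)" "0 \<le> expectation (\<lambda>x. (V x)\<^sup>2)"
    by (auto intro!: Bochner_Integration.integral_nonneg)
  let ?cov = "expectation (\<lambda>x. U x * V x) - expectation U * expectation V"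
  let ?p = "(expectation (\<lambda>x. (U x)\<^sup>2) - (expectation U)\<^sup>2) * (expectation (\<lambda>x. (V x)\<^sup>2) - (expectation V)\<^sup>2)"
  have "?cov \<le> ?r * sqrt (expectation (\<lambda>x. (U x)\<^sup>2) * expectation (\<lambda>x. (V x)\<^sup>2))"
  proof (cases "U \<in> L2_nonconst M B \<and> V \<in> L2_nonconst M C")
    case True
    have CS: "?cov\<^sup>2 \<le> ?p" by (rule covariance_Cauchy_Schwarz) (use U2 V2 in auto)
    have p: "?p \<le> expectation (\<lambda>x. (U x)\<^sup>2) * expectation (\<lambda>x. (V x)\<^sup>2)"
    proof (rule mult_mono)
      have "0 \<le> variance V" by (rule variance_positive)
      then show "0 \<le> expectation (\<lambda>x. (V x)\<^sup>2) - (expectation V)\<^sup>2"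
        using variance_eq[OF square_integrable_imp_integrable V2] V2 by simp
    qed (use nn in auto)
    show ?thesis
    \<comment> \<open>With vanishing denominator \<open>corr\<close> is 0 by convention and carries
      no information; Cauchy-Schwarz then kills the covariance directly.\<close>
    proof (cases "?p = 0")
      case True
      with CS have "?cov = 0" by simp
      then show ?thesis using r nn by simp
    next
      case False
      with CS have p0: "?p > 0" by (smt (verit) zero_le_power2)
      have "\<bar>corr M U V\<bar> \<le> ?r" using max_corr_bounds(3)[OF B C] True by blast
      then have "?cov / sqrt ?p \<le> ?r" unfolding corr_def by (rule order_trans[OF abs_ge_self])
      then have "?cov \<le> ?r * sqrt ?p" using p0 by (simp add: pos_divide_le_eq)
      also have "\<dots> \<le> ?r * sqrt (expectation (\<lambda>x. (U x)\<^sup>2) * expectation (\<lambda>x. (V x)\<^sup>2))"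
        using p r by (intro mult_left_mono real_sqrt_le_mono) auto
      finally show ?thesis .
    qed
  next
    \<comment> \<open>Almost surely constant variables are left out of the supremum in
      \<open>max_corr\<close>, but their covariance with anything is 0.\<close>
    case False
    then have "(\<exists>c. AE x in M. U x = c) \<or> (\<exists>c. AE x in M. V x = c)"
      using UB VC U2 V2 unfolding L2_nonconst_def by blast
    then have "?cov = 0"
    proof
      assume "\<exists>c. AE x in M. U x = c"
      then obtain c where c: "AE x in M. U x = c" by blast
      have "expectation U = expectation (\<lambda>_. c)" by (rule integral_cong_AE) (use c in auto)
      moreover have "expectation (\<lambda>x. U x * V x) = expectation (\<lambda>x. c * V x)"
        by (rule integral_cong_AE) (use c in auto)
      ultimately show ?thesis by (simp add: prob_space)
    next
      assume "\<exists>c. AE x in M. V x = c"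
      then obtain c where c: "AE x in M. V x = c" by blast
      have "expectation V = expectation (\<lambda>_. c)" by (rule integral_cong_AE) (use c in auto)
      moreover have "expectation (\<lambda>x. U x * V x) = expectation (\<lambda>x. U x * c)"
        by (rule integral_cong_AE) (use c in auto)
      ultimately show ?thesis by (simp add: prob_space)
    qed
    then show ?thesis using r nn by simp
  qed
  then show ?thesis by simp
qed

end

text \<open>Iterating \<open>n \<mapsto> 2 * n + m\<close> gives times \<open>q j\<close> that grow
  at most like \<open>3^j\<close>, while \<open>b\<close> shrinks there by \<epsilon> at each step.
  Monotonicity up to \<open>K\<close> fills the gaps between these times.\<close>

lemma doubling_decay_summable:
  fixes b :: "nat \<Rightarrow> real"
  assumes nonneg: "\<And>n. 0 \<le> b n" and "0 < K" and mono: "\<And>m n. m \<le> n \<Longrightarrow> b n \<le> K * b m"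
    and doubling: "\<And>\<epsilon>. 0 < \<epsilon> \<Longrightarrow> \<exists>m N. \<forall>n\<ge>N. b (2 * n + m) \<le> \<epsilon> * b n"
    and "0 < t" "0 \<le> C"
  shows "summable (\<lambda>n. (C * b n) powr t)"
proof -
  \<comment> \<open>\<open>n \<mapsto> 2 * n + m\<close> at most triples \<open>n\<close>, so this factor makes the summands \<open>O(1 / n\<^sup>2)\<close>.\<close>
  define \<epsilon> where "\<epsilon> = (1/9 :: real) powr (1 / t)"
  have \<epsilon>: "0 < \<epsilon>" "\<epsilon> powr t = 1/9" using \<open>0 < t\<close> unfolding \<epsilon>_def by (auto simp: powr_powr)
  obtain m N where mN: "\<And>n. n \<ge> N \<Longrightarrow> b (2 * n + m) \<le> \<epsilon> * b n" using doubling[OF \<epsilon>(1)] by blast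
  \<comment> \<open>At least \<open>N\<close>, so that doubling applies from the start, at least
    \<open>m\<close>, so that \<open>2 * q j + m \<le> 3 * q j\<close>, and positive.\<close>
  define n1 where "n1 = N + m + 1"
  define q where "q = rec_nat n1 (\<lambda>_ x. 2 * x + m)"
  have q: "q 0 = n1" "q (Suc j) = 2 * q j + m" for j unfolding q_def by auto
  have qge: "n1 \<le> q j" for j by (induction j) (auto simp: q)
  have qle: "q j \<le> 3 ^ j * n1" for j
  proof (induction j)
    case (Suc j)
    have "m \<le> q j" using qge[of j] unfolding n1_def by simp
    then show ?case using Suc by (simp add: q)
  qed (simp add: q)
  have bq: "b (q j) \<le> \<epsilon> ^ j * b n1" for j
  proof (induction j)
    case (Suc j)
    have "b (q (Suc j)) \<le> \<epsilon> * b (q j)" unfolding q using qge[of j] by (intro mN) (simp add: n1_def)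
    also have "\<dots> \<le> \<epsilon> * (\<epsilon> ^ j * b n1)" using Suc \<epsilon> by (intro mult_left_mono) auto
    finally show ?case by simp
  qed (simp add: q)
  define A where "A = (C * (K * b n1)) powr t"
  have main: "(C * b n) powr t \<le> A * 9 * (real n1)\<^sup>2 * (1 / (real n)\<^sup>2)" if n: "n1 \<le> n" for n
  proof -
    have n10: "0 < n1" unfolding n1_def by simp
    \<comment> \<open>\<open>j\<close> is the integer part of the base 3 logarithm of
      \<open>n / n1\<close>. The lower bound puts \<open>q j\<close> before \<open>n\<close>; the
      upper one turns \<open>9^(-j)\<close> into a multiple of \<open>1 / n^2\<close>.\<close>
    have "1 \<le> n div n1" using n n10 by (simp add: div_greater_zero_iff Suc_le_eq)
    then obtain j where j: "3 ^ j \<le> n div n1" "n div n1 < 3 ^ (j + 1)"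
      using ex_power_ivl1[of 3 "n div n1"] by auto
    have lo: "3 ^ j * n1 \<le> n" using j(1) n10 by (metis less_eq_div_iff_mult_less_eq)
    have hi: "n < 3 ^ (j + 1) * n1" using j(2) n10 by (metis div_less_iff_less_mult)
    have "b n \<le> K * b (q j)" using lo qle[of j] by (intro mono) simp
    also have "\<dots> \<le> K * (\<epsilon> ^ j * b n1)" using bq \<open>0 < K\<close> by (intro mult_left_mono) auto
    finally have "C * b n \<le> \<epsilon> ^ j * (C * (K * b n1))"
      using \<open>0 \<le> C\<close> mult_left_mono[of "b n" "K * (\<epsilon> ^ j * b n1)" C] by (simp add: mult_ac)
    then have "(C * b n) powr t \<le> (\<epsilon> ^ j * (C * (K * b n1))) powr t"
      using \<open>0 < t\<close> \<open>0 \<le> C\<close> nonneg by (intro powr_mono2) auto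
    also have "\<dots> = (\<epsilon> ^ j) powr t * A"
      unfolding A_def by (rule powr_mult)
    also have "(\<epsilon> ^ j) powr t = (1/9) ^ j"
    proof -
      have "(\<epsilon> ^ j) powr t = (\<epsilon> powr t) ^ j"
        using \<epsilon>(1) by (simp add: powr_realpow[symmetric] powr_powr mult.commute)
      then show ?thesis using \<epsilon>(2) by simp
    qed
    also have "(1/9) ^ j * A \<le> (9 * (real n1)\<^sup>2 * (1 / (real n)\<^sup>2)) * A"
    proof (rule mult_right_mono)
      have "real n \<le> 3 ^ (j + 1) * real n1" 
      proof -
        have "real n \<le> real (3 ^ (j + 1) * n1)" using hi by (intro of_nat_mono) simp
        then show ?thesis by simp
      qed
      then have "(real n)\<^sup>2 \<le> (3 ^ (j + 1) * real n1)\<^sup>2" by (intro power_mono) auto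
      also have "\<dots> = 9 * 9 ^ j * (real n1)\<^sup>2" 
      proof -
        have nine: "(9::real) ^ j = 3 ^ j * 3 ^ j" by (simp flip: power_mult_distrib)
        show ?thesis unfolding nine by (simp add: power2_eq_square)
      qed
      finally have "(real n)\<^sup>2 \<le> 9 * 9 ^ j * (real n1)\<^sup>2" .
      moreover have "0 < real n" using n n10 by simp
      ultimately show "(1/9) ^ j \<le> 9 * (real n1)\<^sup>2 * (1 / (real n)\<^sup>2)"
        by (simp add: power_one_over field_simps)
      show "0 \<le> A" unfolding A_def by simp
    qed
    finally show ?thesis by (simp add: mult_ac)
  qed
  have "summable (\<lambda>n. A * 9 * (real n1)\<^sup>2 * (1 / (real n)\<^sup>2))"
    using inverse_power_summable[of 2, where 'a=real] by (intro summable_mult) (simp add: inverse_eq_divide)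
  then show ?thesis
    by (rule summable_comparison_test'[where N=n1]) (use main in auto)
qed

section \<open>Past and future events and the recursion for the mean norm\<close>

context random_channel
begin

lemma theta_pow_int_meas: "theta_pow M \<theta> j \<in> M \<rightarrow>\<^sub>M M"
  unfolding theta_pow_def \<theta>i_def[symmetric] by auto

lemma instr_gen_sets: "instr_gen d M \<theta> T J \<subseteq> sets M"
proof
  fix A assume "A \<in> instr_gen d M \<theta> T J"
  then obtain a j g B where A: "A = {\<omega> \<in> space M. g (T a (theta_pow M \<theta> j \<omega>)) \<in> B}" "g \<in> map_coords d" "B \<in> sets borel"
    unfolding instr_gen_def by blast
  have "(\<lambda>\<omega>. g (T a (theta_pow M \<theta> j \<omega>))) \<in> borel_measurable M"
    by (rule measurable_compose[OF theta_pow_int_meas T_coord_meas[OF A(2)]])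
  from measurable_sets[OF this A(3)] show "A \<in> sets M"
    unfolding A(1) by (simp add: vimage_def Int_def conj_commute)
qed

lemma instr_alg:
  shows "space (sigma (space M) (instr_gen d M \<theta> T J)) = space M"
    and "subalgebra M (sigma (space M) (instr_gen d M \<theta> T J))"
    and "j \<in> J \<Longrightarrow> g \<in> map_coords d \<Longrightarrow>
      (\<lambda>\<omega>. g (T a (theta_pow M \<theta> j \<omega>))) \<in> borel_measurable (sigma (space M) (instr_gen d M \<theta> T J))"
proof -
  have P: "instr_gen d M \<theta> T J \<subseteq> Pow (space M)" using instr_gen_sets sets.sets_into_space by blast
  show sp: "space (sigma (space M) (instr_gen d M \<theta> T J)) = space M" by (rule space_measure_of[OF P])
  have "sets (sigma (space M) (instr_gen d M \<theta> T J)) \<subseteq> sets M"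
    unfolding sets_measure_of[OF P] by (rule sets.sigma_sets_subset[OF instr_gen_sets])
  then show "subalgebra M (sigma (space M) (instr_gen d M \<theta> T J))" unfolding subalgebra_def sp by simp
  show "(\<lambda>\<omega>. g (T a (theta_pow M \<theta> j \<omega>))) \<in> borel_measurable (sigma (space M) (instr_gen d M \<theta> T J))"
    if "j \<in> J" "g \<in> map_coords d"
  proof (rule measurableI)
    fix B :: "real set" assume B: "B \<in> sets borel"
    have "{\<omega> \<in> space M. g (T a (theta_pow M \<theta> j \<omega>)) \<in> B} \<in> instr_gen d M \<theta> T J"
      unfolding instr_gen_def using that B by blast
    then have "{\<omega> \<in> space M. g (T a (theta_pow M \<theta> j \<omega>)) \<in> B} \<in> sets (sigma (space M) (instr_gen d M \<theta> T J))"
      unfolding sets_measure_of[OF P] by (rule sigma_sets.Basic)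
    then show "(\<lambda>\<omega>. g (T a (theta_pow M \<theta> j \<omega>))) -` B \<inter> space (sigma (space M) (instr_gen d M \<theta> T J))
        \<in> sets (sigma (space M) (instr_gen d M \<theta> T J))"
      unfolding sp by (simp add: vimage_def Int_def conj_commute)
  qed simp
qed

lemma past_alg: "subalgebra M (past_alg d M \<theta> T k)" "D k \<in> borel_measurable (past_alg d M \<theta> T k)"
proof -
  show "subalgebra M (past_alg d M \<theta> T k)" unfolding past_alg_def by (rule instr_alg)
  have "(\<lambda>\<omega>. D k ((\<theta> ^^ 0) \<omega>)) \<in> borel_measurable (past_alg d M \<theta> T k)"
    unfolding past_alg_def
  proof (rule D_meas_gen[OF instr_alg(1)])
    fix i :: nat and a g assume "i \<le> k" "g \<in> map_coords d"
    then show "(\<lambda>\<omega>. g (T a ((\<theta> ^^ (i + 0)) \<omega>))) \<in> borel_measurable (sigma (space M) (instr_gen d M \<theta> T {j. j \<le> int k}))"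
      using instr_alg(3)[of "int i" "{j. j \<le> int k}" g a] by (simp add: theta_pow_def)
  qed
  then show "D k \<in> borel_measurable (past_alg d M \<theta> T k)" by simp
qed

text \<open>After a shift by \<open>m\<close> the first channel used is the one at time
  \<open>m + 1\<close>, hence the condition \<open>k \<le> Suc m\<close>.\<close>

lemma future_alg: "subalgebra M (future_alg d M \<theta> T k)"
  "k \<le> Suc m \<Longrightarrow> (\<lambda>\<omega>. D n ((\<theta> ^^ m) \<omega>)) \<in> borel_measurable (future_alg d M \<theta> T k)"
proof -
  show "subalgebra M (future_alg d M \<theta> T k)" unfolding future_alg_def by (rule instr_alg)
  show "(\<lambda>\<omega>. D n ((\<theta> ^^ m) \<omega>)) \<in> borel_measurable (future_alg d M \<theta> T k)" if "k \<le> Suc m"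
    unfolding future_alg_def
  proof (rule D_meas_gen[OF instr_alg(1)])
    fix i :: nat and a g assume i: "1 \<le> i" "g \<in> map_coords d"
    have "int (i + m) \<in> {j. int k \<le> j}" using that i by simp
    from instr_alg(3)[OF this i(2), of a]
    show "(\<lambda>\<omega>. g (T a ((\<theta> ^^ (i + m)) \<omega>))) \<in> borel_measurable (sigma (space M) (instr_gen d M \<theta> T {j. int k \<le> j}))"
      unfolding theta_pow_def by (simp del: of_nat_add)
  qed
qed

lemma max_corr_le_rho_mix:
  "max_corr M (past_alg d M \<theta> T k) (future_alg d M \<theta> T (k + n)) \<le> rho_mix d M \<theta> T n"
  unfolding rho_mix_def
  by (rule cSUP_upper) (auto intro!: bdd_aboveI[of _ 1] max_corr_bounds past_alg future_alg)

text \<open>Boundedness of \<open>D\<close> replaces the second moment by the mean. This keeps the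
  mixing term of the recursion linear in \<open>b n\<close>, so that a factor \<open>b n\<close> can
  be taken out.\<close>

lemma D_sq: "integrable M (\<lambda>\<omega>. (D n \<omega>)\<^sup>2)" "(\<integral>\<omega>. (D n \<omega>)\<^sup>2 \<partial>M) \<le> K * b n"
proof -
  have le: "AE \<omega> in M. (D n \<omega>)\<^sup>2 \<le> K * D n \<omega>"
    using AE_Good by eventually_elim (simp add: power2_eq_square mult_right_mono D_le_K D_nonneg)
  show 1: "integrable M (\<lambda>\<omega>. (D n \<omega>)\<^sup>2)"
    by (rule Bochner_Integration.integrable_bound[OF integrable_mult_right[OF D_integrable[of n], of K]])
       (use le in \<open>auto simp: abs_mult D_nonneg K_pos less_imp_le\<close>)
  from integral_mono_AE[OF 1 _ le] show "(\<integral>\<omega>. (D n \<omega>)\<^sup>2 \<partial>M) \<le> K * b n"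
    by (simp add: D_integrable b_def)
qed

text \<open>The \<open>2 * n + m\<close> steps are split into \<open>n\<close>, \<open>m\<close> and
  \<open>n\<close>, and the middle ones are dropped at the price of \<open>K\<close>. The first part
  is determined by times up to \<open>n\<close>, the last by times from \<open>n + m + 1\<close>, so
  the gap is \<open>Suc m\<close>. By stationarity both have the same moments, which removes the
  square root.\<close>

lemma b_recursion: "b (2 * n + m) \<le> (K * b n + K\<^sup>2 * rho_mix d M \<theta> T (Suc m)) * b n"
proof -
  let ?V = "\<lambda>\<omega>. D n ((\<theta> ^^ (n + m)) \<omega>)"
  let ?B = "past_alg d M \<theta> T n" and ?C = "future_alg d M \<theta> T (n + Suc m)"
  have V2: "integrable M (\<lambda>\<omega>. (?V \<omega>)\<^sup>2)"
    using integrable_distr[OF theta_pow_meas(1)[of "n + m"], of "\<lambda>\<omega>. (D n \<omega>)\<^sup>2"] D_sq(1) distr_pow by simp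
  have EV: "(\<integral>\<omega>. ?V \<omega> \<partial>M) = b n" unfolding b_def by (rule integral_pow(1)[OF D_meas])
  have EV2: "(\<integral>\<omega>. (?V \<omega>)\<^sup>2 \<partial>M) = (\<integral>\<omega>. (D n \<omega>)\<^sup>2 \<partial>M)"
    by (rule integral_pow(1)[where f="\<lambda>\<omega>. (D n \<omega>)\<^sup>2"]) measurable
  have E2: "0 \<le> (\<integral>\<omega>. (D n \<omega>)\<^sup>2 \<partial>M)" by (intro Bochner_Integration.integral_nonneg) simp
  have Vm [measurable]: "?V \<in> borel_measurable M" by (rule measurable_compose[OF theta_pow_meas(1) D_meas])
  have int: "integrable M (\<lambda>\<omega>. D n \<omega> * ?V \<omega>)"
  proof (rule Bochner_Integration.integrable_bound[OF integrable_mult_right[OF D_integrable[of n], of K]])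
    show "AE \<omega> in M. norm (D n \<omega> * ?V \<omega>) \<le> norm (K * D n \<omega>)"
      using AE_Good by eventually_elim (auto simp: abs_mult D_nonneg K_pos less_imp_le mult.commute[of K] intro!: mult_left_mono D_le_K Good_pow)
  qed measurable
  have "b (2 * n + m) \<le> (\<integral>\<omega>. K * (D n \<omega> * ?V \<omega>) \<partial>M)"
    unfolding b_def
  proof (rule integral_mono_AE)
    show "AE \<omega> in M. D (2 * n + m) \<omega> \<le> K * (D n \<omega> * ?V \<omega>)"
      using AE_Good
    proof eventually_elim
      case (elim \<omega>)
      have "D (2 * n + m) \<omega> \<le> ?V \<omega> * D (n + m) \<omega>" 
      proof -
        have eq: "2 * n + m = n + m + n" by simp
        show ?thesis unfolding eq by (rule D_add[OF elim])
      qed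
      also have "\<dots> \<le> ?V \<omega> * (K * D n \<omega>)" by (intro mult_left_mono D_mono elim D_nonneg) simp
      finally show ?case by (simp add: mult_ac)
    qed
  qed (use int D_integrable in auto)
  also have "\<dots> = K * (\<integral>\<omega>. D n \<omega> * ?V \<omega> \<partial>M)" by simp
  also have "\<dots> \<le> K * (b n * b n + rho_mix d M \<theta> T (Suc m) * (K * b n))"
  proof (rule mult_left_mono)
    have "(\<integral>\<omega>. D n \<omega> * ?V \<omega> \<partial>M) \<le> b n * b n + max_corr M ?B ?C *
        sqrt ((\<integral>\<omega>. (D n \<omega>)\<^sup>2 \<partial>M) * (\<integral>\<omega>. (D n \<omega>)\<^sup>2 \<partial>M))"
      using max_corr_product_le[OF past_alg(1)[of n] future_alg(1) past_alg(2)[of n] future_alg(2)[of "n + Suc m" "n + m" n] D_sq(1) V2]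
      unfolding EV EV2 by (simp add: b_def)
    also have "sqrt ((\<integral>\<omega>. (D n \<omega>)\<^sup>2 \<partial>M) * (\<integral>\<omega>. (D n \<omega>)\<^sup>2 \<partial>M)) = (\<integral>\<omega>. (D n \<omega>)\<^sup>2 \<partial>M)" using E2 by simp
    also have "max_corr M ?B ?C * (\<integral>\<omega>. (D n \<omega>)\<^sup>2 \<partial>M) \<le> rho_mix d M \<theta> T (Suc m) * (K * b n)"
      using max_corr_le_rho_mix[of n "Suc m"] max_corr_bounds(1)[OF past_alg(1)[of n] future_alg(1)[of "n + Suc m"]]
      by (intro mult_mono D_sq(2) E2) auto
    finally show "(\<integral>\<omega>. D n \<omega> * ?V \<omega> \<partial>M) \<le> b n * b n + rho_mix d M \<theta> T (Suc m) * (K * b n)" by simp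
  qed (use K_pos in simp)
  also have "\<dots> = (K * b n + K\<^sup>2 * rho_mix d M \<theta> T (Suc m)) * b n"
    by (simp add: power2_eq_square algebra_simps)
  finally show ?thesis .
qed

lemma mixing_summable:
  assumes mix: "rho_mix d M \<theta> T \<longlonglongrightarrow> 0" and "0 < t" "0 \<le> C"
  shows "summable (\<lambda>n. (C * b n) powr t)"
proof (rule doubling_decay_summable[OF b_nonneg K_pos b_mono _ \<open>0 < t\<close> \<open>0 \<le> C\<close>])
  fix \<epsilon> :: real assume \<epsilon>: "0 < \<epsilon>"
  have "(\<lambda>m. K\<^sup>2 * rho_mix d M \<theta> T (Suc m)) \<longlonglongrightarrow> K\<^sup>2 * 0"
    by (intro tendsto_mult tendsto_const LIMSEQ_Suc mix)
  from order_tendstoD(2)[OF this, of "\<epsilon> / 2"] \<epsilon> obtain m where m: "K\<^sup>2 * rho_mix d M \<theta> T (Suc m) < \<epsilon> / 2"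
    by (auto simp: eventually_sequentially)
  have "(\<lambda>n. K * b n) \<longlonglongrightarrow> K * 0" by (intro tendsto_mult tendsto_const b_tendsto_0)
  from order_tendstoD(2)[OF this, of "\<epsilon> / 2"] \<epsilon> obtain N where N: "\<And>n. n \<ge> N \<Longrightarrow> K * b n < \<epsilon> / 2"
    by (auto simp: eventually_sequentially)
  have "b (2 * n + m) \<le> \<epsilon> * b n" if "N \<le> n" for n
    using b_recursion[of n m] mult_right_mono[OF _ b_nonneg, of "K * b n + K\<^sup>2 * rho_mix d M \<theta> T (Suc m)" \<epsilon> n] N[OF that] m
    by linarith
  then show "\<exists>m N. \<forall>n\<ge>N. b (2 * n + m) \<le> \<epsilon> * b n" by blast
qed

end

theorem theorem1:
  fixes d :: nat and M :: "'w measure" and \<theta> :: "'w \<Rightarrow> 'w"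
    and T :: "'b::finite \<Rightarrow> 'w \<Rightarrow> complex mat \<Rightarrow> complex mat"
  assumes "0 < d"
    and "prob_space M"
    and "ergodic_mpt M \<theta>"
    and "random_instrument d M T"
    and ESP: "AE \<omega> in M. \<exists>N0. \<forall>n\<ge>N0. strictly_positive d (Phi_n d \<theta> T n \<omega>)"
  shows "\<exists>s. dyn_stationary d M \<theta> T s \<and>
     (\<forall>s'. dyn_stationary d M \<theta> T s' \<longrightarrow> (AE \<omega> in M. s' \<omega> = s \<omega>)) \<and>
     (\<forall>\<phi>0. random_state d M \<phi>0 \<longrightarrow>
        (AE \<omega> in M. absolutely_continuous (quenched \<theta> T (s \<omega>) \<omega>) (quenched \<theta> T (\<phi>0 \<omega>) \<omega>))) \<and>
     ((rho_mix d M \<theta> T \<longlonglongrightarrow> 0) \<longrightarrow>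
        (\<forall>\<delta>::real. 0 < \<delta> \<longrightarrow> (\<exists>r :: nat \<Rightarrow> real. (\<forall>n. 0 \<le> r n) \<and>
            summable (\<lambda>n. r (Suc n) powr (\<delta> / (2 + \<delta>))) \<and>
            (\<forall>\<phi>0. random_state d M \<phi>0 \<longrightarrow> (\<forall>n\<ge>1.
               (\<integral>\<omega>. trace_norm (Phi_n d \<theta> T n \<omega> (\<phi>0 \<omega>) - s ((\<theta> ^^ n) \<omega>)) \<partial>M) \<le> r n)))))"
proof -
  interpret prob_space M by fact
  interpret random_channel M d \<theta> T by unfold_locales (fact assms)+
  obtain s where s: "dyn_stationary d M \<theta> T s" and sl: "AE \<omega> in M. s \<omega> = lims \<omega>"
    using dyn_stationary_exists by blast
  have uniq: "AE \<omega> in M. s' \<omega> = s \<omega>" if "dyn_stationary d M \<theta> T s'" for s'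
    using dyn_stationary_lims[OF that] sl by eventually_elim simp
  have ac: "AE \<omega> in M. absolutely_continuous (quenched \<theta> T (s \<omega>) \<omega>) (quenched \<theta> T (\<phi>0 \<omega>) \<omega>)"
    if \<phi>0: "random_state d M \<phi>0" for \<phi>0
    using dyn_stationary_pd[OF s] AE_Good AE_space
  proof eventually_elim
    case (elim \<omega>)
    have "s \<omega> \<in> states d" "\<phi>0 \<omega> \<in> states d"
      using s \<phi>0 elim(3) unfolding dyn_stationary_def random_state_def by auto
    with elim show ?case using quenched_ac by blast
  qed
  have rate: "\<exists>r :: nat \<Rightarrow> real. (\<forall>n. 0 \<le> r n) \<and> summable (\<lambda>n. r (Suc n) powr (\<delta> / (2 + \<delta>))) \<and>
      (\<forall>\<phi>0. random_state d M \<phi>0 \<longrightarrow> (\<forall>n\<ge>1.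
         (\<integral>\<omega>. trace_norm (Phi_n d \<theta> T n \<omega> (\<phi>0 \<omega>) - s ((\<theta> ^^ n) \<omega>)) \<partial>M) \<le> r n))"
    if mix: "rho_mix d M \<theta> T \<longlonglongrightarrow> 0" and "0 < \<delta>" for \<delta> :: real
  \<comment> \<open>One sequence, independent of \<delta> and of the initial state, serves
    throughout: \<delta> enters only as the positive exponent in
    \<open>mixing_summable\<close>.\<close>
  proof (intro exI[of _ "\<lambda>n. 2 * real d ^ 3 * b n"] conjI allI impI)
    show "summable (\<lambda>n. (2 * real d ^ 3 * b (Suc n)) powr (\<delta> / (2 + \<delta>)))"
      using mixing_summable[OF mix, of "\<delta> / (2 + \<delta>)" "2 * real d ^ 3"] \<open>0 < \<delta>\<close>
      by (subst summable_Suc_iff) simp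
  qed (use b_nonneg trace_norm_bound[OF s] in auto)
  from s uniq ac rate show ?thesis by blast
qed

end
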